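(* Let $m\in\{1,2,4,8\}$ and let $V$ be the representation of dimension $n=3m+3$ of the corresponding Lie algebra $\mathfrak g$ in the $e_6$ series. Then $$\check R(u)=4\,\mathbf 1-u\,P+\frac{(4m+8)u}{2m-u}\,K\in \mathrm{End}(V\otimes V)$$ satisfies the Yang–Baxter equation $$(\check R(u)\otimes 1)(1\otimes\check R(u+v))(\check R(v)\otimes 1)=(1\otimes\check R(v))(\check R(u+v)\otimes 1)(1\otimes\check R(u))$$ in $\mathrm{End}(V\otimes V\otimes V)$, as an identity of rational functions of $u,v$.
   Context: Work over $\mathbb{C}$, with repeated indices summed. The $e_6$ series consists of the following pairs $(\mathfrak g,V)$ with $\dim V=n=3m+3$: $m=1$: $\mathfrak g=a_2$, $V=\mathrm{Sym}^2\mathbb{C}^3$; $m=2$: $\mathfrak g=a_2\times a_2$, $V=\mathbb{C}^3\otimes\mathbb{C}^3$; $m=4$: $\mathfrak g=a_5$, $V=\Lambda^2\mathbb{C}^6$; $m=8$: $\mathfrak g=e_6$, $V$ the $27$-dimensional irreducible representation. (Equivalently, $V$ is the complexification of the space of $3\times3$ hermitian matrices over the real division algebra of dimension $m$, and the cubic invariant is the determinant.) In each case the spaces of $\mathfrak g$-invariants in $\mathrm{Sym}^3(V^* )$ and $\mathrm{Sym}^3(V)$ are one-dimensional; $d_{abc}$ and $d^{abc}$ denote the components, in a basis of $V$ and its dual basis, of spanning elements, scaled so that $d^{acd}d_{bcd}=\delta^a_b$. Operators $X$ on $V\otimes V$ have components $X^{ab}_{cd}$ (upper indices output, lower input). $\mathbf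 1^{ab}_{cd}=\delta^a_c\delta^b_d$ is the identity, $P^{ab}_{cd}=\delta^a_d\delta^b_c$ the transposition, and $K^{ab}_{cd}=d^{abe}d_{ecd}$. *)

theory Defs
  imports "HOL-Analysis.Analysis"
begin

text \<open>
  Conventions. After a choice of basis, \<open>V\<close> is \<open>complex^'n\<close>, operators on \<open>V\<close> are matrices
  with \<open>A $ i $ j\<close> (row = output index, column = input index), and elements of \<open>V \<otimes> W\<close> are
  vectors indexed by pairs, so that \<open>End (V \<otimes> V)\<close> is \<open>complex^('n \<times> 'n)^('n \<times> 'n)\<close>. A representation
  of a Lie algebra enters only through its image, the set \<open>G\<close> of matrices by which the algebra acts.
\<close>

definition scale_matrix :: "complex \<Rightarrow> complex^'n^'m \<Rightarrow> complex^'n^'m" (infixr \<open>*m\<close> 75)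
  where "c *m A = (\<chi> i j. c * A $ i $ j)"

definition lie_bracket :: "complex^'n^'n \<Rightarrow> complex^'n^'n \<Rightarrow> complex^'n^'n"
  where "lie_bracket A B = A ** B - B ** A"

inductive_set lie_generated :: "(complex^'n^'n) set \<Rightarrow> (complex^'n^'n) set"
  for S :: "(complex^'n^'n) set" where
  base: "A \<in> S \<Longrightarrow> A \<in> lie_generated S"
| zero: "0 \<in> lie_generated S"
| add: "A \<in> lie_generated S \<Longrightarrow> B \<in> lie_generated S \<Longrightarrow> A + B \<in> lie_generated S"
| scale: "A \<in> lie_generated S \<Longrightarrow> c *m A \<in> lie_generated S"
| bracket: "A \<in> lie_generated S \<Longrightarrow> B \<in> lie_generated S \<Longrightarrow> lie_bracket A B \<in> lie_generated S"


subsection \<open>The classical members of the series\<close>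

definition special_linear :: "(complex^'k^'k) set"
  where "special_linear = {X. trace X = 0}"

text \<open>The action \<open>X \<otimes> 1 + 1 \<otimes> Y\<close> on a tensor product.\<close>

definition tensor_action ::
  "complex^'k^'k \<Rightarrow> complex^'l^'l \<Rightarrow> complex^('k \<times> 'l) \<Rightarrow> complex^('k \<times> 'l)"
  where "tensor_action X Y t =
    vec_lambda (\<lambda>(i, j). (\<Sum>k\<in>UNIV. X $ i $ k * t $ (k, j)) + (\<Sum>l\<in>UNIV. Y $ j $ l * t $ (i, l)))"

definition symmetric_square :: "(complex^('k::finite \<times> 'k)) set"
  where "symmetric_square = {t. \<forall>i j. t $ (j, i) = t $ (i, j)}"

definition exterior_square :: "(complex^('k::finite \<times> 'k)) set"
  where "exterior_square = {t. \<forall>i j. t $ (j, i) = - t $ (i, j)}"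

definition is_basis_of :: "('n \<Rightarrow> complex^'k) \<Rightarrow> (complex^'k) set \<Rightarrow> bool"
  where "is_basis_of b U \<longleftrightarrow> inj b \<and> vec.independent (range b) \<and> vec.span (range b) = U"

definition represents_in :: "('n \<Rightarrow> complex^'k) \<Rightarrow> (complex^'k \<Rightarrow> complex^'k) \<Rightarrow> complex^'n^'n \<Rightarrow> bool"
  where "represents_in b T A \<longleftrightarrow> (\<forall>j. T (b j) = (\<Sum>i\<in>UNIV. A $ i $ j *s b i))"


subsection \<open>The exceptional member\<close>

text \<open>Dynkin diagram: the chain 1 - 3 - 4 - 5 - 6 with the node 2 attached to 4.\<close>

definition e6_adjacent :: "nat \<Rightarrow> nat \<Rightarrow> bool"
  where "e6_adjacent i j \<longleftrightarrow> {i, j} \<in> {{1, 3}, {3, 4}, {4, 5}, {5, 6}, {2, 4}}"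

definition e6_cartan :: "nat \<Rightarrow> nat \<Rightarrow> int"
  where "e6_cartan i j = (if i = j then 2 else if e6_adjacent i j then -1 else 0)"

text \<open>
  The Lie algebra \<open>e\<^sub>6\<close> is presented by the Chevalley--Serre generators and relations, so a
  representation of it is a family of matrices satisfying these relations.
\<close>

definition e6_representation ::
  "(nat \<Rightarrow> complex^'n^'n) \<Rightarrow> (nat \<Rightarrow> complex^'n^'n) \<Rightarrow> (nat \<Rightarrow> complex^'n^'n) \<Rightarrow> bool"
  where "e6_representation e f h \<longleftrightarrow>
    (\<forall>i\<in>{1..6}. \<forall>j\<in>{1..6}.
      lie_bracket (h i) (h j) = 0 \<and>
      lie_bracket (e i) (f j) = (if i = j then h i else 0) \<and>
      lie_bracket (h i) (e j) = of_int (e6_cartan i j) *m e j \<and>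
      lie_bracket (h i) (f j) = - of_int (e6_cartan i j) *m f j \<and>
      (i \<noteq> j \<longrightarrow>
        (lie_bracket (e i) ^^ nat (1 - e6_cartan i j)) (e j) = 0 \<and>
        (lie_bracket (f i) ^^ nat (1 - e6_cartan i j)) (f j) = 0))"

definition acts_irreducibly :: "(complex^'n^'n) set \<Rightarrow> bool"
  where "acts_irreducibly G \<longleftrightarrow>
    (\<forall>U. vec.subspace U \<and> (\<forall>A\<in>G. \<forall>x\<in>U. A *v x \<in> U) \<longrightarrow> U = {0} \<or> U = UNIV)"


subsection \<open>The series\<close>

text \<open>
  \<open>e6_series m G\<close>: \<open>G\<close> is the image of the Lie algebra in \<open>End V\<close>, written in some basis of \<open>V\<close>
  indexed by \<open>'n\<close>. For \<open>m = 8\<close> the basis is left free because every family of matrices satisfying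
  the relations is admitted; this covers both (mutually dual) irreducible representations of
  dimension 27.
\<close>

definition e6_series :: "nat \<Rightarrow> (complex^'n^'n) set \<Rightarrow> bool"
  where "e6_series m G \<longleftrightarrow>
    (m = 1 \<and> (\<exists>b :: 'n \<Rightarrow> complex^(3 \<times> 3). is_basis_of b symmetric_square \<and>
       G = {A. \<exists>X\<in>special_linear. represents_in b (tensor_action X X) A})) \<or>
    (m = 2 \<and> (\<exists>b :: 'n \<Rightarrow> complex^(3 \<times> 3). is_basis_of b UNIV \<and>
       G = {A. \<exists>X\<in>special_linear. \<exists>Y\<in>special_linear. represents_in b (tensor_action X Y) A})) \<or>
    (m = 4 \<and> (\<exists>b :: 'n \<Rightarrow> complex^(6 \<times> 6). is_basis_of b exterior_square \<and>
       G = {A. \<exists>X\<in>special_linear. represents_in b (tensor_action X X) A})) \<or>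
    (m = 8 \<and> CARD('n) = 27 \<and> (\<exists>e f h. e6_representation e f h \<and>
       G = lie_generated (e ` {1..6} \<union> f ` {1..6} \<union> h ` {1..6}) \<and> acts_irreducibly G))"


subsection \<open>Invariant cubic tensors\<close>

definition symmetric_cubic :: "complex^('n::finite \<times> 'n \<times> 'n) \<Rightarrow> bool"
  where "symmetric_cubic t \<longleftrightarrow> (\<forall>a b c. t $ (b, a, c) = t $ (a, b, c) \<and> t $ (a, c, b) = t $ (a, b, c))"

text \<open>
  \<open>A\<close> acts on \<open>V\<close> with components \<open>A $ a $ e\<close>, and on the dual space with the negative transpose; the
  overall sign is dropped below. The components refer to a basis of \<open>V\<close> and its dual basis.
\<close>

definition Sym3_invariants :: "(complex^'n^'n) set \<Rightarrow> (complex^('n \<times> 'n \<times> 'n)) set"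
  where "Sym3_invariants G = {t. symmetric_cubic t \<and> (\<forall>A\<in>G. \<forall>a b c.
    (\<Sum>e\<in>UNIV. A $ a $ e * t $ (e, b, c) + A $ b $ e * t $ (a, e, c) + A $ c $ e * t $ (a, b, e)) = 0)}"

definition Sym3_dual_invariants :: "(complex^'n^'n) set \<Rightarrow> (complex^('n \<times> 'n \<times> 'n)) set"
  where "Sym3_dual_invariants G = {t. symmetric_cubic t \<and> (\<forall>A\<in>G. \<forall>a b c.
    (\<Sum>e\<in>UNIV. A $ e $ a * t $ (e, b, c) + A $ e $ b * t $ (a, e, c) + A $ e $ c * t $ (a, b, e)) = 0)}"

text \<open>
  \<open>d\<close> carries the lower indices (it lies in \<open>Sym\<^sup>3\<close> of the dual space), \<open>D\<close> the upper ones. Each spans the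
  corresponding one-dimensional space of invariants.
\<close>

definition cubic_invariants ::
  "(complex^'n^'n) set \<Rightarrow> complex^('n \<times> 'n \<times> 'n) \<Rightarrow> complex^('n \<times> 'n \<times> 'n) \<Rightarrow> bool"
  where "cubic_invariants G d D \<longleftrightarrow>
    vec.span {d} = Sym3_dual_invariants G \<and>
    vec.span {D} = Sym3_invariants G \<and>
    (\<forall>a b. (\<Sum>c\<in>UNIV. \<Sum>e\<in>UNIV. D $ (a, c, e) * d $ (b, c, e)) = (if a = b then 1 else 0))"


subsection \<open>Operators on tensor powers\<close>

definition flip_op :: "complex^('n::finite \<times> 'n)^('n \<times> 'n)"
  where "flip_op = vec_lambda (\<lambda>(a, b). vec_lambda (\<lambda>(c, d). if a = d \<and> b = c then 1 else 0))"

definition K_op ::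
  "complex^('n::finite \<times> 'n \<times> 'n) \<Rightarrow> complex^('n \<times> 'n \<times> 'n) \<Rightarrow> complex^('n \<times> 'n)^('n \<times> 'n)"
  where "K_op d D =
    vec_lambda (\<lambda>(a, b). vec_lambda (\<lambda>(c, c'). \<Sum>e\<in>UNIV. D $ (a, b, e) * d $ (e, c, c')))"

definition R_check ::
  "nat \<Rightarrow> complex^('n::finite \<times> 'n \<times> 'n) \<Rightarrow> complex^('n \<times> 'n \<times> 'n) \<Rightarrow> complex
    \<Rightarrow> complex^('n \<times> 'n)^('n \<times> 'n)"
  where "R_check m d D u =
    4 *m mat 1 - u *m flip_op + ((4 * of_nat m + 8) * u / (2 * of_nat m - u)) *m K_op d D"

text \<open>\<open>X \<otimes> 1\<close> and \<open>1 \<otimes> X\<close> on \<open>V \<otimes> V \<otimes> V\<close>\<close>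

definition tensor_id :: "complex^('n::finite \<times> 'n)^('n \<times> 'n) \<Rightarrow> complex^('n \<times> 'n \<times> 'n)^('n \<times> 'n \<times> 'n)"
  where "tensor_id X = vec_lambda (\<lambda>(a, b, c). vec_lambda (\<lambda>(a', b', c').
    if c = c' then X $ (a, b) $ (a', b') else 0))"

definition id_tensor :: "complex^('n::finite \<times> 'n)^('n \<times> 'n) \<Rightarrow> complex^('n \<times> 'n \<times> 'n)^('n \<times> 'n \<times> 'n)"
  where "id_tensor X = vec_lambda (\<lambda>(a, b, c). vec_lambda (\<lambda>(a', b', c').
    if a = a' then X $ (b, c) $ (b', c') else 0))"

end

(*
  The identity that makes everything work is the polarised adjoint identity (x#)# = N(x) x of the cubic form N,
  here called the Springer relation: symmetrised over three pairings, D d d is a multiple of the symmetrised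
  delta d, and likewise with d and D exchanged. Contracting it gives the multiple 1/(m+2). Write C_i for the
  contraction of a tensor F on V x V x V with d that leaves slot i, E_i for the dual extension by D, and B for
  their composite C_i E_j, i different from j. The Springer relation determines B^2, the sum of the B C_i and
  the sum of the E_i B, and these three rules suffice to bring both sides of the Yang-Baxter equation to the
  same form.

  Since the invariants are assumed to be one-dimensional, it is enough to find in each case one pair of
  invariant cubic tensors that satisfies the Springer relation: the determinant for m = 1, 2, the Pfaffian for
  m = 4 and the cubic form with 45 signed monomials in 27 variables for m = 8. In the last case the
  representation has to be identified. A weight that is positive on a simple coroot may be lowered by the
  corresponding root; starting from a highest weight that is neither zero nor minuscule, this produces 28
  different weights, too many for dimension 27. In the minuscule case words in the f_i applied to the highest
  weight vector form a basis in which every e_i and f_i maps a basis vector to a basis vector or to zero.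
*)

theory Submission
  imports Defs "HOL-Computational_Algebra.Fundamental_Theorem_Algebra"
begin

section \<open>The Yang--Baxter equation from the Springer relation\<close>

text \<open>C_i sends V x V x V to End(V), where B acts and where traces and identity matrices come
  from; on V x V x V, K tensor 1 is E_3 C_3 and 1 tensor K is E_1 C_1. The terms without K cancel,
  since 4 - s P alone is Yang's solution. What the three rules leave is four scalar identities, and
  these explain the coefficient k(s) of K: for s \<noteq> 0 the quotient 4 s / k(s) = \<alpha> (2 m
  - s) is affine in s. Both invariants come from one cubic form. A bilinear pairing identifies the
  ambient space with its dual, so the form evaluated on a basis gives d and on the dual basis gives
  D. Hence an operator and its transpose must both be derivations of the form. For m = 8 weights are
  told apart by one integer, the eigenvalue of a fixed combination of the h_i. Distinct eigenvalues
  bound the dimension from below, which excludes highest weights. In the minuscule case 27 known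
  eigenvalues already fill the space, so e_i or f_i must kill a basis vector whenever the image
  would have a further eigenvalue. The trivial weight is excluded by irreducibility, and the dual
  representation is reduced to the first one by the symmetry of the diagram.\<close>

lemma sum_nested3:
  "(\<Sum>a\<in>UNIV. \<Sum>b\<in>UNIV. \<Sum>c\<in>UNIV. f a b c) = (\<Sum>(a, b, c)\<in>UNIV. f a b c)"
  for f :: "'a::finite \<Rightarrow> 'b::finite \<Rightarrow> 'c::finite \<Rightarrow> complex"
  by (simp add: sum.cartesian_product UNIV_Times_UNIV[symmetric] case_prod_unfold del: UNIV_Times_UNIV)

lemma sum_delta_nested2:
  "(\<Sum>p\<in>UNIV. \<Sum>q\<in>UNIV. f p q * (if p = c then g p q else 0)) = (\<Sum>q\<in>UNIV. f c q * g c q)"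
  "(\<Sum>p\<in>UNIV. \<Sum>q\<in>UNIV. f' p q * (if p = q then g' p q else 0)) = (\<Sum>q\<in>UNIV. f' q q * g' q q)"
  for f g :: "'a::finite \<Rightarrow> 'b::finite \<Rightarrow> complex" and f' g' :: "'a::finite \<Rightarrow> 'a::finite \<Rightarrow> complex"
  subgoal by (subst sum.remove[of _ c]) auto
  subgoal by (simp add: if_distrib[of "\<lambda>t. _ * t"] cong: if_cong)
  done

lemma sum_delta_nested3:
  "(\<Sum>p\<in>UNIV. \<Sum>q\<in>UNIV. \<Sum>r\<in>UNIV. f p q r * (if c = p then g p q r else 0))
    = (\<Sum>q\<in>UNIV. \<Sum>r\<in>UNIV. f c q r * g c q r)"
  "(\<Sum>p\<in>UNIV. \<Sum>q\<in>UNIV. \<Sum>r\<in>UNIV. f p q r * (if c = q then g p q r else 0))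
    = (\<Sum>p\<in>UNIV. \<Sum>r\<in>UNIV. f p c r * g p c r)"
  "(\<Sum>p\<in>UNIV. \<Sum>q\<in>UNIV. \<Sum>r\<in>UNIV. f p q r * (if c = r then g p q r else 0))
    = (\<Sum>p\<in>UNIV. \<Sum>q\<in>UNIV. f p q c * g p q c)"
  for f g :: "'a::finite \<Rightarrow> 'a \<Rightarrow> 'a \<Rightarrow> complex"
  subgoal by (subst sum.remove[of _ c]) auto
  subgoal by (rule sum.cong[OF refl], subst sum.remove[of _ c]) auto
  subgoal by (simp add: if_distrib[of "\<lambda>t. _ * t"] cong: if_cong)
  done

lemma sum_nested4:
  "(\<Sum>a\<in>UNIV. \<Sum>b\<in>UNIV. \<Sum>c\<in>UNIV. \<Sum>d\<in>UNIV. f a b c d) = (\<Sum>(a, b, c, d)\<in>UNIV. f a b c d)"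
  for f :: "'a::finite \<Rightarrow> 'b::finite \<Rightarrow> 'c::finite \<Rightarrow> 'd::finite \<Rightarrow> complex"
  by (simp add: sum.cartesian_product UNIV_Times_UNIV[symmetric] case_prod_unfold del: UNIV_Times_UNIV)

lemma sum_nested5:
  "(\<Sum>a\<in>UNIV. \<Sum>b\<in>UNIV. \<Sum>c\<in>UNIV. \<Sum>d\<in>UNIV. \<Sum>e\<in>UNIV. f a b c d e)
    = (\<Sum>(a, b, c, d, e)\<in>UNIV. f a b c d e)"
  for f :: "'a::finite \<Rightarrow> 'b::finite \<Rightarrow> 'c::finite \<Rightarrow> 'd::finite \<Rightarrow> 'e::finite \<Rightarrow> complex"
  by (simp add: sum.cartesian_product UNIV_Times_UNIV[symmetric] case_prod_unfold del: UNIV_Times_UNIV)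

lemma sum_nested6:
  "(\<Sum>a\<in>UNIV. \<Sum>b\<in>UNIV. \<Sum>c\<in>UNIV. \<Sum>d\<in>UNIV. \<Sum>e\<in>UNIV. \<Sum>g\<in>UNIV. f a b c d e g)
    = (\<Sum>(a, b, c, d, e, g)\<in>UNIV. f a b c d e g)"
  for f :: "'a::finite \<Rightarrow> 'b::finite \<Rightarrow> 'c::finite \<Rightarrow> 'd::finite \<Rightarrow> 'e::finite \<Rightarrow> 'f::finite \<Rightarrow> complex"
  by (simp add: sum.cartesian_product UNIV_Times_UNIV[symmetric] case_prod_unfold del: UNIV_Times_UNIV)

text \<open>Both relations are full polarisations of (x#)# = N(x) x: there are three ways to pair
  four arguments on the left and four ways to single out one argument on the right.\<close>

locale springer_pair =
  fixes d D :: "'n::finite \<Rightarrow> 'n \<Rightarrow> 'n \<Rightarrow> complex" and \<alpha> :: complex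
  assumes d_sym: "d b a c = d a b c" "d a c b = d a b c"
    and D_sym: "D b a c = D a b c" "D a c b = D a b c"
    and contract: "(\<Sum>p\<in>UNIV. \<Sum>q\<in>UNIV. D a p q * d b p q) = (if a = b then 1 else 0)"
    and springer: "(\<Sum>p\<in>UNIV. \<Sum>q\<in>UNIV. D g p q * (d a b p * d c e q + d a c p * d b e q + d a e p * d b c q))
      = \<alpha> * ((if g = a then d b c e else 0) + (if g = b then d a c e else 0)
           + (if g = c then d a b e else 0) + (if g = e then d a b c else 0))"
    and springer_dual: "(\<Sum>p\<in>UNIV. \<Sum>q\<in>UNIV. d g p q * (D a b p * D c e q + D a c p * D b e q + D a e p * D b c q))
      = \<alpha> * ((if g = a then D b c e else 0) + (if g = b then D a c e else 0)
           + (if g = c then D a b e else 0) + (if g = e then D a b c else 0))"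
begin

text \<open>The result has a lower index \<open>e\<close> and an upper index \<open>c\<close>, so it
  is an endomorphism of V. This is why a trace and an identity matrix appear in the rules
  below.\<close>

definition ctr1 where "ctr1 F e c = (\<Sum>p\<in>UNIV. \<Sum>q\<in>UNIV. d e p q * F c p q)"
definition ctr2 where "ctr2 F e c = (\<Sum>p\<in>UNIV. \<Sum>q\<in>UNIV. d e p q * F p c q)"
definition ctr3 where "ctr3 F e c = (\<Sum>p\<in>UNIV. \<Sum>q\<in>UNIV. d e p q * F p q c)"
definition ext1 where "ext1 X a b c = (\<Sum>e\<in>UNIV. D b c e * X e a)"
definition ext2 where "ext2 X a b c = (\<Sum>e\<in>UNIV. D a c e * X e b)"
definition ext3 where "ext3 X a b c = (\<Sum>e\<in>UNIV. D a b e * X e c)"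
text \<open>One operator serves all six pairs of different slots because \<open>d\<close> and
  \<open>D\<close> are symmetric; see \<open>ctr_ext_diff\<close>.\<close>

definition bridge where
  "bridge X e c = (\<Sum>p\<in>UNIV. \<Sum>y\<in>UNIV. \<Sum>g\<in>UNIV. d e p y * D y c g * X g p)"
definition full where "full F = (\<Sum>p\<in>UNIV. \<Sum>q\<in>UNIV. \<Sum>r\<in>UNIV. d p q r * F p q r)"

lemmas ops = ctr1_def ctr2_def ctr3_def ext1_def ext2_def ext3_def bridge_def

lemma d_sym': "d a b c = d b c a" "d a b c = d c a b" "d a b c = d c b a"
  by (metis d_sym)+

lemma D_sym': "D a b c = D b c a" "D a b c = D c a b" "D a b c = D c b a"
  by (metis D_sym)+

lemma contract': "(\<Sum>p\<in>UNIV. \<Sum>q\<in>UNIV. d a p q * D b p q) = (if a = b then 1 else 0)"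
  using contract[of b a] by (simp add: mult.commute eq_commute)

lemma contract_ext: "(\<Sum>p\<in>UNIV. \<Sum>q\<in>UNIV. d e p q * (\<Sum>g\<in>UNIV. D p q g * X g)) = X e"
proof -
  have "(\<Sum>p\<in>UNIV. \<Sum>q\<in>UNIV. d e p q * (\<Sum>g\<in>UNIV. D p q g * X g))
     = (\<Sum>p\<in>UNIV. \<Sum>q\<in>UNIV. \<Sum>g\<in>UNIV. d e p q * D g p q * X g)"
    by (simp add: sum_distrib_left mult.assoc D_sym'(1)[of g for g])
  also have "\<dots> = (\<Sum>p\<in>UNIV. \<Sum>g\<in>UNIV. \<Sum>q\<in>UNIV. d e p q * D g p q * X g)"
    by (intro sum.cong refl sum.swap)
  also have "\<dots> = (\<Sum>g\<in>UNIV. (\<Sum>p\<in>UNIV. \<Sum>q\<in>UNIV. d e p q * D g p q) * X g)"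
    by (subst sum.swap) (simp add: sum_distrib_right)
  also have "\<dots> = X e"
    by (simp add: contract' if_distrib[of "\<lambda>t. t * _"] cong: if_cong)
  finally show ?thesis .
qed

text \<open>The normalisation of \<open>d\<close> against \<open>D\<close> enters here. It makes
  each composite of \<open>ext\<close> after \<open>ctr\<close> in one slot, and hence K,
  idempotent.\<close>

lemma ctr_ext_same:
  "ctr1 (ext1 X) = X" "ctr2 (ext2 X) = X" "ctr3 (ext3 X) = X"
  by (intro ext, simp add: ops contract_ext)+

lemma ctr_ext_aux:
  "(\<Sum>p\<in>UNIV. \<Sum>q\<in>UNIV. d e p q * (\<Sum>g\<in>UNIV. D q c g * X g p)) = bridge X e c"
  by (simp add: bridge_def sum_distrib_left mult.assoc)

lemma ctr_ext_aux':
  "(\<Sum>p\<in>UNIV. \<Sum>q\<in>UNIV. d e p q * (\<Sum>g\<in>UNIV. D p c g * X g q)) = bridge X e c"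
  by (subst sum.swap, subst d_sym(2)) (rule ctr_ext_aux)

lemma ctr_ext_aux_swapped:
  "(\<Sum>p\<in>UNIV. \<Sum>q\<in>UNIV. d e p q * (\<Sum>g\<in>UNIV. D c q g * X g p)) = bridge X e c"
  "(\<Sum>p\<in>UNIV. \<Sum>q\<in>UNIV. d e p q * (\<Sum>g\<in>UNIV. D c p g * X g q)) = bridge X e c"
  using ctr_ext_aux[of e c X] ctr_ext_aux'[of e c X] D_sym(1)[of c] by auto

lemma ctr_ext_diff:
  "ctr1 (ext2 X) = bridge X" "ctr1 (ext3 X) = bridge X" "ctr2 (ext1 X) = bridge X"
  "ctr2 (ext3 X) = bridge X" "ctr3 (ext1 X) = bridge X" "ctr3 (ext2 X) = bridge X"
  unfolding fun_eq_iff ctr1_def ctr2_def ctr3_def ext1_def ext2_def ext3_def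
  by (intro allI; (rule ctr_ext_aux | rule ctr_ext_aux' | rule ctr_ext_aux_swapped(1) | rule ctr_ext_aux_swapped(2)))+

text \<open>The tensor paired with \<open>f\<close> is \<open>ext2 X\<close>, which is symmetric in
  its outer slots \<open>p\<close> and \<open>y'\<close>. Pairing the Springer relation with it
  produces the square of \<open>bridge\<close>.\<close>

definition pairing where
  "pairing X f = (\<Sum>p\<in>UNIV. \<Sum>y'\<in>UNIV. \<Sum>g'\<in>UNIV. \<Sum>p'\<in>UNIV. f p p' y' * (D y' p g' * X g' p'))"

lemma pairing_add: "pairing X (\<lambda>p p' y. f p p' y + h p p' y) = pairing X f + pairing X h"
  by (simp add: pairing_def distrib_right sum.distrib)

lemma pairing_scale: "pairing X (\<lambda>p p' y. a * f p p' y) = a * pairing X f"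
  by (simp add: pairing_def sum_distrib_left mult.assoc)

lemma pairing_swap: "pairing X (\<lambda>p p' y. f p p' y) = pairing X (\<lambda>p p' y. f y p' p)"
  unfolding pairing_def by (subst sum.swap) (simp add: D_sym)

lemma pairing_bridge_bridge:
  "pairing X (\<lambda>p p' y'. \<Sum>y\<in>UNIV. \<Sum>g\<in>UNIV. D c y g * (d e p y * d p' y' g)) = bridge (bridge X) e c"
  unfolding pairing_def bridge_def sum_distrib_left sum_distrib_right sum_nested6
  by (rule sum.reindex_bij_witness[where
       i = "\<lambda>(p, y, g, p', y', g'). (p, y', g', p', y, g)"
       and j = "\<lambda>(p, y', g', p', y, g). (p, y, g, p', y', g')"])
    (auto simp: D_sym d_sym' algebra_simps)

lemma pairing_contract:
  "pairing X (\<lambda>p p' y. d p p' y * h) = h * (\<Sum>g\<in>UNIV. X g g)"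
  "pairing X (\<lambda>p p' y. d p y h' * f p') = (\<Sum>p\<in>UNIV. X h' p * f p)"
proof -
  have *: "pairing X (\<lambda>p p' y. d p y (h p') * f p')= (\<Sum>p\<in>UNIV. X (h p) p * f p)" for f h
  proof -
    have "pairing X (\<lambda>p p' y. d p y (h p') * f p') = (\<Sum>(p', g, p, y)\<in>UNIV. d (h p') p y * D g p y * (X g p' * f p'))"
      unfolding pairing_def sum_nested4
      by (rule sum.reindex_bij_witness[where
           i = "\<lambda>(p', g, p, y). (p, y, g, p')" and j = "\<lambda>(p, y, g, p'). (p', g, p, y)"])
        (auto simp: D_sym D_sym' d_sym d_sym' algebra_simps)
    also have "\<dots> = (\<Sum>p'\<in>UNIV. \<Sum>g\<in>UNIV. (\<Sum>p\<in>UNIV. \<Sum>y\<in>UNIV. d (h p') p y * D g p y) * (X g p' * f p'))"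
      by (simp add: sum_distrib_right sum_nested4)
    also have "\<dots> = (\<Sum>p\<in>UNIV. X (h p) p * f p)"
      by (simp add: contract' if_distrib[of "\<lambda>t. t * _"] cong: if_cong)
    finally show ?thesis .
  qed
  show "pairing X (\<lambda>p p' y. d p y h' * f p') = (\<Sum>p\<in>UNIV. X h' p * f p)" by (rule *)
  show "pairing X (\<lambda>p p' y. d p p' y * h) = h * (\<Sum>g\<in>UNIV. X g g)"
    using *[of "\<lambda>p. p" "\<lambda>_. h"] by (simp add: d_sym sum_distrib_left mult.commute)
qed

text \<open>Here \<open>d p y' g\<close> meets both outer slots of the paired tensor, so this
  \<open>d\<close> and its \<open>D\<close> contract to a delta and a single bridge is left.\<close>

lemma pairing_cross:
  "pairing X (\<lambda>p p' y'. \<Sum>y\<in>UNIV. \<Sum>g\<in>UNIV. D c y g * (d e p' y * d p y' g)) = bridge X e c"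
proof -
  have "pairing X (\<lambda>p p' y'. \<Sum>y\<in>UNIV. \<Sum>g\<in>UNIV. D c y g * (d e p' y * d p y' g))
     = (\<Sum>y\<in>UNIV. \<Sum>g\<in>UNIV. pairing X (\<lambda>p p' y'. d p y' g * (D c y g * d e p' y)))"
    unfolding pairing_def sum_distrib_left sum_distrib_right sum_nested6
    by (rule sum.reindex_bij_witness[where
         i = "\<lambda>(y, g, p, y', g', p'). (p, y', g', p', y, g)"
         and j = "\<lambda>(p, y', g', p', y, g). (y, g, p, y', g', p')"])
      (auto simp: algebra_simps)
  also have "\<dots> = (\<Sum>y\<in>UNIV. \<Sum>g\<in>UNIV. \<Sum>p\<in>UNIV. X g p * (D c y g * d e p y))"
    by (simp add: pairing_contract)
  also have "\<dots> = (\<Sum>y\<in>UNIV. \<Sum>p\<in>UNIV. \<Sum>g\<in>UNIV. X g p * (D c y g * d e p y))"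
    by (intro sum.cong refl sum.swap)
  also have "\<dots> = bridge X e c"
    unfolding bridge_def by (subst sum.swap) (simp add: D_sym algebra_simps)
  finally show ?thesis .
qed

lemma pairing_if:
  "pairing X (\<lambda>p p' y. if c = e then d p p' y else 0) = (if e = c then \<Sum>g\<in>UNIV. X g g else 0)"
  "pairing X (\<lambda>p p' y. if c = p then d e p' y else 0) = bridge X e c"
  "pairing X (\<lambda>p p' y. if c = p' then d e p y else 0) = X e c"
  "pairing X (\<lambda>p p' y. if c = y then d e p p' else 0) = bridge X e c"
proof -
  show "pairing X (\<lambda>p p' y. if c = e then d p p' y else 0) = (if e = c then \<Sum>g\<in>UNIV. X g g else 0)"
    using pairing_contract(1)[of X 1] by (auto simp: pairing_def)
  have "pairing X (\<lambda>p p' y. d p y e * (if c = p' then 1 else 0)) = X e c"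
    by (subst pairing_contract(2)) (simp add: if_distrib[of "\<lambda>t. _ * t"] cong: if_cong)
  moreover have "(\<lambda>p p' y. if c = p' then d e p y else 0) = (\<lambda>p p' y. d p y e * (if c = p' then 1 else 0))"
    by (auto simp: fun_eq_iff d_sym')
  ultimately show "pairing X (\<lambda>p p' y. if c = p' then d e p y else 0) = X e c" by simp
  show A: "pairing X (\<lambda>p p' y. if c = p then d e p' y else 0) = bridge X e c"
  proof -
    have "pairing X (\<lambda>p p' y. if c = p then d e p' y else 0)
       = (\<Sum>y'\<in>UNIV. \<Sum>g'\<in>UNIV. \<Sum>p'\<in>UNIV. d e p' y' * (D y' c g' * X g' p'))"
      unfolding pairing_def by (subst sum.remove[of _ c]) auto
    also have "\<dots> = bridge X e c"
      unfolding bridge_def sum_nested3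
      by (rule sum.reindex_bij_witness[where i = "\<lambda>(p, y, g). (y, g, p)" and j = "\<lambda>(y, g, p). (p, y, g)"])
        (auto simp: mult.assoc)
    finally show ?thesis .
  qed
  show "pairing X (\<lambda>p p' y. if c = y then d e p p' else 0) = bridge X e c"
  proof -
    have "pairing X (\<lambda>p p' y. if c = y then d e p p' else 0) = pairing X (\<lambda>p p' y. if c = p then d e y p' else 0)"
      by (rule pairing_swap)
    also have "\<dots> = pairing X (\<lambda>p p' y. if c = p then d e p' y else 0)"
      by (subst d_sym(2)) (rule refl)
    finally show ?thesis by (simp add: A)
  qed
qed

text \<open>Pair the Springer relation with \<open>ext2 X\<close>. Two of its three left-hand terms
  are exchanged by the symmetry of the outer slots and give the square; the third gives
  \<open>bridge X\<close>, hence the -1. On the right the two deltas at outer slots give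
  \<open>2 * \<alpha>\<close> bridges, the other two give the trace and \<open>X\<close>.\<close>

lemma bridge_bridge:
  "2 * bridge (bridge X) e c
    = \<alpha> * ((if e = c then \<Sum>g\<in>UNIV. X g g else 0) + X e c) + (2 * \<alpha> - 1) * bridge X e c"
proof -
  have "(\<lambda>p p' y'. (\<Sum>y\<in>UNIV. \<Sum>g\<in>UNIV. D c y g * (d e p y * d p' y' g))
        + (\<Sum>y\<in>UNIV. \<Sum>g\<in>UNIV. D c y g * (d e p' y * d p y' g))
        + (\<Sum>y\<in>UNIV. \<Sum>g\<in>UNIV. D c y g * (d e y' y * d p' p g)))
     = (\<lambda>p p' y'. \<alpha> * ((if c = e then d p p' y' else 0) + (if c = p then d e p' y' else 0)
           + (if c = p' then d e p y' else 0) + (if c = y' then d e p p' else 0)))"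
    unfolding springer[symmetric]
    by (simp add: fun_eq_iff distrib_left sum.distrib d_sym)
  from arg_cong[OF this, of "pairing X"] show ?thesis
    unfolding pairing_add pairing_scale pairing_bridge_bridge pairing_cross pairing_if
      pairing_swap[of X "\<lambda>p p' y'. \<Sum>y\<in>UNIV. \<Sum>g\<in>UNIV. D c y g * (d e y' y * d p' p g)"]
    by (simp add: algebra_simps)
qed

text \<open>The three summands are the three pairings in the Springer relation with lower arguments
  \<open>e\<close> and the slots of \<open>F\<close>. The deltas at the slots of \<open>F\<close>
  give the contractions, the delta at \<open>e\<close> gives the full contraction.\<close>

lemma bridge_ctr_sum:
  "bridge (ctr1 F) e c + bridge (ctr2 F) e c + bridge (ctr3 F) e c
    = \<alpha> * ((if e = c then full F else 0) + ctr1 F e c + ctr2 F e c + ctr3 F e c)"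
  (is "?L = ?R")
proof -
  let ?S = "\<lambda>H. \<Sum>p\<in>UNIV. \<Sum>q\<in>UNIV. \<Sum>r\<in>UNIV. F p q r * H p q r"
  have S_add: "?S (\<lambda>p q r. H p q r + H' p q r) = ?S H + ?S H'" for H H'
    by (simp add: distrib_left sum.distrib)
  have S_scale: "?S (\<lambda>p q r. a * H p q r) = a * ?S H" for a H
    by (simp add: sum_distrib_left mult.left_commute)
  have 1: "bridge (ctr1 F) e c = ?S (\<lambda>p q r. \<Sum>y\<in>UNIV. \<Sum>g\<in>UNIV. D c y g * (d e p y * d q r g))"
    unfolding bridge_def ctr1_def sum_distrib_left sum_distrib_right
    unfolding sum_nested5
    by (rule sum.reindex_bij_witness[where
         i = "\<lambda>(p, q, r, y, g). (p, y, g, q, r)" and j = "\<lambda>(p, y, g, q, r). (p, q, r, y, g)"])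
      (auto simp: D_sym d_sym' algebra_simps)
  have 2: "bridge (ctr2 F) e c = ?S (\<lambda>p q r. \<Sum>y\<in>UNIV. \<Sum>g\<in>UNIV. D c y g * (d e q y * d p r g))"
    unfolding bridge_def ctr2_def sum_distrib_left sum_distrib_right
    unfolding sum_nested5
    by (rule sum.reindex_bij_witness[where
         i = "\<lambda>(p, q, r, y, g). (q, y, g, p, r)" and j = "\<lambda>(q, y, g, p, r). (p, q, r, y, g)"])
      (auto simp: D_sym d_sym' algebra_simps)
  have 3: "bridge (ctr3 F) e c = ?S (\<lambda>p q r. \<Sum>y\<in>UNIV. \<Sum>g\<in>UNIV. D c y g * (d e r y * d p q g))"
    unfolding bridge_def ctr3_def sum_distrib_left sum_distrib_right
    unfolding sum_nested5
    by (rule sum.reindex_bij_witness[where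
         i = "\<lambda>(p, q, r, y, g). (r, y, g, p, q)" and j = "\<lambda>(r, y, g, p, q). (p, q, r, y, g)"])
      (auto simp: D_sym d_sym' algebra_simps)
  have "?L = ?S (\<lambda>p q r. \<Sum>y\<in>UNIV. \<Sum>g\<in>UNIV. D c y g * (d e p y * d q r g + d e q y * d p r g + d e r y * d p q g))"
    unfolding 1 2 3 S_add[symmetric] sum.distrib[symmetric] distrib_left[symmetric] ..
  also have "\<dots> = ?R"
    unfolding springer S_scale S_add
    by (simp add: full_def ctr1_def ctr2_def ctr3_def mult.commute[of "d _ _ _"] sum_delta_nested3)
  finally show ?thesis .
qed

text \<open>This is the dual Springer relation with upper arguments \<open>a\<close>,
  \<open>b\<close>, \<open>c\<close>, \<open>g\<close>, summed against \<open>X g p\<close>; the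
  trace comes from the delta between \<open>p\<close> and \<open>g\<close>.\<close>

lemma ext_bridge_sum:
  "ext1 (bridge X) a b c + ext2 (bridge X) a b c + ext3 (bridge X) a b c
    = \<alpha> * (D a b c * (\<Sum>g\<in>UNIV. X g g) + ext1 X a b c + ext2 X a b c + ext3 X a b c)"
  (is "?L = ?R")
proof -
  let ?S = "\<lambda>H. \<Sum>p\<in>UNIV. \<Sum>g\<in>UNIV. X g p * H p g"
  have S_add: "?S (\<lambda>p g. H p g + H' p g) = ?S H + ?S H'" for H H'
    by (simp add: distrib_left sum.distrib)
  have S_scale: "?S (\<lambda>p g. k * H p g) = k * ?S H" for k H
    by (simp add: sum_distrib_left mult.left_commute)
  have 1: "ext1 (bridge X) a b c = ?S (\<lambda>p g. \<Sum>e\<in>UNIV. \<Sum>y\<in>UNIV. d p e y * (D a g e * D b c y))"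
    unfolding ext1_def bridge_def sum_distrib_left sum_distrib_right
    unfolding sum_nested4
    by (rule sum.reindex_bij_witness[where
         i = "\<lambda>(p, g, e, y). (y, p, e, g)" and j = "\<lambda>(y, p, e, g). (p, g, e, y)"])
      (auto simp: D_sym d_sym d_sym' D_sym' algebra_simps)
  have 2: "ext2 (bridge X) a b c = ?S (\<lambda>p g. \<Sum>e\<in>UNIV. \<Sum>y\<in>UNIV. d p e y * (D a c e * D b g y))"
    unfolding ext2_def bridge_def sum_distrib_left sum_distrib_right
    unfolding sum_nested4
    by (rule sum.reindex_bij_witness[where
         i = "\<lambda>(p, g, e, y). (e, p, y, g)" and j = "\<lambda>(e, p, y, g). (p, g, e, y)"])
      (auto simp: D_sym d_sym d_sym' D_sym' algebra_simps)
  have 3: "ext3 (bridge X) a b c = ?S (\<lambda>p g. \<Sum>e\<in>UNIV. \<Sum>y\<in>UNIV. d p e y * (D a b e * D c g y))"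
    unfolding ext3_def bridge_def sum_distrib_left sum_distrib_right
    unfolding sum_nested4
    by (rule sum.reindex_bij_witness[where
         i = "\<lambda>(p, g, e, y). (e, p, y, g)" and j = "\<lambda>(e, p, y, g). (p, g, e, y)"])
      (auto simp: D_sym d_sym d_sym' D_sym' algebra_simps)
  have "?L = ?S (\<lambda>p g. \<Sum>e\<in>UNIV. \<Sum>y\<in>UNIV. d p e y * (D a b e * D c g y + D a c e * D b g y + D a g e * D b c y))"
    unfolding 1 2 3 S_add[symmetric] sum.distrib[symmetric] distrib_left[symmetric] by (simp add: add_ac)
  also have "\<dots> = ?R"
    unfolding springer_dual S_scale S_add
    by (simp add: ext1_def ext2_def ext3_def mult.commute[of "D _ _ _"] sum_delta_nested2 sum_distrib_right)
  finally show ?thesis .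
qed

lemma op_linear:
  "ctr1 (\<lambda>a b c. F a b c + H a b c) = (\<lambda>e c. ctr1 F e c + ctr1 H e c)"
  "ctr2 (\<lambda>a b c. F a b c + H a b c) = (\<lambda>e c. ctr2 F e c + ctr2 H e c)"
  "ctr3 (\<lambda>a b c. F a b c + H a b c) = (\<lambda>e c. ctr3 F e c + ctr3 H e c)"
  "ctr1 (\<lambda>a b c. k * F a b c) = (\<lambda>e c. k * ctr1 F e c)"
  "ctr2 (\<lambda>a b c. k * F a b c) = (\<lambda>e c. k * ctr2 F e c)"
  "ctr3 (\<lambda>a b c. k * F a b c) = (\<lambda>e c. k * ctr3 F e c)"
  "ext1 (\<lambda>e c. X e c + Y e c) = (\<lambda>a b c. ext1 X a b c + ext1 Y a b c)"
  "ext2 (\<lambda>e c. X e c + Y e c) = (\<lambda>a b c. ext2 X a b c + ext2 Y a b c)"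
  "ext3 (\<lambda>e c. X e c + Y e c) = (\<lambda>a b c. ext3 X a b c + ext3 Y a b c)"
  "ext1 (\<lambda>e c. k * X e c) = (\<lambda>a b c. k * ext1 X a b c)"
  "ext2 (\<lambda>e c. k * X e c) = (\<lambda>a b c. k * ext2 X a b c)"
  "ext3 (\<lambda>e c. k * X e c) = (\<lambda>a b c. k * ext3 X a b c)"
  "bridge (\<lambda>e c. X e c + Y e c) = (\<lambda>e c. bridge X e c + bridge Y e c)"
  "bridge (\<lambda>e c. k * X e c) = (\<lambda>e c. k * bridge X e c)"
  by (simp_all add: fun_eq_iff ops sum.distrib algebra_simps sum_distrib_left)

section \<open>Both sides of the Yang--Baxter equation as operators on triple tensors\<close>

definition swap_left where "swap_left F = (\<lambda>a b c. F b a c)" for F :: "'n \<Rightarrow> 'n \<Rightarrow> 'n \<Rightarrow> complex"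
definition swap_right where "swap_right F = (\<lambda>a b c. F a c b)" for F :: "'n \<Rightarrow> 'n \<Rightarrow> 'n \<Rightarrow> complex"

lemma swap_linear:
  "swap_left (\<lambda>a b c. F a b c + H a b c) = (\<lambda>a b c. swap_left F a b c + swap_left H a b c)"
  "swap_right (\<lambda>a b c. F a b c + H a b c) = (\<lambda>a b c. swap_right F a b c + swap_right H a b c)"
  "swap_left (\<lambda>a b c. k * F a b c) = (\<lambda>a b c. k * swap_left F a b c)"
  "swap_right (\<lambda>a b c. k * F a b c) = (\<lambda>a b c. k * swap_right F a b c)"
  by (simp_all add: swap_left_def swap_right_def)

lemma swap_swap:
  "swap_left (swap_left F) = F" "swap_right (swap_right F) = F"
  "swap_left (swap_right (swap_left F)) = swap_right (swap_left (swap_right F))"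
  by (simp_all add: swap_left_def swap_right_def)

lemma ctr_swap:
  "ctr1 (swap_left F) = ctr2 F" "ctr2 (swap_left F) = ctr1 F" "ctr3 (swap_left F) = ctr3 F"
  "ctr1 (swap_right F) = ctr1 F" "ctr2 (swap_right F) = ctr3 F" "ctr3 (swap_right F) = ctr2 F"
proof -
  have "(\<Sum>p\<in>UNIV. \<Sum>q\<in>UNIV. d e p q * f p q) = (\<Sum>p\<in>UNIV. \<Sum>q\<in>UNIV. d e p q * f q p)" for e f
    by (subst sum.swap) (simp add: d_sym(2)[of e])
  then show "ctr1 (swap_left F) = ctr2 F" "ctr2 (swap_left F) = ctr1 F" "ctr3 (swap_left F) = ctr3 F"
    "ctr1 (swap_right F) = ctr1 F" "ctr2 (swap_right F) = ctr3 F" "ctr3 (swap_right F) = ctr2 F"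
    by (simp_all add: fun_eq_iff ctr1_def ctr2_def ctr3_def swap_left_def swap_right_def)
qed

lemma swap_ext:
  "swap_left (ext1 X) = ext2 X" "swap_left (ext2 X) = ext1 X" "swap_left (ext3 X) = ext3 X"
  "swap_right (ext1 X) = ext1 X" "swap_right (ext2 X) = ext3 X" "swap_right (ext3 X) = ext2 X"
  by (simp_all add: ops D_sym(1) D_sym(2) swap_left_def swap_right_def fun_eq_iff)

definition R_left where
  "R_left s k F = (\<lambda>a b c. 4 * F a b c + - s * swap_left F a b c + k * ext3 (ctr3 F) a b c)"
definition R_right where
  "R_right s k F = (\<lambda>a b c. 4 * F a b c + - s * swap_right F a b c + k * ext1 (ctr1 F) a b c)"

lemma ext_if:
  "ext3 (\<lambda>e c. if e = c then t else 0) a b c = D a b c * t"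
  "ext2 (\<lambda>e c. if e = c then t else 0) a b c = D a b c * t"
  "ext1 (\<lambda>e c. if e = c then t else 0) a b c = D a b c * t"
  by (simp_all add: ext3_def ext2_def ext1_def if_distrib[of "\<lambda>t. _ * t"] D_sym(2)[of a b c]
      D_sym'(1)[of a b c, symmetric] cong: if_cong)

lemma ext_bridge_bridge:
  "2 * ext3 (bridge (bridge X)) a b c = \<alpha> * (D a b c * (\<Sum>g\<in>UNIV. X g g) + ext3 X a b c) + (2 * \<alpha> - 1) * ext3 (bridge X) a b c" (is ?A)
  "2 * ext1 (bridge (bridge X)) a b c = \<alpha> * (D a b c * (\<Sum>g\<in>UNIV. X g g) + ext1 X a b c) + (2 * \<alpha> - 1) * ext1 (bridge X) a b c" (is ?B)
proof -
  have "(\<lambda>e c. 2 * bridge (bridge X) e c)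
     = (\<lambda>e c. \<alpha> * ((if e = c then \<Sum>g\<in>UNIV. X g g else 0) + X e c) + (2 * \<alpha> - 1) * bridge X e c)"
    by (simp add: bridge_bridge fun_eq_iff)
  from arg_cong[OF this, of ext3] arg_cong[OF this, of ext1]
  show ?A ?B
    unfolding op_linear
    by (simp_all add: fun_eq_iff ext_if)
qed

lemma trace_ctr:
  "(\<Sum>g\<in>UNIV. ctr1 F g g) = full F" "(\<Sum>g\<in>UNIV. ctr2 F g g) = full F" "(\<Sum>g\<in>UNIV. ctr3 F g g) = full F"
proof -
  show "(\<Sum>g\<in>UNIV. ctr1 F g g) = full F"
    by (simp add: ctr1_def full_def)
  show "(\<Sum>g\<in>UNIV. ctr2 F g g) = full F"
    unfolding ctr2_def full_def
    by (subst sum.swap) (simp add: d_sym)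
  show "(\<Sum>g\<in>UNIV. ctr3 F g g) = full F"
    unfolding ctr3_def full_def sum_nested3
    by (rule sum.reindex_bij_witness[where i = "\<lambda>(p, q, g). (g, p, q)" and j = "\<lambda>(g, p, q). (p, q, g)"])
      (auto simp: d_sym')
qed

lemma row_sums:
  "ext2 (bridge (ctr1 F)) a b c + ext2 (bridge (ctr2 F)) a b c + ext2 (bridge (ctr3 F)) a b c
    = \<alpha> * (D a b c * full F + ext2 (ctr1 F) a b c + ext2 (ctr2 F) a b c + ext2 (ctr3 F) a b c)" (is ?A)
  "ext3 (bridge (ctr1 F)) a b c + ext3 (bridge (ctr2 F)) a b c + ext3 (bridge (ctr3 F)) a b c
    = \<alpha> * (D a b c * full F + ext3 (ctr1 F) a b c + ext3 (ctr2 F) a b c + ext3 (ctr3 F) a b c)" (is ?B)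
proof -
  have "(\<lambda>e c. bridge (ctr1 F) e c + bridge (ctr2 F) e c + bridge (ctr3 F) e c)
     = (\<lambda>e c. \<alpha> * ((if e = c then full F else 0) + ctr1 F e c + ctr2 F e c + ctr3 F e c))"
    by (simp only: bridge_ctr_sum)
  from arg_cong[OF this, of ext2] arg_cong[OF this, of ext3]
  show ?A ?B
    unfolding op_linear by (simp_all add: fun_eq_iff ext_if)
qed

text \<open>After expansion every surviving term is an \<open>ext\<close> of a \<open>ctr\<close>
  with zero, one or two bridges in between, or \<open>D\<close> times the full contraction. The
  rules for bridges then leave only conditions on the scalars.\<close>

lemma yang_baxter:
  assumes k: "k * (2 * m - u) = (4 * m + 8) * u" and l: "l * (2 * m - v) = (4 * m + 8) * v"
    and z: "z * (2 * m - (u + v)) = (4 * m + 8) * (u + v)" and m: "\<alpha> * (m + 2) = 1"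
    and nz: "u \<noteq> 2 * m" "v \<noteq> 2 * m" "u + v \<noteq> 2 * m"
  shows "R_left u k (R_right (u + v) z (R_left v l F)) a b c
    = R_right v l (R_left (u + v) z (R_right u k F)) a b c"
proof -
  have m2: "m + 2 \<noteq> 0" using m by auto
  have \<alpha>: "\<alpha> = 1 / (m + 2)" using m m2 by (simp add: field_simps)
  have nz': "2 * m - u \<noteq> 0" "2 * m - v \<noteq> 0" "2 * m - (u + v) \<noteq> 0" using nz by auto
  have k': "k = (4 * m + 8) * u / (2 * m - u)" and l': "l = (4 * m + 8) * v / (2 * m - v)"
    and z': "z = (4 * m + 8) * (u + v) / (2 * m - (u + v))"
    using k l z nz' by (simp_all add: eq_divide_eq)
  \<comment> \<open>With k(s) the coefficient of K, 4 s / k(s) = \<alpha> (2 m - s) for s \<noteq>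
    0. For nonzero coefficients, \<open>E1\<close> and \<open>E2\<close> say that this quotient is
    affine in s, and \<open>E0\<close>, divided by \<open>k * l * z\<close>, amounts to 1 - 2
    \<alpha> = \<alpha> m.\<close>
  have E0: "2 * k * l * (u + v) + k * l * z * (1 - 2 * \<alpha>) = 2 * z * (k * v + u * l)"
    and E1: "4 * z * u = 4 * k * (u + v) + \<alpha> * k * z * v"
    and E2: "4 * z * v = 4 * l * (u + v) + \<alpha> * l * z * u"
    and E3: "32 * (k + l - z) + 8 * k * l - 8 * k * v - 8 * u * l + \<alpha> * k * l * z = 2 * \<alpha> * z * (k * v + u * l)"
    unfolding k' l' z' \<alpha> using nz' m2
    by (simp_all add: divide_simps) (simp_all add: algebra_simps)
  let ?Q = "D a b c * full F"
  let ?K = "\<lambda>i j. i (j F) a b c" and ?S = "\<lambda>i j. i (bridge (j F)) a b c"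
  let ?K11 = "?K ext1 ctr1" and ?K12 = "?K ext1 ctr2" and ?K13 = "?K ext1 ctr3"
  let ?K21 = "?K ext2 ctr1" and ?K22 = "?K ext2 ctr2" and ?K23 = "?K ext2 ctr3"
  let ?K31 = "?K ext3 ctr1" and ?K32 = "?K ext3 ctr2" and ?K33 = "?K ext3 ctr3"
  let ?S11 = "?S ext1 ctr1" and ?S12 = "?S ext1 ctr2" and ?S13 = "?S ext1 ctr3"
  let ?S21 = "?S ext2 ctr1" and ?S22 = "?S ext2 ctr2" and ?S23 = "?S ext2 ctr3"
  let ?S31 = "?S ext3 ctr1" and ?S32 = "?S ext3 ctr2" and ?S33 = "?S ext3 ctr3"
  let ?T = "ext3 (bridge (bridge (ctr3 F))) a b c" and ?U = "ext1 (bridge (bridge (ctr1 F))) a b c"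
  note rows = row_sums[of F a b c]
  note cols = ext_bridge_sum[of "ctr1 F" a b c] ext_bridge_sum[of "ctr2 F" a b c]
  note TU = ext_bridge_bridge(1)[of "ctr3 F" a b c] ext_bridge_bridge(2)[of "ctr1 F" a b c]
  \<comment> \<open>An explicit certificate: the row, column and square rules appear with their
    multipliers, and the remaining coefficients are exactly the differences in \<open>E0\<close> to
    \<open>E3\<close>. The overall factor 2 matches the 2 in front of the squared bridge.\<close>
  have "2 * (R_left u k (R_right (u + v) z (R_left v l F)) a b c
      - R_right v l (R_left (u + v) z (R_right u k F)) a b c)
    = 2 * (k * z * v + u * z * l) * (?S11 + ?S21 + ?S31 - \<alpha> * (?Q + ?K11 + ?K21 + ?K31))
    + 2 * u * z * l * (?S12 + ?S22 + ?S32 - \<alpha> * (?Q + ?K12 + ?K22 + ?K32))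
    - 2 * u * z * l * (?S21 + ?S22 + ?S23 - \<alpha> * (?Q + ?K21 + ?K22 + ?K23))
    - 2 * (k * z * v + u * z * l) * (?S31 + ?S32 + ?S33 - \<alpha> * (?Q + ?K31 + ?K32 + ?K33))
    + k * l * z * ((2 * ?T - (\<alpha> * (?Q + ?K33) + (2 * \<alpha> - 1) * ?S33))
         - (2 * ?U - (\<alpha> * (?Q + ?K11) + (2 * \<alpha> - 1) * ?S11)))
    + (2 * k * l * (u + v) + k * l * z * (1 - 2 * \<alpha>) - 2 * z * (k * v + u * l)) * (?S11 - ?S33)
    + (32 * (k + l - z) + 8 * k * l - 8 * k * v - 8 * u * l + \<alpha> * k * l * z
         - 2 * \<alpha> * z * (k * v + u * l)) * (?K33 - ?K11)
    + 2 * (4 * z * u - (4 * k * (u + v) + \<alpha> * k * z * v)) * (?K32 - ?K21)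
    + 2 * (4 * z * v - (4 * l * (u + v) + \<alpha> * l * z * u)) * (?K23 - ?K12)"
    by (simp only: R_left_def R_right_def op_linear swap_linear ctr_swap swap_ext swap_swap ctr_ext_same ctr_ext_diff)
      (simp add: algebra_simps)
  also have "\<dots> = 0"
    using rows cols TU E0 E1 E2 E3 unfolding trace_ctr by simp
  finally show ?thesis by simp
qed

text \<open>Put g = a in the Springer relation and sum. By the normalisation each left-hand term
  reproduces \<open>d b c e\<close>, while the four deltas on the right contribute n + 1 + 1 + 1
  copies. Some entry of \<open>d\<close> is nonzero, again by the normalisation.\<close>

lemma springer_constant: "\<alpha> * (of_nat CARD('n) + 3) = 3"
proof -
  have contract2: "(\<Sum>a\<in>UNIV. \<Sum>p\<in>UNIV. \<Sum>q\<in>UNIV. D a p q * (d a b p * f q)) = f b" for b f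
  proof -
    have "(\<Sum>a\<in>UNIV. \<Sum>p\<in>UNIV. \<Sum>q\<in>UNIV. D a p q * (d a b p * f q))
        = (\<Sum>q\<in>UNIV. \<Sum>a\<in>UNIV. \<Sum>p\<in>UNIV. (D q a p * d b a p) * f q)"
      unfolding sum_nested3
      by (rule sum.reindex_bij_witness[where i = "\<lambda>(q, a, p). (a, p, q)" and j = "\<lambda>(a, p, q). (q, a, p)"])
        (auto simp: D_sym D_sym' d_sym algebra_simps)
    also have "\<dots> = (\<Sum>q\<in>UNIV. (\<Sum>a\<in>UNIV. \<Sum>p\<in>UNIV. D q a p * d b a p) * f q)"
      by (simp only: sum_distrib_right)
    also have "\<dots> = f b"
      by (simp add: contract if_distrib[of "\<lambda>t. t * _"] cong: if_cong)
    finally show ?thesis .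
  qed
  have *: "3 * d b c e = \<alpha> * (of_nat CARD('n) + 3) * d b c e" for b c e
  proof -
    have "(\<Sum>a\<in>UNIV. \<Sum>p\<in>UNIV. \<Sum>q\<in>UNIV. D a p q * (d a b p * d c e q + d a c p * d b e q + d a e p * d b c q))
       = 3 * d b c e"
      unfolding distrib_left sum.distrib contract2
      by (simp add: d_sym d_sym')
    moreover have "(\<Sum>a\<in>UNIV. \<Sum>p\<in>UNIV. \<Sum>q\<in>UNIV. D a p q * (d a b p * d c e q + d a c p * d b e q + d a e p * d b c q))
       = \<alpha> * (of_nat CARD('n) + 3) * d b c e"
      unfolding springer sum_distrib_left[symmetric] sum.distrib by (simp add: d_sym d_sym' algebra_simps)
    ultimately show ?thesis by simp
  qed
  have "\<exists>b c e. d b c e \<noteq> 0"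
  proof (rule ccontr)
    assume "\<not> ?thesis"
    then show False using contract[of undefined undefined] by simp
  qed
  then show ?thesis using * by auto
qed

end

section \<open>From tensors with indices to matrices on tensor powers\<close>

lemma sum_UNIV_pair: "(\<Sum>z\<in>UNIV. f z) = (\<Sum>a\<in>UNIV. \<Sum>b\<in>UNIV. f (a, b))"
  for f :: "'a::finite \<times> 'b::finite \<Rightarrow> 'c::comm_monoid_add"
  by (simp add: sum.cartesian_product UNIV_Times_UNIV[symmetric] del: UNIV_Times_UNIV)

lemma tensor_id_apply:
  "(tensor_id X *v x) $ (a, b, c) = (\<Sum>a'\<in>UNIV. \<Sum>b'\<in>UNIV. X $ (a, b) $ (a', b') * x $ (a', b', c))"
  by (simp add: matrix_vector_mult_def tensor_id_def sum_UNIV_pair if_distrib[of "\<lambda>t. t * _"] cong: if_cong)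

lemma id_tensor_apply:
  "(id_tensor X *v x) $ (a, b, c) = (\<Sum>b'\<in>UNIV. \<Sum>c'\<in>UNIV. X $ (b, c) $ (b', c') * x $ (a, b', c'))"
proof -
  have "(id_tensor X *v x) $ (a, b, c)
     = (\<Sum>a'\<in>UNIV. if a = a' then \<Sum>b'\<in>UNIV. \<Sum>c'\<in>UNIV. X $ (b, c) $ (b', c') * x $ (a', b', c') else 0)"
  proof -
    have "(\<Sum>b'\<in>UNIV. \<Sum>c'\<in>UNIV. (if a = a' then X $ (b, c) $ (b', c') else 0) * x $ (a', b', c'))
       = (if a = a' then \<Sum>b'\<in>UNIV. \<Sum>c'\<in>UNIV. X $ (b, c) $ (b', c') * x $ (a', b', c') else 0)" for a'
      by (cases "a = a'") simp_all
    then show ?thesis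
      by (simp add: matrix_vector_mult_def id_tensor_def sum_UNIV_pair)
  qed
  then show ?thesis by simp
qed

lemma R_check_nth:
  "R_check m d D u $ (a, b) $ (a', b')
    = 4 * (if a = a' \<and> b = b' then 1 else 0) - u * (if a = b' \<and> b = a' then 1 else 0)
      + (4 * of_nat m + 8) * u / (2 * of_nat m - u) * (\<Sum>e\<in>UNIV. D $ (a, b, e) * d $ (e, a', b'))"
  by (simp add: R_check_def scale_matrix_def flip_op_def K_op_def mat_def)

lemma sum_delta_pair:
  "(\<Sum>a'\<in>UNIV. \<Sum>b'\<in>UNIV. (if a = a' \<and> b = b' then 1 else 0) * f a' b') = f a b"
  "(\<Sum>a'\<in>UNIV. \<Sum>b'\<in>UNIV. (if a = b' \<and> b = a' then 1 else 0) * f a' b') = f b a"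
  for f :: "'a::finite \<Rightarrow> 'a \<Rightarrow> complex"
proof -
  have "(\<Sum>b'\<in>UNIV. (if a = a' \<and> b = b' then 1 else 0) * f a' b') = (if a = a' then f a' b else 0)" for a' a b
    by (cases "a = a'") (simp_all add: if_distrib[of "\<lambda>t. t * _"] cong: if_cong)
  from this[of a _ b] this[of b _ a]
  show "(\<Sum>a'\<in>UNIV. \<Sum>b'\<in>UNIV. (if a = a' \<and> b = b' then 1 else 0) * f a' b') = f a b"
    "(\<Sum>a'\<in>UNIV. \<Sum>b'\<in>UNIV. (if a = b' \<and> b = a' then 1 else 0) * f a' b') = f b a"
    by (simp_all add: conj_commute[of "a = _" "b = _"])
qed

lemma sum_R_check:
  fixes f :: "'n::finite \<Rightarrow> 'n \<Rightarrow> complex"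
  shows "(\<Sum>a'\<in>UNIV. \<Sum>b'\<in>UNIV. R_check m d D u $ (a, b) $ (a', b') * f a' b')
    = 4 * f a b + - u * f b a + (4 * of_nat m + 8) * u / (2 * of_nat m - u)
        * (\<Sum>e\<in>UNIV. D $ (a, b, e) * (\<Sum>p\<in>UNIV. \<Sum>q\<in>UNIV. d $ (e, p, q) * f p q))"
proof -
  have 1: "(\<Sum>a'\<in>UNIV. \<Sum>b'\<in>UNIV. (\<Sum>e\<in>UNIV. D $ (a, b, e) * d $ (e, a', b')) * f a' b')
      = (\<Sum>e\<in>UNIV. D $ (a, b, e) * (\<Sum>p\<in>UNIV. \<Sum>q\<in>UNIV. d $ (e, p, q) * f p q))"
    unfolding sum_distrib_left sum_distrib_right sum_nested3
    by (rule sum.reindex_bij_witness[where i = "\<lambda>(e, p, q). (p, q, e)" and j = "\<lambda>(p, q, e). (e, p, q)"])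
      (auto simp: mult.assoc)
  have "(\<Sum>a'\<in>UNIV. \<Sum>b'\<in>UNIV. (4 * (if a = a' \<and> b = b' then 1 else 0) - u * (if a = b' \<and> b = a' then 1 else 0)
        + k * (\<Sum>e\<in>UNIV. D $ (a, b, e) * d $ (e, a', b'))) * f a' b')
     = 4 * f a b + - u * f b a + k * (\<Sum>e\<in>UNIV. D $ (a, b, e) * (\<Sum>p\<in>UNIV. \<Sum>q\<in>UNIV. d $ (e, p, q) * f p q))" for k
    unfolding left_diff_distrib distrib_right sum.distrib sum_subtractf mult.assoc[of 4] mult.assoc[of u]
      mult.assoc[of k] sum_distrib_left[symmetric] sum_delta_pair 1
    by simp
  then show ?thesis
    unfolding R_check_nth .
qed

definition springer_tensors :: "complex^('n::finite \<times> 'n \<times> 'n) \<Rightarrow> complex^('n \<times> 'n \<times> 'n) \<Rightarrow> bool"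
  where "springer_tensors d D \<longleftrightarrow> (\<exists>\<alpha>. springer_pair (\<lambda>i j k. d $ (i, j, k)) (\<lambda>i j k. D $ (i, j, k)) \<alpha>)"

lemma R_check_yang_baxter:
  fixes d D :: "complex^('n::finite \<times> 'n \<times> 'n)" and u v :: complex
  assumes pair: "springer_tensors d D"
    and card: "CARD('n) = 3 * m + 3"
    and nz: "u \<noteq> 2 * of_nat m" "v \<noteq> 2 * of_nat m" "u + v \<noteq> 2 * of_nat m"
  shows "tensor_id (R_check m d D u) ** id_tensor (R_check m d D (u + v)) ** tensor_id (R_check m d D v)
       = id_tensor (R_check m d D v) ** tensor_id (R_check m d D (u + v)) ** id_tensor (R_check m d D u)"
proof -
  obtain \<alpha> where "springer_pair (\<lambda>a b c. d $ (a, b, c)) (\<lambda>a b c. D $ (a, b, c)) \<alpha>"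
    using pair unfolding springer_tensors_def by blast
  then interpret springer_pair "\<lambda>a b c. d $ (a, b, c)" "\<lambda>a b c. D $ (a, b, c)" \<alpha> .
  define k where "k s = (4 * of_nat m + 8) * s / (2 * of_nat m - s)" for s :: complex
  define comp where "comp x = (\<lambda>a b c. x $ (a, b, c))" for x :: "complex^('n \<times> 'n \<times> 'n)"
  have left: "comp (tensor_id (R_check m d D s) *v x) = R_left s (k s) (comp x)" for s x
    by (intro ext) (simp add: comp_def R_left_def k_def tensor_id_apply sum_R_check swap_left_def ext3_def ctr3_def)
  have right: "comp (id_tensor (R_check m d D s) *v x) = R_right s (k s) (comp x)" for s x
  proof (intro ext)
    fix a b c
    have cyc: "D $ (a, b, c) = D $ (b, a, c)" for a b c by (rule D_sym)
    show "comp (id_tensor (R_check m d D s) *v x) a b c = R_right s (k s) (comp x) a b c"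
      by (simp add: comp_def R_right_def k_def id_tensor_apply sum_R_check swap_right_def ext1_def ctr1_def)
  qed
  have inj: "x = y" if "comp x = comp y" for x y
    using that by (auto simp: comp_def vec_eq_iff fun_eq_iff)
  \<comment> \<open>The dimension enters here: n = 3 m + 3 turns \<alpha> (n + 3) = 3 into the
    relation that fits the coefficient of K.\<close>
  have "\<alpha> * (of_nat m + 2) = 1"
  proof -
    have "3 * (\<alpha> * (of_nat m + 2)) = \<alpha> * (of_nat CARD('n) + 3)" unfolding card by (simp add: algebra_simps)
    then show ?thesis using springer_constant by simp
  qed
  moreover have "k s * (2 * of_nat m - s) = (4 * of_nat m + 8) * s" if "s \<noteq> 2 * of_nat m" for s
    using that by (simp add: k_def)
  ultimately have "R_left u (k u) (R_right (u + v) (k (u + v)) (R_left v (k v) F))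
     = R_right v (k v) (R_left (u + v) (k (u + v)) (R_right u (k u) F))" for F
    using nz by (intro ext yang_baxter) auto
  then show ?thesis
    unfolding matrix_eq matrix_vector_mul_assoc[symmetric]
    by (intro allI inj) (simp only: left right)
qed

section \<open>Cubic forms with an adjoint\<close>

text \<open>Evaluation at x + y and x - y separates \<open>f x x y\<close> from
  \<open>f x y y\<close>. The set \<open>U\<close> allows identities that are known on symmetric or
  skew tensors only.\<close>

lemma trilinear_polarization:
  fixes f :: "complex^'k \<Rightarrow> complex^'k \<Rightarrow> complex^'k \<Rightarrow> complex"
  assumes U: "\<And>x y. x \<in> U \<Longrightarrow> y \<in> U \<Longrightarrow> x + y \<in> U" "\<And>x. x \<in> U \<Longrightarrow> - x \<in> U"
    and add: "\<And>x y z w. \<lbrakk>x \<in> U; y \<in> U; z \<in> U; w \<in> U\<rbrakk> \<Longrightarrow> f (x + y) z w = f x z w + f y z w"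
    and neg: "\<And>x z w. \<lbrakk>x \<in> U; z \<in> U; w \<in> U\<rbrakk> \<Longrightarrow> f (- x) z w = - f x z w"
    and sym: "\<And>x y z. \<lbrakk>x \<in> U; y \<in> U; z \<in> U\<rbrakk> \<Longrightarrow> f y x z = f x y z"
             "\<And>x y z. \<lbrakk>x \<in> U; y \<in> U; z \<in> U\<rbrakk> \<Longrightarrow> f x z y = f x y z"
    and diag: "\<And>x. x \<in> U \<Longrightarrow> f x x x = 0"
    and xyz: "x \<in> U" "y \<in> U" "z \<in> U"
  shows "f x y z = 0"
proof -
  have add': "f z (x + y) w = f z x w + f z y w" "f z w (x + y) = f z w x + f z w y"
    "f z (- x) w = - f z x w" "f z w (- x) = - f z w x"
    if "x \<in> U" "y \<in> U" "z \<in> U" "w \<in> U" for x y z w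
  proof -
    show "f z (x + y) w = f z x w + f z y w"
      using add[OF that] sym(1)[of z "x + y" w] sym(1)[of z x w] sym(1)[of z y w] that U by simp
    then show "f z w (x + y) = f z w x + f z w y"
      using sym(2)[of z "x + y" w] sym(2)[of z x w] sym(2)[of z y w] that U by simp
    show "f z (- x) w = - f z x w"
      using neg[of x z w] sym(1)[of z "- x" w] sym(1)[of z x w] that U by simp
    then show "f z w (- x) = - f z w x"
      using sym(2)[of z "- x" w] sym(2)[of z x w] that U by simp
  qed
  have two: "f x x y = 0" if "x \<in> U" "y \<in> U" for x y
  proof -
    have s: "f y x x = f x x y" "f x y x = f x x y" "f y y x = f x y y" "f y x y = f x y y"
      using that sym by metis+
    have "f (x + y) (x + y) (x + y) = 0" "f (x + - y) (x + - y) (x + - y) = 0"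
      using that U by (blast intro: diag)+
    then have "3 * f x x y + 3 * f x y y = 0" "3 * f x y y + - (3 * f x x y) = 0"
      using that U diag[OF that(1)] diag[OF that(2)]
      by (simp_all add: add add' neg s algebra_simps del: add_uminus_conv_diff)
    then have "6 * f x x y = 0" by algebra
    then show ?thesis by simp
  qed
  have "f (x + y) (x + y) z = 0" using xyz U two by blast
  then show ?thesis
    using xyz U two[of x z] two[of y z] sym(1)[of x y z] by (simp add: add add')
qed

text \<open>Adding the values at x + y and x - y isolates \<open>f x x y y\<close>; replacing y by x
  + y there gives \<open>f x x x y\<close>. With the last argument fixed the cubic case finishes the
  proof.\<close>

lemma quartic_polarization:
  fixes f :: "complex^'k \<Rightarrow> complex^'k \<Rightarrow> complex^'k \<Rightarrow> complex^'k \<Rightarrow> complex"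
  assumes U: "\<And>x y. x \<in> U \<Longrightarrow> y \<in> U \<Longrightarrow> x + y \<in> U" "\<And>x. x \<in> U \<Longrightarrow> - x \<in> U"
    and add: "\<And>x y z w v. \<lbrakk>x \<in> U; y \<in> U; z \<in> U; w \<in> U; v \<in> U\<rbrakk> \<Longrightarrow> f (x + y) z w v = f x z w v + f y z w v"
    and neg: "\<And>x z w v. \<lbrakk>x \<in> U; z \<in> U; w \<in> U; v \<in> U\<rbrakk> \<Longrightarrow> f (- x) z w v = - f x z w v"
    and sym: "\<And>x y z w. \<lbrakk>x \<in> U; y \<in> U; z \<in> U; w \<in> U\<rbrakk> \<Longrightarrow> f y x z w = f x y z w"
             "\<And>x y z w. \<lbrakk>x \<in> U; y \<in> U; z \<in> U; w \<in> U\<rbrakk> \<Longrightarrow> f x z y w = f x y z w"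
             "\<And>x y z w. \<lbrakk>x \<in> U; y \<in> U; z \<in> U; w \<in> U\<rbrakk> \<Longrightarrow> f x y w z = f x y z w"
    and diag: "\<And>x. x \<in> U \<Longrightarrow> f x x x x = 0"
    and xyz: "x \<in> U" "y \<in> U" "z \<in> U" "w \<in> U"
  shows "f x y z w = 0"
proof -
  have add': "f z (x + y) w v = f z x w v + f z y w v" "f z w (x + y) v = f z w x v + f z w y v"
    "f z w v (x + y) = f z w v x + f z w v y"
    "f z (- x) w v = - f z x w v" "f z w (- x) v = - f z w x v" "f z w v (- x) = - f z w v x"
    if "x \<in> U" "y \<in> U" "z \<in> U" "w \<in> U" "v \<in> U" for x y z w v
  proof -
    show "f z (x + y) w v = f z x w v + f z y w v"
      using add[of x y z w v] sym(1)[of z "x + y" w v] sym(1)[of z x w v] sym(1)[of z y w v] that U by simp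
    then show "f z w (x + y) v = f z w x v + f z w y v"
      using sym(2)[of z "x + y" w v] sym(2)[of z x w v] sym(2)[of z y w v] that U by simp
    then show "f z w v (x + y) = f z w v x + f z w v y"
      using sym(3)[of z w "x + y" v] sym(3)[of z w x v] sym(3)[of z w y v] that U by simp
    show "f z (- x) w v = - f z x w v"
      using neg[of x z w v] sym(1)[of z "- x" w v] sym(1)[of z x w v] that U by simp
    then show "f z w (- x) v = - f z w x v"
      using sym(2)[of z "- x" w v] sym(2)[of z x w v] that U by simp
    then show "f z w v (- x) = - f z w v x"
      using sym(3)[of z w "- x" v] sym(3)[of z w x v] that U by simp
  qed
  have two: "f x x y y = 0" if xy: "x \<in> U" "y \<in> U" for x y
  proof -
    have s: "f y x x x = f x x x y" "f x y x x = f x x x y" "f x x y x = f x x x y"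
      "f y y x x = f x x y y" "f y x y x = f x x y y" "f y x x y = f x x y y"
      "f x y y x = f x x y y" "f x y x y = f x x y y"
      "f y y y x = f x y y y" "f y y x y = f x y y y" "f y x y y = f x y y y"
      using xy sym by metis+
    have "f (x + y) (x + y) (x + y) (x + y) = 0" "f (x + - y) (x + - y) (x + - y) (x + - y) = 0"
      using xy U by (blast intro: diag)+
    then have "4 * f x y y y + (6 * f x x y y + 4 * f x x x y) = 0"
      "6 * f x x y y + (- (4 * f x x x y) - 4 * f x y y y) = 0"
      using xy U diag[OF xy(1)] diag[OF xy(2)]
      by (simp_all add: add add' neg s del: add_uminus_conv_diff)
    then have "12 * f x x y y = 0" by algebra
    then show ?thesis by simp
  qed
  have three: "f x x x y = 0" if xy: "x \<in> U" "y \<in> U" for x y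
  proof -
    have "f x x (x + y) (x + y) = 0" "f x x y y = 0" using xy U two by blast+
    moreover have "f x x y x = f x x x y" using xy sym by metis
    ultimately show ?thesis
      using xy U diag[OF xy(1)] by (simp add: add')
  qed
  show ?thesis
  proof (rule trilinear_polarization[of U "\<lambda>x y z. f x y z w"])
    show "f x x x w = 0" if "x \<in> U" for x using three that xyz by blast
  qed (use U add neg sym xyz in auto)
qed

text \<open>Bilinear, without complex conjugation: it identifies the space with its dual, so that
  one cubic form yields invariants with lower and with upper indices.\<close>

definition pair :: "complex^'k \<Rightarrow> complex^'k \<Rightarrow> complex"
  where "pair x y = (\<Sum>i\<in>UNIV. x $ i * y $ i)"

lemma pair_commute: "pair x y = pair y x"
  by (simp add: pair_def mult.commute)

lemma pair_add: "pair (x + y) z = pair x z + pair y z" "pair z (x + y) = pair z x + pair z y"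
  by (simp_all add: pair_def sum.distrib algebra_simps)

lemma pair_scale: "pair (a *s x) y = a * pair x y" "pair x (a *s y) = a * pair x y"
  by (simp_all add: pair_def sum_distrib_left algebra_simps)

lemma pair_minus: "pair (- x) y = - pair x y" "pair x (- y) = - pair x y"
  by (simp_all add: pair_def sum_negf)

lemma pair_zero: "pair 0 y = 0" "pair x 0 = 0"
  by (simp_all add: pair_def)

lemma pair_sum: "pair (\<Sum>i\<in>I. f i) y = (\<Sum>i\<in>I. pair (f i) y)" "pair x (\<Sum>i\<in>I. f i) = (\<Sum>i\<in>I. pair x (f i))"
  by (induction I rule: infinite_finite_induct) (simp_all add: pair_zero pair_add)

lemma pair_axis: "pair (axis i 1) x = x $ i" "pair x (axis i 1) = x $ i"
  by (simp_all add: pair_def axis_def if_distrib[of "\<lambda>t. t * _"] if_distrib[of "\<lambda>t. _ * t"] cong: if_cong)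

lemma pair_eqI: "(\<And>z. pair x z = pair y z) \<Longrightarrow> x = y"
  by (metis pair_axis(2) vec_eq_iff)

text \<open>\<open>c i\<close> is the vector that represents the functional "i-th coordinate of
  \<open>proj x\<close>" under \<open>pair\<close>. Self-adjointness of \<open>proj\<close> puts it
  into the image of \<open>proj\<close>.\<close>

lemma dual_basis_exists:
  fixes b :: "'n::finite \<Rightarrow> complex^'k" and proj :: "complex^'k \<Rightarrow> complex^'k"
  assumes proj: "\<And>x y. proj (x + y) = proj x + proj y" "\<And>a x. proj (a *s x) = a *s proj x"
    "\<And>x. proj (proj x) = proj x" "\<And>x y. pair (proj x) y = pair x (proj y)"
    and b: "is_basis_of b {x. proj x = x}"
  obtains c where "\<And>i. proj (c i) = c i" "\<And>i j. pair (b i) (c j) = (if i = j then 1 else 0)"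
    "\<And>x. proj x = x \<Longrightarrow> (\<Sum>i\<in>UNIV. pair x (c i) *s b i) = x"
    "\<And>x. proj x = x \<Longrightarrow> (\<Sum>i\<in>UNIV. pair x (b i) *s c i) = x"
proof -
  have inj: "inj b" and indep: "vec.independent (range b)" and span: "vec.span (range b) = {x. proj x = x}"
    using b by (auto simp: is_basis_of_def)
  define \<phi> where "\<phi> i x = vec.representation (range b) (proj x) (b i)" for i x
  have in_span: "proj x \<in> vec.span (range b)" for x by (simp add: span proj(3))
  have \<phi>_add: "\<phi> i (x + y) = \<phi> i x + \<phi> i y" for i x y
    by (simp add: \<phi>_def proj(1) vec.representation_add[OF indep in_span in_span])
  have \<phi>_scale: "\<phi> i (a *s x) = a * \<phi> i x" for i a x
    by (simp add: \<phi>_def proj(2) vec.representation_scale[OF indep in_span])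
  have \<phi>_zero: "\<phi> i 0 = 0" for i using \<phi>_scale[of i 0 0] by simp
  have \<phi>_sum: "\<phi> i (\<Sum>j\<in>J. f j) = (\<Sum>j\<in>J. \<phi> i (f j))" for i J and f :: "'k \<Rightarrow> complex^'k"
    by (induction J rule: infinite_finite_induct) (simp_all add: \<phi>_zero \<phi>_add)
  define c where "c i = (\<chi> j. \<phi> i (axis j 1))" for i
  have pair_c: "pair (c i) x = \<phi> i x" for i x
  proof -
    have "\<phi> i x = \<phi> i (\<Sum>j\<in>UNIV. x $ j *s axis j 1)"
      by (simp add: basis_expansion)
    also have "\<dots> = pair (c i) x"
      by (simp add: \<phi>_sum \<phi>_scale pair_def c_def mult.commute)
    finally show ?thesis ..
  qed
  have b_proj: "proj (b i) = b i" for i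
    using span vec.span_base[of "b i" "range b"] by auto
  have rep: "(\<Sum>i\<in>UNIV. pair x (c i) *s b i) = x" if "proj x = x" for x
  proof -
    have "(\<Sum>v\<in>range b. vec.representation (range b) x v *s v) = x"
      by (rule vec.sum_representation_eq[OF indep]) (use that span in auto)
    then show ?thesis
      by (simp add: sum.reindex[OF inj] pair_commute[of x] pair_c \<phi>_def that)
  qed
  show thesis
  proof (rule that[of c])
    show c_proj: "proj (c i) = c i" for i
      by (rule pair_eqI) (simp add: proj(4) pair_c \<phi>_def proj(3))
    show "pair (b i) (c j) = (if i = j then 1 else 0)" for i j
      using vec.representation_basis[OF indep, of "b i"] inj
      by (simp add: pair_commute[of "b i"] pair_c \<phi>_def b_proj inj_eq)
    show "(\<Sum>i\<in>UNIV. pair x (c i) *s b i) = x" if "proj x = x" for x by (rule rep[OF that])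
    show "(\<Sum>i\<in>UNIV. pair x (b i) *s c i) = x" if "proj x = x" for x
    proof (rule pair_eqI)
      fix z
      have "pair x z = pair x (proj z)" using proj(4)[of x z] that by simp
      also have "\<dots> = pair x (\<Sum>i\<in>UNIV. pair (proj z) (c i) *s b i)" by (simp add: rep proj(3))
      also have "\<dots> = (\<Sum>i\<in>UNIV. pair x (b i) * pair z (c i))"
        by (simp add: pair_sum pair_scale proj(4) c_proj mult.commute)
      also have "\<dots> = pair (\<Sum>i\<in>UNIV. pair x (b i) *s c i) z"
        by (simp add: pair_sum pair_scale pair_commute)
      finally show "pair (\<Sum>i\<in>UNIV. pair x (b i) *s c i) z = pair x z" ..
    qed
  qed
qed

text \<open>The form lives on the image of \<open>proj\<close> in a larger space;
  \<open>proj\<close> will be the identity, symmetrisation or antisymmetrisation. With x# =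
  \<open>cross x x\<close> / 2 and N(x) = \<open>pair (cross x x) x\<close> / 6, the assumption
  \<open>adjoint\<close> reads (x#)# = \<beta> N(x) x. The 3 and 4 count the terms of its
  polarisation.\<close>

locale cubic_norm =
  fixes proj :: "complex^'k \<Rightarrow> complex^'k"
    and cross :: "complex^'k \<Rightarrow> complex^'k \<Rightarrow> complex^'k"
    and \<beta> :: complex
  assumes proj_add: "proj (x + y) = proj x + proj y"
    and proj_scale: "proj (a *s x) = a *s proj x"
    and proj_proj: "proj (proj x) = proj x"
    and proj_selfadjoint: "pair (proj x) y = pair x (proj y)"
    and cross_add: "cross (x + y) z = cross x z + cross y z"
    and cross_scale: "cross (a *s x) y = a *s cross x y"
    and cross_commute: "cross x y = cross y x"
    and cross_pair: "pair (cross x y) z = pair (cross x z) y"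
    and cross_proj: "\<lbrakk>proj x = x; proj y = y\<rbrakk> \<Longrightarrow> proj (cross x y) = cross x y"
    and adjoint: "proj x = x \<Longrightarrow> 3 *s cross (cross x x) (cross x x) = (4 * \<beta> * pair (cross x x) x) *s x"
    and nontrivial: "\<exists>x. proj x = x \<and> pair (cross x x) x \<noteq> 0"
begin

definition form :: "complex^'k \<Rightarrow> complex^'k \<Rightarrow> complex^'k \<Rightarrow> complex"
  where "form x y z = pair (cross x y) z"

lemma form_sym: "form y x z = form x y z" "form x z y = form x y z"
  by (simp_all add: form_def cross_commute[of y x] cross_pair[of x y z])

lemma form_add: "form (x + y) z w = form x z w + form y z w" "form z (x + y) w = form z x w + form z y w"
    "form z w (x + y) = form z w x + form z w y"
  by (simp_all add: form_def cross_add pair_add cross_commute[of z])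

lemma form_scale: "form (a *s x) z w = a * form x z w" "form z (a *s x) w = a * form z x w"
    "form z w (a *s x) = a * form z w x"
  by (simp_all add: form_def cross_scale pair_scale cross_commute[of z])

lemma form_zero: "form 0 y z = 0" "form y 0 z = 0" "form y z 0 = 0"
  using form_scale(1)[of 0 0] form_scale(2)[of _ 0 0] form_scale(3)[of _ _ 0 0] by simp_all

lemma form_sum:
  "form (\<Sum>i\<in>I. f i) y z = (\<Sum>i\<in>I. form (f i) y z)"
  "form y (\<Sum>i\<in>I. f i) z = (\<Sum>i\<in>I. form y (f i) z)"
  "form y z (\<Sum>i\<in>I. f i) = (\<Sum>i\<in>I. form y z (f i))"
  by (induction I rule: infinite_finite_induct) (simp_all add: form_zero form_add)

lemma cross_minus: "cross (- x) y = - cross x y"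
  using cross_scale[of "-1" x y] by (simp add: vec_eq_iff)

lemma form_minus: "form (- x) y z = - form x y z"
  by (simp add: form_def cross_minus pair_minus)

lemma proj_minus: "proj (- x) = - proj x"
  using proj_scale[of "-1" x] by (simp add: vec_eq_iff)

text \<open>The difference of the two sides is symmetric and additive in four arguments, and
  \<open>adjoint\<close> says that it vanishes on the diagonal.\<close>

lemma adjoint_polarized:
  assumes "proj x = x" "proj y = y" "proj z = z" "proj w = w"
  shows "pair (cross (cross x y) (cross z w) + cross (cross x z) (cross y w) + cross (cross x w) (cross y z)) g
     = \<beta> * (form y z w * pair x g + form x z w * pair y g + form x y w * pair z g + form x y z * pair w g)"
proof -
  define f where "f x y z w =
      pair (cross (cross x y) (cross z w) + cross (cross x z) (cross y w) + cross (cross x w) (cross y z)) g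
     - \<beta> * (form y z w * pair x g + form x z w * pair y g + form x y w * pair z g + form x y z * pair w g)" for x y z w
  have "f x y z w = 0"
  proof (rule quartic_polarization[where U = "{x. proj x = x}" and f = f])
    fix x assume "x \<in> {x. proj x = x}"
    then have "pair (3 *s cross (cross x x) (cross x x)) g = pair ((4 * \<beta> * pair (cross x x) x) *s x) g"
      by (simp add: adjoint)
    then show "f x x x x = 0"
      unfolding f_def pair_add by (simp add: form_def pair_scale)
  next
    show "f (x + y) z w v = f x z w v + f y z w v" for x y z w v
      by (simp add: f_def form_add pair_add cross_add algebra_simps)
    show "f (- x) z w v = - f x z w v" for x z w v
      unfolding f_def cross_minus pair_add by (simp add: form_minus pair_minus cross_minus algebra_simps)
    show "f y x z w = f x y z w" for x y z w
      unfolding f_def pair_add by (simp add: form_sym cross_commute algebra_simps)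
    show "f x z y w = f x y z w" for x y z w
      unfolding f_def pair_add by (simp add: form_sym cross_commute algebra_simps)
    show "f x y w z = f x y z w" for x y z w
      unfolding f_def pair_add by (simp add: form_sym cross_commute algebra_simps)
  qed (use assms in \<open>auto simp: proj_add proj_minus\<close>)
  then show ?thesis by (simp add: f_def)
qed

section \<open>The Springer relation for the components in dual bases\<close>

definition dual_bases :: "('n::finite \<Rightarrow> complex^'k) \<Rightarrow> ('n \<Rightarrow> complex^'k) \<Rightarrow> bool"
  where "dual_bases b c \<longleftrightarrow> (\<forall>i. proj (b i) = b i \<and> proj (c i) = c i)
    \<and> (\<forall>i j. pair (b i) (c j) = (if i = j then 1 else 0))
    \<and> (\<forall>x. proj x = x \<longrightarrow> (\<Sum>i\<in>UNIV. pair x (c i) *s b i) = x \<and> (\<Sum>i\<in>UNIV. pair x (b i) *s c i) = x)"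

lemma dual_bases_commute: "dual_bases b c \<Longrightarrow> dual_bases c b"
  by (auto simp: dual_bases_def pair_commute[of "c _" "b _"])

text \<open>Summing \<open>form (b i) (b j) (b p)\<close> against \<open>c p\<close> rebuilds the
  vector \<open>cross (b i) (b j)\<close>. Each double sum is therefore a product of two such
  crosses paired with \<open>c g\<close>, to which \<open>adjoint_polarized\<close> applies.\<close>

lemma form_springer:
  fixes b c :: "'n::finite \<Rightarrow> complex^'k"
  assumes "dual_bases b c"
  shows "(\<Sum>p\<in>UNIV. \<Sum>q\<in>UNIV. form (c g) (c p) (c q) *
       (form (b i) (b j) (b p) * form (b k) (b l) (b q) + form (b i) (b k) (b p) * form (b j) (b l) (b q)
         + form (b i) (b l) (b p) * form (b j) (b k) (b q)))
    = \<beta> * ((if g = i then form (b j) (b k) (b l) else 0) + (if g = j then form (b i) (b k) (b l) else 0)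
      + (if g = k then form (b i) (b j) (b l) else 0) + (if g = l then form (b i) (b j) (b k) else 0))"
proof -
  have proj_b: "proj (b i) = b i" for i using assms by (simp add: dual_bases_def)
  have expand: "(\<Sum>p\<in>UNIV. form (b i) (b j) (b p) *s c p) = cross (b i) (b j)" for i j
    using assms cross_proj[of "b i" "b j"] by (auto simp: dual_bases_def form_def)
  have "(\<Sum>p\<in>UNIV. \<Sum>q\<in>UNIV. form (c g) (c p) (c q) * (form (b i) (b j) (b p) * form (b k) (b l) (b q)))
      = form (c g) (\<Sum>p\<in>UNIV. form (b i) (b j) (b p) *s c p) (\<Sum>q\<in>UNIV. form (b k) (b l) (b q) *s c q)" for i j k l
    by (simp add: form_sum form_scale sum_distrib_left algebra_simps) (rule sum.swap)
  then have *: "(\<Sum>p\<in>UNIV. \<Sum>q\<in>UNIV. form (c g) (c p) (c q) * (form (b i) (b j) (b p) * form (b k) (b l) (b q)))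
      = pair (cross (cross (b i) (b j)) (cross (b k) (b l))) (c g)" for i j k l
    unfolding expand by (metis form_def form_sym)
  show ?thesis
    unfolding distrib_left[of "form (c _) (c _) (c _)"] sum.distrib * pair_add(1)[symmetric]
      adjoint_polarized[OF proj_b proj_b proj_b proj_b]
    using assms by (auto simp: dual_bases_def algebra_simps)
qed

lemma form_basis_nontrivial:
  fixes b c :: "'n::finite \<Rightarrow> complex^'k"
  assumes "dual_bases b c"
  shows "\<exists>i j k. form (b i) (b j) (b k) \<noteq> 0"
proof (rule ccontr)
  assume *: "\<not> ?thesis"
  obtain x where x: "proj x = x" "form x x x \<noteq> 0" using nontrivial by (auto simp: form_def)
  have "x = (\<Sum>i\<in>UNIV. pair x (c i) *s b i)" using assms x by (simp add: dual_bases_def)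
  then have "form x x x = form (\<Sum>i\<in>UNIV. pair x (c i) *s b i) (\<Sum>i\<in>UNIV. pair x (c i) *s b i)
      (\<Sum>i\<in>UNIV. pair x (c i) *s b i)" by simp
  also have "\<dots> = 0" using * by (simp add: form_sum form_scale)
  finally show False using x by simp
qed

text \<open>One-dimensionality makes the components of the form in \<open>b\<close> and in
  \<open>c\<close> multiples \<open>s\<close> and \<open>t\<close> of \<open>d\<close> and
  \<open>D\<close>. Both factors are nonzero because the form is, so the Springer relation can be
  transferred.\<close>

lemma springer_pair_of_invariants:
  fixes b c :: "'n::finite \<Rightarrow> complex^'k"
  assumes dual: "dual_bases b c" and inv: "cubic_invariants G d D"
    and lower: "vec_lambda (\<lambda>(i, j, k). form (b i) (b j) (b k)) \<in> Sym3_dual_invariants G"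
    and upper: "vec_lambda (\<lambda>(i, j, k). form (c i) (c j) (c k)) \<in> Sym3_invariants G"
  shows "springer_tensors d D"
proof -
  let ?d = "vec_lambda (\<lambda>(i, j, k). form (b i) (b j) (b k))" and ?D = "vec_lambda (\<lambda>(i, j, k). form (c i) (c j) (c k))"
  have "?d \<in> vec.span {d}" "?D \<in> vec.span {D}"
    using lower upper inv by (auto simp: cubic_invariants_def)
  then obtain s t where s: "?d = s *s d" and t: "?D = t *s D"
    by (auto simp: vec.span_singleton)
  have s': "form (b i) (b j) (b k) = s * d $ (i, j, k)" for i j k
    using arg_cong[OF s, of "\<lambda>x. x $ (i, j, k)"] by simp
  have t': "form (c i) (c j) (c k) = t * D $ (i, j, k)" for i j k
    using arg_cong[OF t, of "\<lambda>x. x $ (i, j, k)"] by simp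
  have st: "s \<noteq> 0" "t \<noteq> 0"
    using form_basis_nontrivial[OF dual] form_basis_nontrivial[OF dual_bases_commute[OF dual]]
    by (auto simp: s' t')
  have d: "d $ (i, j, k) = form (b i) (b j) (b k) / s" for i j k using st by (simp add: s')
  have D: "D $ (i, j, k) = form (c i) (c j) (c k) / t" for i j k using st by (simp add: t')
  have if_div: "(if P then x / (r::complex) else 0) = (if P then x else 0) / r" for P x r by simp
  show ?thesis
    unfolding springer_tensors_def
  \<comment> \<open>The left side of the Springer relation is rescaled by 1 / (t s^2), the right
    side by 1 / s; the quotient is 1 / (s t), and it is the same for the dual relation.\<close>
  proof (intro exI[of _ "\<beta> / (s * t)"] springer_pair.intro)
    show "(\<Sum>p\<in>UNIV. \<Sum>q\<in>UNIV. D $ (a, p, q) * d $ (i, p, q)) = (if a = i then 1 else 0)" for a i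
      using inv by (simp add: cubic_invariants_def)
    show "(\<Sum>p\<in>UNIV. \<Sum>q\<in>UNIV. D $ (g, p, q) * (d $ (i, j, p) * d $ (k, l, q) + d $ (i, k, p) * d $ (j, l, q)
          + d $ (i, l, p) * d $ (j, k, q)))
      = \<beta> / (s * t) * ((if g = i then d $ (j, k, l) else 0) + (if g = j then d $ (i, k, l) else 0)
          + (if g = k then d $ (i, j, l) else 0) + (if g = l then d $ (i, j, k) else 0))" for g i j k l
    proof -
      have "(\<Sum>p\<in>UNIV. \<Sum>q\<in>UNIV. D $ (g, p, q) * (d $ (i, j, p) * d $ (k, l, q) + d $ (i, k, p) * d $ (j, l, q)
          + d $ (i, l, p) * d $ (j, k, q)))
        = (\<Sum>p\<in>UNIV. \<Sum>q\<in>UNIV. form (c g) (c p) (c q) *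
       (form (b i) (b j) (b p) * form (b k) (b l) (b q) + form (b i) (b k) (b p) * form (b j) (b l) (b q)
         + form (b i) (b l) (b p) * form (b j) (b k) (b q))) / (t * s * s)"
        unfolding d D sum_divide_distrib by (intro sum.cong refl) (use st in \<open>simp add: field_simps\<close>)
      also have "\<dots> = \<beta> / (s * t) * ((if g = i then d $ (j, k, l) else 0) + (if g = j then d $ (i, k, l) else 0)
          + (if g = k then d $ (i, j, l) else 0) + (if g = l then d $ (i, j, k) else 0))"
        unfolding form_springer[OF dual] d if_div using st by (simp add: field_simps)
      finally show ?thesis .
    qed
    show "(\<Sum>p\<in>UNIV. \<Sum>q\<in>UNIV. d $ (g, p, q) * (D $ (i, j, p) * D $ (k, l, q) + D $ (i, k, p) * D $ (j, l, q)
          + D $ (i, l, p) * D $ (j, k, q)))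
      = \<beta> / (s * t) * ((if g = i then D $ (j, k, l) else 0) + (if g = j then D $ (i, k, l) else 0)
          + (if g = k then D $ (i, j, l) else 0) + (if g = l then D $ (i, j, k) else 0))" for g i j k l
    proof -
      have "(\<Sum>p\<in>UNIV. \<Sum>q\<in>UNIV. d $ (g, p, q) * (D $ (i, j, p) * D $ (k, l, q) + D $ (i, k, p) * D $ (j, l, q)
          + D $ (i, l, p) * D $ (j, k, q)))
        = (\<Sum>p\<in>UNIV. \<Sum>q\<in>UNIV. form (b g) (b p) (b q) *
       (form (c i) (c j) (c p) * form (c k) (c l) (c q) + form (c i) (c k) (c p) * form (c j) (c l) (c q)
         + form (c i) (c l) (c p) * form (c j) (c k) (c q))) / (s * t * t)"
        unfolding d D sum_divide_distrib by (intro sum.cong refl) (use st in \<open>simp add: field_simps\<close>)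
      also have "\<dots> = \<beta> / (s * t) * ((if g = i then D $ (j, k, l) else 0) + (if g = j then D $ (i, k, l) else 0)
          + (if g = k then D $ (i, j, l) else 0) + (if g = l then D $ (i, j, k) else 0))"
        unfolding form_springer[OF dual_bases_commute[OF dual]] D if_div using st by (simp add: field_simps)
      finally show ?thesis .
    qed
  qed (simp_all add: d D form_sym)
qed

text \<open>Up to the factor 3, the hypothesis on \<open>form x x (T x)\<close> is the derivative of
  the cubic form x -> \<open>form x x x\<close> along T; the conclusion is its polarisation, i.e.
  invariance of the trilinear form.\<close>

lemma derivation_polarized:
  assumes T: "\<And>x y. T (x + y) = T x + T y" "\<And>x. T (- x) = - T x" "\<And>x. proj x = x \<Longrightarrow> form x x (T x) = 0"
    and xyz: "proj x = x" "proj y = y" "proj z = z"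
  shows "form (T x) y z + form x (T y) z + form x y (T z) = 0"
proof (rule trilinear_polarization[where U = "{x. proj x = x}" and f = "\<lambda>x y z. form (T x) y z + form x (T y) z + form x y (T z)"])
  fix x assume "x \<in> {x. proj x = x}"
  then show "form (T x) x x + form x (T x) x + form x x (T x) = 0"
    using T(3)[of x] form_sym(1)[of "T x" x x] form_sym(2)[of x "T x" x] by simp
next
  show "form (T y) x z + form y (T x) z + form y x (T z) = form (T x) y z + form x (T y) z + form x y (T z)" for x y z
    using form_sym(1)[of "T y" x z] form_sym(1)[of y "T x" z] form_sym(1)[of y x "T z"] by simp
  show "form (T x) z y + form x (T z) y + form x z (T y) = form (T x) y z + form x (T y) z + form x y (T z)" for x y z
    using form_sym(2)[of "T x" z y] form_sym(2)[of x "T z" y] form_sym(2)[of x z "T y"] by simp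
qed (use xyz in \<open>auto simp: proj_add proj_minus T form_add form_minus\<close>)

text \<open>The operator represented by \<open>A\<close> is given together with its transpose, which acts on the dual
  tensor.\<close>

definition acts_by_derivation :: "('n::finite \<Rightarrow> complex^'k) \<Rightarrow> complex^'n^'n \<Rightarrow> bool"
  where "acts_by_derivation b A \<longleftrightarrow> (\<exists>T T'. represents_in b T A \<and> (\<forall>x y. pair (T x) y = pair x (T' y))
      \<and> (\<forall>x. proj x = x \<longrightarrow> proj (T' x) = T' x)
      \<and> (\<forall>x y. T (x + y) = T x + T y) \<and> (\<forall>x y. T' (x + y) = T' x + T' y)
      \<and> (\<forall>x. T (- x) = - T x) \<and> (\<forall>x. T' (- x) = - T' x)
      \<and> (\<forall>x. proj x = x \<longrightarrow> form x x (T x) = 0 \<and> form x x (T' x) = 0))"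

text \<open>\<open>T\<close> has the matrix A on \<open>b\<close>, and \<open>T'\<close> has the
  transposed matrix on the dual basis. These are the actions in \<open>Sym3_dual_invariants\<close>
  and \<open>Sym3_invariants\<close>, so the two derivation conditions supply the two
  invariants.\<close>

lemma springer_pair_of_derivations:
  fixes b :: "'n::finite \<Rightarrow> complex^'k"
  assumes b: "is_basis_of b {x. proj x = x}" and inv: "cubic_invariants G d D"
    and act: "\<And>A. A \<in> G \<Longrightarrow> acts_by_derivation b A"
  shows "springer_tensors d D"
proof -
  obtain c where c: "\<And>i. proj (c i) = c i" "\<And>i j. pair (b i) (c j) = (if i = j then 1 else 0)"
    "\<And>x. proj x = x \<Longrightarrow> (\<Sum>i\<in>UNIV. pair x (c i) *s b i) = x"
    "\<And>x. proj x = x \<Longrightarrow> (\<Sum>i\<in>UNIV. pair x (b i) *s c i) = x"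
    using dual_basis_exists[OF proj_add proj_scale proj_proj proj_selfadjoint b] by blast
  have b_proj: "proj (b i) = b i" for i
    using b vec.span_base[of "b i" "range b"] by (auto simp: is_basis_of_def)
  have dual: "dual_bases b c" using b_proj c by (simp add: dual_bases_def)
  show ?thesis
  proof (rule springer_pair_of_invariants[OF dual inv])
    show "vec_lambda (\<lambda>(i, j, k). form (b i) (b j) (b k)) \<in> Sym3_dual_invariants G"
    proof -
      have "(\<Sum>e\<in>UNIV. A $ e $ i * form (b e) (b j) (b k) + A $ e $ j * form (b i) (b e) (b k) + A $ e $ k * form (b i) (b j) (b e)) = 0"
        if "A \<in> G" for A i j k
      proof -
        from that obtain T T' where T: "represents_in b T A" "\<And>x y. T (x + y) = T x + T y" "\<And>x. T (- x) = - T x"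
          "\<And>x. proj x = x \<Longrightarrow> form x x (T x) = 0" using act[of A] unfolding acts_by_derivation_def by blast
        have "(\<Sum>e\<in>UNIV. A $ e $ i * form (b e) (b j) (b k) + A $ e $ j * form (b i) (b e) (b k)
            + A $ e $ k * form (b i) (b j) (b e))
          = form (T (b i)) (b j) (b k) + form (b i) (T (b j)) (b k) + form (b i) (b j) (T (b k))"
          using T(1) by (simp add: represents_in_def form_sum form_scale sum.distrib)
        also have "\<dots> = 0" by (rule derivation_polarized) (use T b_proj in auto)
        finally show ?thesis .
      qed
      then show ?thesis
        by (simp add: Sym3_dual_invariants_def symmetric_cubic_def) (simp add: form_sym)
    qed
    show "vec_lambda (\<lambda>(i, j, k). form (c i) (c j) (c k)) \<in> Sym3_invariants G"
    proof -
      have "(\<Sum>e\<in>UNIV. A $ i $ e * form (c e) (c j) (c k) + A $ j $ e * form (c i) (c e) (c k) + A $ k $ e * form (c i) (c j) (c e)) = 0"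
        if "A \<in> G" for A i j k
      proof -
        from that obtain T T' where T: "represents_in b T A" "\<And>x y. pair (T x) y = pair x (T' y)"
          "\<And>x. proj x = x \<Longrightarrow> proj (T' x) = T' x"
          "\<And>x y. T' (x + y) = T' x + T' y" "\<And>x. T' (- x) = - T' x"
          "\<And>x. proj x = x \<Longrightarrow> form x x (T' x) = 0" using act[of A] unfolding acts_by_derivation_def by blast
        \<comment> \<open>The coefficients are read off by pairing with \<open>b j\<close> and
          moving \<open>T'\<close> to the other side.\<close>
        have T'c: "T' (c i) = (\<Sum>j\<in>UNIV. A $ i $ j *s c j)" for i
        proof -
          have "pair (T' (c i)) (b j) = A $ i $ j" for j
          proof -
            have "pair (T' (c i)) (b j) = pair (T (b j)) (c i)" by (metis T(2) pair_commute)
            also have "\<dots> = A $ i $ j"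
              using T(1) by (simp add: represents_in_def pair_sum pair_scale c(2) if_distrib[of "\<lambda>t. _ * t"] cong: if_cong)
            finally show ?thesis .
          qed
          then show ?thesis using c(4)[of "T' (c i)"] T(3) c(1) by simp
        qed
        have "(\<Sum>e\<in>UNIV. A $ i $ e * form (c e) (c j) (c k) + A $ j $ e * form (c i) (c e) (c k)
            + A $ k $ e * form (c i) (c j) (c e))
          = form (T' (c i)) (c j) (c k) + form (c i) (T' (c j)) (c k) + form (c i) (c j) (T' (c k))"
          by (simp add: T'c form_sum form_scale sum.distrib)
        also have "\<dots> = 0" by (rule derivation_polarized) (use T c in auto)
        finally show ?thesis .
      qed
      then show ?thesis
        by (simp add: Sym3_invariants_def symmetric_cubic_def) (simp add: form_sym)
    qed
  qed
qed

end

section \<open>Cubic forms given by signed triples\<close>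

text \<open>A tuple \<open>(p, q, k, s)\<close> stands for the monomial \<open>s X\<^sub>p X\<^sub>q X\<^sub>k\<close> of a cubic form.\<close>

definition triples_cubic :: "(nat \<times> nat \<times> nat \<times> complex) list \<Rightarrow> (nat \<Rightarrow> complex) \<Rightarrow> complex"
  where "triples_cubic T X = (\<Sum>(p, q, k, s)\<leftarrow>T. s * X p * X q * X k)"

definition triples_gradient :: "(nat \<times> nat \<times> nat \<times> complex) list \<Rightarrow> (nat \<Rightarrow> complex) \<Rightarrow> nat \<Rightarrow> complex"
  where "triples_gradient T X r = (\<Sum>(p, q, k, s)\<leftarrow>T. s * ((if k = r then X p * X q else 0)
    + (if p = r then X q * X k else 0) + (if q = r then X p * X k else 0)))"

text \<open>\<open>E\<close> is an orthogonal basis whose members share the value \<open>g\<close>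
  of \<open>pair (E r) (E r)\<close>: 1 for unit vectors, 2 for differences of two unit vectors. The
  adjoint is the gradient in coordinates, so that the adjoint identity becomes finitely many
  polynomial identities.\<close>

locale triple_system =
  fixes T :: "(nat \<times> nat \<times> nat \<times> complex) list" and n :: nat
    and E :: "nat \<Rightarrow> complex^'k" and g :: complex and proj :: "complex^'k \<Rightarrow> complex^'k"
  assumes range: "\<forall>(p, q, k, s)\<in>set T. p < n \<and> q < n \<and> k < n"
    and ortho: "\<lbrakk>r < n; r' < n\<rbrakk> \<Longrightarrow> pair (E r) (E r') = (if r = r' then g else 0)"
    and g_nonzero: "g \<noteq> 0"
    and expansion: "proj x = x \<Longrightarrow> (\<Sum>r<n. pair x (E r) *s E r) = g *s x"
    and projection_add: "proj (x + y) = proj x + proj y"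
    and projection_scale: "proj (a *s x) = a *s proj x"
    and projection_proj: "proj (proj x) = proj x"
    and projection_selfadjoint: "pair (proj x) y = pair x (proj y)"
    and proj_E: "r < n \<Longrightarrow> proj (E r) = E r"
    and adjoint_coordinates: "r < n \<Longrightarrow> triples_gradient T (triples_gradient T X) r = triples_cubic T X * X r"
    and cubic_nonzero: "\<exists>X. triples_cubic T X \<noteq> 0"
begin

definition coord where "coord x r = pair x (E r)"

text \<open>The polarised gradient without normalising factors: it is twice the gradient on the
  diagonal, and \<open>pair (cross x x) x\<close> is six times the cubic.\<close>

definition cross :: "complex^'k \<Rightarrow> complex^'k \<Rightarrow> complex^'k" where
  "cross x y = (\<Sum>(p, q, k, s)\<leftarrow>T. s *s ((coord x p * coord y q + coord x q * coord y p) *s E k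
    + (coord x q * coord y k + coord x k * coord y q) *s E p
    + (coord x p * coord y k + coord x k * coord y p) *s E q))"

lemma coord_add: "coord (x + y) r = coord x r + coord y r"
  and coord_scale: "coord (a *s x) r = a * coord x r"
  by (simp_all add: coord_def pair_add pair_scale)

lemma pair_sum_list: "pair (sum_list (map f L)) y = (\<Sum>i\<leftarrow>L. pair (f i) y)"
  by (induction L) (simp_all add: pair_zero pair_add)

lemma pair_cross:
  "pair (cross x y) z = (\<Sum>(p, q, k, s)\<leftarrow>T. s * ((coord x p * coord y q + coord x q * coord y p) * coord z k
    + (coord x q * coord y k + coord x k * coord y q) * coord z p
    + (coord x p * coord y k + coord x k * coord y p) * coord z q))"
  by (simp add: cross_def pair_sum_list case_prod_unfold pair_add pair_scale coord_def pair_commute[of "E _"] algebra_simps)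

lemma cross_eq_gradient: "cross x x = (\<Sum>r<n. (2 * triples_gradient T (coord x) r) *s E r)"
proof -
  have "(\<Sum>r<n. (2 * triples_gradient L (coord x) r) *s E r)
      = (\<Sum>(p, q, k, s)\<leftarrow>L. s *s ((coord x p * coord x q + coord x q * coord x p) *s E k
    + (coord x q * coord x k + coord x k * coord x q) *s E p
    + (coord x p * coord x k + coord x k * coord x p) *s E q))"
    if "\<forall>(p, q, k, s)\<in>set L. p < n \<and> q < n \<and> k < n" for L
    using that
  proof (induction L)
    case Nil
    then show ?case by (simp add: triples_gradient_def)
  next
    case (Cons t L)
    obtain p q k s where t: "t = (p, q, k, s)" by (cases t) auto
    have pqk: "p < n" "q < n" "k < n" using Cons.prems t by auto
    have if_vec: "(a * (if P then b else 0)) *s v = (if P then (a * b) *s v else 0)"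
      for a b :: complex and v :: "complex^'k" and P
      by (simp add: vec_eq_iff)
    have "triples_gradient (t # L) (coord x) r = s * (if k = r then coord x p * coord x q else 0)
       + s * (if p = r then coord x q * coord x k else 0) + s * (if q = r then coord x p * coord x k else 0)
       + triples_gradient L (coord x) r" for r
      by (simp add: triples_gradient_def t distrib_left)
    then have "(\<Sum>r<n. (2 * triples_gradient (t # L) (coord x) r) *s E r)
       = (\<Sum>r<n. ((2 * s) * (if k = r then coord x p * coord x q else 0)) *s E r)
       + (\<Sum>r<n. ((2 * s) * (if p = r then coord x q * coord x k else 0)) *s E r)
       + (\<Sum>r<n. ((2 * s) * (if q = r then coord x p * coord x k else 0)) *s E r)
       + (\<Sum>r<n. (2 * triples_gradient L (coord x) r) *s E r)"
      by (simp add: distrib_left vec.scale_left_distrib sum.distrib mult.assoc)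
    also have "\<dots> = (2 * s * (coord x p * coord x q)) *s E k + (2 * s * (coord x q * coord x k)) *s E p
       + (2 * s * (coord x p * coord x k)) *s E q + (\<Sum>r<n. (2 * triples_gradient L (coord x) r) *s E r)"
      unfolding if_vec using pqk by simp
    also have "\<dots> = (\<Sum>(p, q, k, s)\<leftarrow>t # L. s *s ((coord x p * coord x q + coord x q * coord x p) *s E k
      + (coord x q * coord x k + coord x k * coord x q) *s E p
      + (coord x p * coord x k + coord x k * coord x p) *s E q))"
      using Cons by (simp add: t vec_eq_iff algebra_simps)
    finally show ?case .
  qed
  from this[OF range] show ?thesis by (simp add: cross_def)
qed

lemma coord_combination: "r < n \<Longrightarrow> coord (\<Sum>r<n. a r *s E r) r = g * a r"
  by (simp add: coord_def pair_sum pair_scale ortho if_distrib[of "\<lambda>t. _ * t"] mult.commute cong: if_cong)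

lemma triples_gradient_cong:
  assumes "\<And>r. r < n \<Longrightarrow> X r = Y r"
  shows "triples_gradient T X r = triples_gradient T Y r"
proof -
  have "map (\<lambda>(p, q, k, s). s * ((if k = r then X p * X q else 0)
    + (if p = r then X q * X k else 0) + (if q = r then X p * X k else 0))) T
    = map (\<lambda>(p, q, k, s). s * ((if k = r then Y p * Y q else 0)
    + (if p = r then Y q * Y k else 0) + (if q = r then Y p * Y k else 0))) T"
    using range assms by (intro map_cong refl) auto
  then show ?thesis unfolding triples_gradient_def by (rule arg_cong)
qed

lemma triples_gradient_scale: "triples_gradient T (\<lambda>r. a * X r) r = a\<^sup>2 * triples_gradient T X r"
proof -
  have "(\<lambda>(p, q, k, s). s * ((if k = r then a * X p * (a * X q) else 0)
    + (if p = r then a * X q * (a * X k) else 0) + (if q = r then a * X p * (a * X k) else 0)))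
    = (\<lambda>t. a\<^sup>2 * (\<lambda>(p, q, k, s). s * ((if k = r then X p * X q else 0)
    + (if p = r then X q * X k else 0) + (if q = r then X p * X k else 0))) t)"
    by (auto simp: fun_eq_iff power2_eq_square algebra_simps)
  then show ?thesis unfolding triples_gradient_def by (simp only: sum_list_const_mult)
qed

lemma pair_cross_diag: "pair (cross x x) x = 6 * triples_cubic T (coord x)"
proof -
  have "(\<lambda>(p, q, k, s). s * ((coord x p * coord x q + coord x q * coord x p) * coord x k
    + (coord x q * coord x k + coord x k * coord x q) * coord x p
    + (coord x p * coord x k + coord x k * coord x p) * coord x q))
    = (\<lambda>t. 6 * (\<lambda>(p, q, k, s). s * coord x p * coord x q * coord x k) t)"
    by (auto simp: fun_eq_iff algebra_simps)
  then show ?thesis unfolding pair_cross triples_cubic_def by (simp only: sum_list_const_mult)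
qed

text \<open>The coordinates of \<open>cross x x\<close> carry a factor \<open>g\<close>, which the
  second gradient squares; expanding x in the basis \<open>E\<close> contributes the third
  factor.\<close>

sublocale cubic_norm proj cross "g ^ 3"
proof
  show "proj (x + y) = proj x + proj y" for x y by (rule projection_add)
  show "proj (a *s x) = a *s proj x" for a x by (rule projection_scale)
  show "proj (proj x) = proj x" for x by (rule projection_proj)
  show "pair (proj x) y = pair x (proj y)" for x y by (rule projection_selfadjoint)
  show "cross (x + y) z = cross x z + cross y z" for x y z
    by (rule pair_eqI) (simp add: pair_add pair_cross coord_add sum_list_addf[symmetric] case_prod_unfold algebra_simps)
  show "cross (a *s x) z = a *s cross x z" for a x z
    by (rule pair_eqI)
      (simp add: pair_scale pair_cross coord_scale sum_list_const_mult[symmetric] case_prod_unfold algebra_simps)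
  show "cross x y = cross y x" for x y
    by (rule pair_eqI) (simp add: pair_cross case_prod_unfold algebra_simps)
  show "pair (cross x y) z = pair (cross x z) y" for x y z
    by (simp add: pair_cross case_prod_unfold algebra_simps)
  show "proj (cross x y) = cross x y" for x y
  proof -
    have proj_zero: "proj 0 = 0" using projection_scale[of 0 0] by simp
    have "proj (\<Sum>(p, q, k, s)\<leftarrow>L. s *s (a p q k *s E k + b p q k *s E p + c p q k *s E q))
        = (\<Sum>(p, q, k, s)\<leftarrow>L. s *s (a p q k *s E k + b p q k *s E p + c p q k *s E q))"
      if "\<forall>(p, q, k, s)\<in>set L. p < n \<and> q < n \<and> k < n" for L a b c
      using that by (induction L) (auto simp: proj_zero projection_add projection_scale proj_E)
    from this[OF range, of "\<lambda>p q k. coord x p * coord y q + coord x q * coord y p"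
        "\<lambda>p q k. coord x q * coord y k + coord x k * coord y q" "\<lambda>p q k. coord x p * coord y k + coord x k * coord y p"]
    show ?thesis unfolding cross_def .
  qed
  show "3 *s cross (cross x x) (cross x x) = (4 * g ^ 3 * pair (cross x x) x) *s x" if "proj x = x" for x
  proof -
    have c: "coord (cross x x) r = 2 * g * triples_gradient T (coord x) r" if "r < n" for r
      unfolding cross_eq_gradient[of x] coord_combination[OF that] by simp
    have "cross (cross x x) (cross x x) = (\<Sum>r<n. (8 * g\<^sup>2 * (triples_cubic T (coord x) * coord x r)) *s E r)"
      unfolding cross_eq_gradient[of "cross x x"]
    proof (intro sum.cong refl)
      fix r assume "r \<in> {..<n}"
      then have "triples_gradient T (coord (cross x x)) r = (2 * g)\<^sup>2 * (triples_cubic T (coord x) * coord x r)"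
        using triples_gradient_cong[of "coord (cross x x)" "\<lambda>r. 2 * g * triples_gradient T (coord x) r" r, OF c]
        by (simp add: triples_gradient_scale[of "2 * g"] adjoint_coordinates)
      then show "(2 * triples_gradient T (coord (cross x x)) r) *s E r
          = (8 * g\<^sup>2 * (triples_cubic T (coord x) * coord x r)) *s E r"
        by (simp add: power2_eq_square)
    qed
    also have "\<dots> = (8 * g\<^sup>2 * triples_cubic T (coord x)) *s (\<Sum>r<n. pair x (E r) *s E r)"
      by (simp add: vec.scale_sum_right mult.assoc coord_def)
    also have "\<dots> = (8 * g ^ 3 * triples_cubic T (coord x)) *s x"
      unfolding expansion[OF that] by (simp add: power2_eq_square power3_eq_cube mult_ac)
    finally show ?thesis
      unfolding pair_cross_diag by simp
  qed
  show "\<exists>x. proj x = x \<and> pair (cross x x) x \<noteq> 0"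
  proof -
    obtain X where X: "triples_cubic T X \<noteq> 0" using cubic_nonzero by blast
    define x where "x = (\<Sum>r<n. (X r / g) *s E r)"
    have "proj x = x"
    proof -
      have proj_zero: "proj 0 = 0" using projection_scale[of 0 0] by simp
      have "proj (\<Sum>r\<in>I. a r *s E r) = (\<Sum>r\<in>I. a r *s E r)" if "I \<subseteq> {..<n}" "finite I" for I a
        using that(2,1) by (induction I) (auto simp: proj_zero projection_add projection_scale proj_E)
      then show ?thesis by (simp add: x_def)
    qed
    moreover have coord_x: "coord x r = X r" if "r < n" for r
      using coord_combination[OF that] g_nonzero by (simp add: x_def)
    have "map (\<lambda>(p, q, k, s). s * coord x p * coord x q * coord x k) T = map (\<lambda>(p, q, k, s). s * X p * X q * X k) T"
      using range coord_x by (intro map_cong refl) auto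
    then have "triples_cubic T (coord x) = triples_cubic T X" unfolding triples_cubic_def by (rule arg_cong)
    ultimately show ?thesis using X by (auto simp: pair_cross_diag)
  qed
qed

lemma form_gradient: "form x x z = (\<Sum>r<n. 2 * triples_gradient T (coord x) r * coord z r)"
  unfolding form_def cross_eq_gradient by (simp add: pair_sum pair_scale coord_def pair_commute[of z])

end

section \<open>The determinant and the Pfaffian\<close>

lemma UNIV_6: "UNIV = {0, 1, 2, 3, 4, 5 :: 6}"
proof -
  have "x \<in> {0, 1, 2, 3, 4, 5}" for x :: 6
  proof (cases x rule: bit0_cases)
    case (of_int z)
    then have "z \<in> {0, 1, 2, 3, 4, 5}" by auto
    then show ?thesis using of_int by auto
  qed
  then show ?thesis by auto
qed

lemma UNIV_3': "UNIV = {0, 1, 2 :: 3}"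
  unfolding UNIV_3 by auto

lemma sum_3_6: "(\<Sum>i\<in>UNIV. f3 i) = f3 0 + f3 1 + f3 2" "(\<Sum>i\<in>UNIV. f6 i) = f6 0 + f6 1 + f6 2 + f6 3 + f6 4 + f6 5"
  for f3 :: "3 \<Rightarrow> 'a::comm_monoid_add" and f6 :: "6 \<Rightarrow> 'b::comm_monoid_add"
  unfolding UNIV_3' UNIV_6 by (simp_all add: add.assoc)

lemma all_6: "(\<forall>i::6. P i) \<longleftrightarrow> P 0 \<and> P 1 \<and> P 2 \<and> P 3 \<and> P 4 \<and> P 5"
  by (metis UNIV_6 UNIV_I empty_iff insert_iff)

lemma less_9: "(r < (9::nat)) \<longleftrightarrow> r \<in> {0, 1, 2, 3, 4, 5, 6, 7, 8}"
  by (auto simp: less_Suc_eq eval_nat_numeral)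

lemma sum_less_9: "(\<Sum>r<(9::nat). f r) = f 0 + f 1 + f 2 + f 3 + f 4 + f 5 + f 6 + f 7 + f 8"
  by (simp add: eval_nat_numeral add_ac)

lemma less_15: "(r < (15::nat)) \<longleftrightarrow> r \<in> {0, 1, 2, 3, 4, 5, 6, 7, 8, 9, 10, 11, 12, 13, 14}"
  by (auto simp: less_Suc_eq eval_nat_numeral)

lemma sum_less_15: "(\<Sum>r<(15::nat). f r) = f 0 + f 1 + f 2 + f 3 + f 4 + f 5 + f 6 + f 7 + f 8 + f 9 + f 10 + f 11 + f 12 + f 13 + f 14"
  by (simp add: eval_nat_numeral add_ac)

section \<open>Tensor actions and their transposes\<close>

definition swap_index :: "complex^('k::finite \<times> 'k) \<Rightarrow> complex^('k \<times> 'k)"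
  where "swap_index x = vec_lambda (\<lambda>(i, j). x $ (j, i))"

lemma swap_index_nth: "swap_index x $ (i, j) = x $ (j, i)"
  by (simp add: swap_index_def)

lemma pair_swap_index: "pair (swap_index x) y = pair x (swap_index y)"
  unfolding pair_def sum_UNIV_pair swap_index_nth by (rule sum.swap)

lemma tensor_action_nth: "tensor_action X Y t $ (i, j) = (\<Sum>k\<in>UNIV. X $ i $ k * t $ (k, j)) + (\<Sum>l\<in>UNIV. Y $ j $ l * t $ (i, l))"
  by (simp add: tensor_action_def)

lemma pair_tensor_action: "pair (tensor_action X Y x) y = pair x (tensor_action (transpose X) (transpose Y) y)"
proof -
  have 1: "(\<Sum>i\<in>UNIV. \<Sum>j\<in>UNIV. (\<Sum>k\<in>UNIV. X $ i $ k * x $ (k, j)) * y $ (i, j))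
      = (\<Sum>i\<in>UNIV. \<Sum>j\<in>UNIV. x $ (i, j) * (\<Sum>k\<in>UNIV. X $ k $ i * y $ (k, j)))"
    unfolding sum_distrib_left sum_distrib_right sum_nested3
    by (rule sum.reindex_bij_witness[where i = "\<lambda>(i, j, k). (k, j, i)" and j = "\<lambda>(i, j, k). (k, j, i)"]) auto
  have 2: "(\<Sum>i\<in>UNIV. \<Sum>j\<in>UNIV. (\<Sum>l\<in>UNIV. Y $ j $ l * x $ (i, l)) * y $ (i, j))
      = (\<Sum>i\<in>UNIV. \<Sum>j\<in>UNIV. x $ (i, j) * (\<Sum>l\<in>UNIV. Y $ l $ j * y $ (i, l)))"
    unfolding sum_distrib_left sum_distrib_right sum_nested3
    by (rule sum.reindex_bij_witness[where i = "\<lambda>(i, j, k). (i, k, j)" and j = "\<lambda>(i, j, k). (i, k, j)"]) auto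
  show ?thesis
    by (simp add: pair_def sum_UNIV_pair tensor_action_nth distrib_left distrib_right sum.distrib 1 2 transpose_def)
qed

lemma tensor_action_add: "tensor_action X Y (x + y) = tensor_action X Y x + tensor_action X Y y"
  by (simp add: tensor_action_def vec_eq_iff distrib_left sum.distrib)

lemma tensor_action_minus: "tensor_action X Y (- x) = - tensor_action X Y x"
  by (simp add: tensor_action_def vec_eq_iff sum_negf)

lemma tensor_action_scale: "tensor_action X Y (a *s x) = a *s tensor_action X Y x"
  by (simp add: vec_eq_iff tensor_action_nth distrib_left sum_distrib_left algebra_simps)

lemma tensor_action_swap_index: "tensor_action X X (swap_index x) = swap_index (tensor_action X X x)"
  by (simp add: tensor_action_def vec_eq_iff swap_index_nth add.commute)

lemma transpose_special_linear: "X \<in> special_linear \<Longrightarrow> transpose X \<in> special_linear"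
  by (simp add: special_linear_def trace_def transpose_def)

text \<open>The nine matrix entries are numbered row by row, and the six monomials belong to the
  permutations.\<close>

definition det_triples :: "(nat \<times> nat \<times> nat \<times> complex) list"
  where "det_triples = [(0,4,8,1), (0,5,7,-1), (1,3,8,-1), (1,5,6,1), (2,3,7,1), (2,4,6,-1)]"

lemma det_gradient:
  "triples_gradient det_triples X 0 = X 4 * X 8 - X 5 * X 7"
  "triples_gradient det_triples X 1 = X 5 * X 6 - X 3 * X 8"
  "triples_gradient det_triples X 2 = X 3 * X 7 - X 4 * X 6"
  "triples_gradient det_triples X 3 = X 2 * X 7 - X 1 * X 8"
  "triples_gradient det_triples X 4 = X 0 * X 8 - X 2 * X 6"
  "triples_gradient det_triples X 5 = X 1 * X 6 - X 0 * X 7"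
  "triples_gradient det_triples X 6 = X 1 * X 5 - X 2 * X 4"
  "triples_gradient det_triples X 7 = X 2 * X 3 - X 0 * X 5"
  "triples_gradient det_triples X 8 = X 0 * X 4 - X 1 * X 3"
  by (simp_all add: triples_gradient_def det_triples_def algebra_simps)

lemma det_cubic:
  "triples_cubic det_triples X = X 0 * X 4 * X 8 + X 1 * X 5 * X 6 + X 2 * X 3 * X 7 - X 0 * X 5 * X 7 - X 1 * X 3 * X 8 - X 2 * X 4 * X 6"
  by (simp add: triples_cubic_def det_triples_def)

definition det_indices :: "(3 \<times> 3) list"
  where "det_indices = [(0, 0), (0, 1), (0, 2), (1, 0), (1, 1), (1, 2), (2, 0), (2, 1), (2, 2)]"

lemma bij_det_indices: "bij_betw ((!) det_indices) {..<9} UNIV"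
proof -
  have "distinct det_indices" by (simp add: det_indices_def)
  moreover have len: "length det_indices = 9" by (simp add: det_indices_def)
  ultimately have inj: "inj_on ((!) det_indices) {..<9}"
    by (auto simp: inj_on_def nth_eq_iff_index_eq)
  then have "card ((!) det_indices ` {..<9}) = CARD(3 \<times> 3)" by (simp add: card_image)
  then have "(!) det_indices ` {..<9} = UNIV" by (intro card_subset_eq) auto
  with inj show ?thesis by (simp add: bij_betw_def)
qed

global_interpretation det: triple_system det_triples 9 "\<lambda>r. axis (det_indices ! r) 1" 1 "\<lambda>x. x"
proof
  show "\<forall>(p, q, k, s)\<in>set det_triples. p < 9 \<and> q < 9 \<and> k < 9"
    by (simp add: det_triples_def)
  show "pair (axis (det_indices ! r) 1) (axis (det_indices ! r') 1) = (if r = r' then 1 else 0)" if "r < 9" "r' < 9" for r r'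
    using that bij_det_indices unfolding pair_axis by (auto simp: axis_def bij_betw_def inj_on_def)
  show "(\<Sum>r<9. pair x (axis (det_indices ! r) 1) *s axis (det_indices ! r) 1) = 1 *s x" for x
    using sum.reindex_bij_betw[OF bij_det_indices, of "\<lambda>p. x $ p *s axis p 1"]
    by (simp add: pair_axis basis_expansion)
  show "triples_gradient det_triples (triples_gradient det_triples X) r = triples_cubic det_triples X * X r" if "r < 9" for r X
  proof -
    have "\<forall>r\<in>{0, 1, 2, 3, 4, 5, 6, 7, 8}.
        triples_gradient det_triples (triples_gradient det_triples X) r = triples_cubic det_triples X * X r"
      unfolding ball_simps(5,7) det_gradient det_cubic by (intro conjI TrueI; algebra)
    then show ?thesis using that unfolding less_9 by blast
  qed
  show "\<exists>X. triples_cubic det_triples X \<noteq> 0"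
    by (rule exI[of _ "\<lambda>r. if r \<in> {0, 4, 8} then 1 else 0"]) (simp add: det_cubic)
qed simp_all

lemma det_coord:
  "det.coord x 0 = x $ (0, 0)" "det.coord x 1 = x $ (0, 1)" "det.coord x 2 = x $ (0,
      2)" "det.coord x 3 = x $ (1, 0)" "det.coord x 4 = x $ (1, 1)" "det.coord x 5 = x $ (1,
      2)" "det.coord x 6 = x $ (2, 0)" "det.coord x 7 = x $ (2, 1)" "det.coord x 8 = x $ (2, 2)"
  unfolding det.coord_def pair_axis by (simp_all add: det_indices_def)

text \<open>The tensor x is a matrix on which the action is X x + x Y^T, and the derivative of det
  in this direction is (tr X + tr Y) det x. Eliminating the last diagonal entries of X and Y leaves
  a polynomial identity.\<close>

lemma det_form_tensor_action:
  assumes "X \<in> special_linear" "Y \<in> special_linear"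
  shows "det.form x x (tensor_action X Y x) = 0"
proof -
  have X: "X $ 2 $ 2 = - X $ 0 $ 0 - X $ 1 $ 1" and Y: "Y $ 2 $ 2 = - Y $ 0 $ 0 - Y $ 1 $ 1"
    using assms by (simp_all add: special_linear_def trace_def sum_3_6 eq_neg_iff_add_eq_0 algebra_simps)
  show ?thesis
    unfolding det.form_gradient sum_less_9 det_gradient det_coord
    by (simp add: tensor_action_nth sum_3_6 X Y algebra_simps)
qed

text \<open>The 15 monomials are the perfect matchings of six points with their signs. The variables
  are the entries above the diagonal, in the order of \<open>pf_indices\<close>.\<close>

definition pf_triples :: "(nat \<times> nat \<times> nat \<times> complex) list"
  where "pf_triples = [(0,9,14,1), (0,10,13,-1), (0,11,12,1), (1,6,14,-1), (1,7,13,1), (1,8,12,-1),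
      (2,5,14,1), (2,7,11,-1), (2,8,10,1), (3,5,13,-1), (3,6,11,1), (3,8,9,-1), (4,5,12,1), (4,6,10,-1),
      (4,7,9,1)]"

lemma pf_gradient:
  "triples_gradient pf_triples X 0 = X 9 * X 14 + X 11 * X 12 - X 10 * X 13"
  "triples_gradient pf_triples X 1 = X 7 * X 13 - X 6 * X 14 - X 8 * X 12"
  "triples_gradient pf_triples X 2 = X 5 * X 14 + X 8 * X 10 - X 7 * X 11"
  "triples_gradient pf_triples X 3 = X 6 * X 11 - X 5 * X 13 - X 8 * X 9"
  "triples_gradient pf_triples X 4 = X 5 * X 12 + X 7 * X 9 - X 6 * X 10"
  "triples_gradient pf_triples X 5 = X 2 * X 14 + X 4 * X 12 - X 3 * X 13"
  "triples_gradient pf_triples X 6 = X 3 * X 11 - X 1 * X 14 - X 4 * X 10"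
  "triples_gradient pf_triples X 7 = X 1 * X 13 + X 4 * X 9 - X 2 * X 11"
  "triples_gradient pf_triples X 8 = X 2 * X 10 - X 1 * X 12 - X 3 * X 9"
  "triples_gradient pf_triples X 9 = X 0 * X 14 + X 4 * X 7 - X 3 * X 8"
  "triples_gradient pf_triples X 10 = X 2 * X 8 - X 0 * X 13 - X 4 * X 6"
  "triples_gradient pf_triples X 11 = X 0 * X 12 + X 3 * X 6 - X 2 * X 7"
  "triples_gradient pf_triples X 12 = X 0 * X 11 + X 4 * X 5 - X 1 * X 8"
  "triples_gradient pf_triples X 13 = X 1 * X 7 - X 0 * X 10 - X 3 * X 5"
  "triples_gradient pf_triples X 14 = X 0 * X 9 + X 2 * X 5 - X 1 * X 6"
  by (simp_all add: triples_gradient_def pf_triples_def algebra_simps)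

lemma pf_cubic:
  "triples_cubic pf_triples X = X 0 * X 9 * X 14 + X 0 * X 11 * X 12 + X 1 * X 7 * X 13 + X 2 * X 5 * X 14 + X 2 * X 8 * X 10 + X 3 * X 6 * X 11 + X 4 * X 5 * X 12 + X 4 * X 7 * X 9 - X 0 * X 10 * X 13 - X 1 * X 6 * X 14 - X 1 * X 8 * X 12 - X 2 * X 7 * X 11 - X 3 * X 5 * X 13 - X 3 * X 8 * X 9 - X 4 * X 6 * X 10"
  by (simp add: triples_cubic_def pf_triples_def)

definition pf_indices :: "(6 \<times> 6) list"
  where "pf_indices = [(0,1), (0,2), (0,3), (0,4), (0,5), (1,2), (1,3), (1,4), (1,5), (2,3), (2,4), (2,5), (3,4), (3,5), (4,5)]"

definition pf_index :: "nat \<Rightarrow> 6 \<times> 6"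
  where "pf_index r = pf_indices ! r"

text \<open>Two entries of modulus 1 make the value of \<open>pair\<close> equal to 2, which is the
  constant passed to \<open>triple_system\<close>.\<close>

definition pf_vector :: "nat \<Rightarrow> complex^(6 \<times> 6)"
  where "pf_vector r = axis (pf_index r) 1 - swap_index (axis (pf_index r) 1)"

definition skew_part :: "complex^('k::finite \<times> 'k) \<Rightarrow> complex^('k \<times> 'k)"
  where "skew_part x = (1/2) *s (x - swap_index x)"

lemma pair_pf_vector: "pair x (pf_vector r) = x $ pf_index r - swap_index x $ pf_index r"
proof -
  have "pair x (- swap_index y) = - pair (swap_index x) y" for y by (simp add: pair_minus pair_swap_index)
  then show ?thesis
    unfolding pf_vector_def diff_conv_add_uminus pair_add by (simp add: pair_axis)
qed

lemma pf_vector_nth: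
  "pf_vector r $ p = (if p = pf_index r then 1 else 0) - (if p = prod.swap (pf_index r) then 1 else 0)"
  by (cases p; cases "pf_index r") (auto simp: pf_vector_def swap_index_nth axis_def)

lemma skew_part_fixed: "skew_part x = x \<longleftrightarrow> x \<in> exterior_square"
proof -
  have eq: "(a - b) / 2 = a \<longleftrightarrow> b = - a" for a b :: complex
  proof
    assume "(a - b) / 2 = a"
    then have "a - b = 2 * a" by (simp add: field_simps)
    then show "b = - a" by algebra
  qed simp
  have "skew_part x = x \<longleftrightarrow> (\<forall>i j. (x $ (i, j) - x $ (j, i)) / 2 = x $ (i, j))"
    by (simp add: skew_part_def vec_eq_iff swap_index_nth diff_divide_distrib)
  also have "\<dots> \<longleftrightarrow> x \<in> exterior_square"
    unfolding eq exterior_square_def by simp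
  finally show ?thesis .
qed

global_interpretation pf: triple_system pf_triples 15 pf_vector 2 skew_part
proof
  show "\<forall>(p, q, k, s)\<in>set pf_triples. p < 15 \<and> q < 15 \<and> k < 15"
    by (simp add: pf_triples_def)
  show "pair (pf_vector r) (pf_vector r') = (if r = r' then 2 else 0)" if "r < 15" "r' < 15" for r r'
  proof -
    \<comment> \<open>Distinctness of all 30 off-diagonal positions settles at once when two indices
      agree and that no index is the mirror image of another.\<close>
    let ?M = "pf_indices @ map prod.swap pf_indices"
    have "distinct ?M" by (simp add: pf_indices_def)
    moreover have "length pf_indices = 15" by (simp add: pf_indices_def)
    ultimately have M: "?M ! a = ?M ! c \<longleftrightarrow> a = c" if "a < 30" "c < 30" for a c
      using that by (intro nth_eq_iff_index_eq) auto
    have "?M ! a = pf_index a" "?M ! (15 + a) = prod.swap (pf_index a)" if "a < 15" for a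
      using that \<open>length pf_indices = 15\<close> by (simp_all add: nth_append pf_index_def)
    then have "pf_index r = pf_index r' \<longleftrightarrow> r = r'" "pf_index r \<noteq> prod.swap (pf_index r')"
      "pf_index r' \<noteq> prod.swap (pf_index r)"
      using M[of r r'] M[of r "15 + r'"] M[of r' "15 + r"] that by auto
    then have *: "pf_vector r $ pf_index r' = (if r = r' then 1 else 0)"
      unfolding pf_vector_nth by auto
    have "swap_index (pf_vector r) $ pf_index r' = - (pf_vector r $ pf_index r')"
      by (simp add: pf_vector_def swap_index_def split: prod.split)
    then show ?thesis
      unfolding pair_pf_vector by (simp only: *) simp
  qed
  show "(\<Sum>r<15. pair x (pf_vector r) *s pf_vector r) = 2 *s x" if "skew_part x = x" for x
  proof -
    have skew: "x $ (j, i) = - x $ (i, j)" for i j using that unfolding skew_part_fixed exterior_square_def by blast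
    have diag: "x $ (i, i) = 0" for i
  proof -
    have "2 * x $ (i, i) = 0" using skew[of i i] by algebra
    then show ?thesis by simp
  qed
    have *: "(a - b) *s v = a *s v - b *s v" "a *s (v - w) = a *s v - a *s w" "- a *s v = - (a *s v)"
      "2 *s (v - w) = 2 *s v - 2 *s w" "2 *s (v + w) = 2 *s v + 2 *s w" "2 *s (a *s v) = (2 * a) *s v"
      for a b and v w :: "complex^(6 \<times> 6)"
      by (simp_all add: vec_eq_iff algebra_simps)
    have "2 *s x = 2 *s (\<Sum>i\<in>UNIV. \<Sum>j\<in>UNIV. x $ (i, j) *s axis (i, j) 1)"
      using basis_expansion[of x] by (simp only: sum_UNIV_pair)
    also have "\<dots> = (\<Sum>r<15. (2 * x $ pf_index r) *s (axis (pf_index r) 1 - axis (prod.swap (pf_index r)) 1))"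
      unfolding sum_3_6 sum_less_15
      by (simp add: pf_index_def pf_indices_def diag * skew[of 1 0] skew[of 2 0] skew[of 3 0] skew[of 4 0]
      skew[of 5 0] skew[of 2 1] skew[of 3 1] skew[of 4 1] skew[of 5 1] skew[of 3 2] skew[of 4 2] skew[of 5 2]
      skew[of 4 3] skew[of 5 3] skew[of 5 4])
    also have "\<dots> = (\<Sum>r<15. pair x (pf_vector r) *s pf_vector r)"
    proof (intro sum.cong refl)
      fix r
      obtain i j where ij: "pf_index r = (i, j)" by (cases "pf_index r")
      have "swap_index (axis (i, j) 1) = axis (j, i) (1::complex)"
        by (auto simp: vec_eq_iff swap_index_nth axis_def)
      then show "(2 * x $ pf_index r) *s (axis (pf_index r) 1 - axis (prod.swap (pf_index r)) 1)
          = pair x (pf_vector r) *s pf_vector r"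
        unfolding pair_pf_vector using skew[of j i] by (simp add: swap_index_nth pf_vector_def ij)
    qed
    finally show ?thesis ..
  qed
  show "triples_gradient pf_triples (triples_gradient pf_triples X) r = triples_cubic pf_triples X * X r" if "r < 15" for r X
  proof -
    have "\<forall>r\<in>{0, 1, 2, 3, 4, 5, 6, 7, 8, 9, 10, 11, 12, 13, 14}.
        triples_gradient pf_triples (triples_gradient pf_triples X) r = triples_cubic pf_triples X * X r"
      unfolding ball_simps(5,7) pf_gradient pf_cubic by (intro conjI TrueI; algebra)
    then show ?thesis using that unfolding less_15 by blast
  qed
  show "\<exists>X. triples_cubic pf_triples X \<noteq> 0"
    by (rule exI[of _ "\<lambda>r. if r \<in> {0, 9, 14} then 1 else 0"]) (simp add: pf_cubic)
  show "skew_part (x + y) = skew_part x + skew_part y" for x y :: "complex^(6 \<times> 6)"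
    by (simp add: skew_part_def vec_eq_iff swap_index_nth algebra_simps)
  show "skew_part (a *s x) = a *s skew_part x" for a and x :: "complex^(6 \<times> 6)"
    by (simp add: skew_part_def vec_eq_iff swap_index_nth algebra_simps)
  show "skew_part (skew_part x) = skew_part x" for x :: "complex^(6 \<times> 6)"
    by (simp add: skew_part_def vec_eq_iff swap_index_nth algebra_simps)
  show "pair (skew_part x) y = pair x (skew_part y)" for x y :: "complex^(6 \<times> 6)"
    unfolding skew_part_def diff_conv_add_uminus pair_scale pair_add pair_minus by (simp add: pair_swap_index)
  show "skew_part (pf_vector r) = pf_vector r" for r
    unfolding skew_part_fixed exterior_square_def by (simp add: pf_vector_def swap_index_nth)
qed simp_all

definition pf_matrix :: "(nat \<Rightarrow> complex) \<Rightarrow> complex^(6 \<times> 6)"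
  where "pf_matrix Z = (\<Sum>r<15. Z r *s pf_vector r)"

lemma pf_matrix_nth:
  "pf_matrix Z $ (0, 0) = 0"
  "pf_matrix Z $ (0, 1) = Z 0"
  "pf_matrix Z $ (0, 2) = Z 1"
  "pf_matrix Z $ (0, 3) = Z 2"
  "pf_matrix Z $ (0, 4) = Z 3"
  "pf_matrix Z $ (0, 5) = Z 4"
  "pf_matrix Z $ (1, 0) = - Z 0"
  "pf_matrix Z $ (1, 1) = 0"
  "pf_matrix Z $ (1, 2) = Z 5"
  "pf_matrix Z $ (1, 3) = Z 6"
  "pf_matrix Z $ (1, 4) = Z 7"
  "pf_matrix Z $ (1, 5) = Z 8"
  "pf_matrix Z $ (2, 0) = - Z 1"
  "pf_matrix Z $ (2, 1) = - Z 5"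
  "pf_matrix Z $ (2, 2) = 0"
  "pf_matrix Z $ (2, 3) = Z 9"
  "pf_matrix Z $ (2, 4) = Z 10"
  "pf_matrix Z $ (2, 5) = Z 11"
  "pf_matrix Z $ (3, 0) = - Z 2"
  "pf_matrix Z $ (3, 1) = - Z 6"
  "pf_matrix Z $ (3, 2) = - Z 9"
  "pf_matrix Z $ (3, 3) = 0"
  "pf_matrix Z $ (3, 4) = Z 12"
  "pf_matrix Z $ (3, 5) = Z 13"
  "pf_matrix Z $ (4, 0) = - Z 3"
  "pf_matrix Z $ (4, 1) = - Z 7"
  "pf_matrix Z $ (4, 2) = - Z 10"
  "pf_matrix Z $ (4, 3) = - Z 12"
  "pf_matrix Z $ (4, 4) = 0"
  "pf_matrix Z $ (4, 5) = Z 14"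
  "pf_matrix Z $ (5, 0) = - Z 4"
  "pf_matrix Z $ (5, 1) = - Z 8"
  "pf_matrix Z $ (5, 2) = - Z 11"
  "pf_matrix Z $ (5, 3) = - Z 13"
  "pf_matrix Z $ (5, 4) = - Z 14"
  "pf_matrix Z $ (5, 5) = 0"
  by (simp_all add: pf_matrix_def sum_less_15 pf_vector_nth pf_index_def pf_indices_def)

text \<open>The Pfaffian counterpart of adj(A) A = det(A) 1. It turns the derivative of the Pfaffian
  into a trace, without expanding the action of a general 6 x 6 matrix.\<close>

lemma pf_matrix_adjoint:
  "(\<Sum>j\<in>UNIV. pf_matrix (triples_gradient pf_triples Z) $ (i, j) * pf_matrix Z $ (k, j))
    = (if i = k then triples_cubic pf_triples Z else 0)"
proof -
  have "\<forall>i k. (\<Sum>j\<in>UNIV. pf_matrix (triples_gradient pf_triples Z) $ (i, j) * pf_matrix Z $ (k, j))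
    = (if i = k then triples_cubic pf_triples Z else 0)"
    unfolding all_6 sum_3_6 pf_matrix_nth pf_gradient pf_cubic
    by (intro conjI; simp; algebra)
  then show ?thesis by blast
qed

text \<open>The derivative of Pf along X x + x X^T is tr X Pf x. By skewness the two summands
  contribute equally, and \<open>pf_matrix_adjoint\<close> evaluates each of them.\<close>

lemma pf_form_tensor_action:
  assumes X: "X \<in> special_linear" and x: "skew_part x = x"
  shows "pf.form x x (tensor_action X X x) = 0"
proof -
  let ?Z = "pf.coord x" let ?w = "pf_matrix (triples_gradient pf_triples ?Z)"
  have w: "pf.cross x x = 2 *s ?w"
    unfolding pf.cross_eq_gradient pf_matrix_def by (simp add: vec_eq_iff sum_distrib_left mult.assoc)
  have x2: "2 *s x = pf_matrix ?Z"
    using pf.expansion[OF x] by (simp add: pf_matrix_def pf.coord_def)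
  have skew_matrix: "pf_matrix Y $ (j, i) = - (pf_matrix Y $ (i, j))" for Y i j
    by (simp add: pf_matrix_def pf_vector_def swap_index_nth sum_negf[symmetric] algebra_simps)
  have A: "?w $ (i, j) * (X $ i $ k * pf_matrix ?Z $ (k, j)) = X $ i $ k * (?w $ (i, j) * pf_matrix ?Z $ (k, j))" for i j k
    by simp
  have B: "?w $ (i, j) * (X $ j $ k * pf_matrix ?Z $ (i, k)) = X $ j $ k * (?w $ (j, i) * pf_matrix ?Z $ (k, i))" for i j k
    by (simp add: skew_matrix[of _ i j] skew_matrix[of _ i k])
  have "pair ?w (tensor_action X X (2 *s x))
     = (\<Sum>i\<in>UNIV. \<Sum>j\<in>UNIV. \<Sum>k\<in>UNIV. X $ i $ k * (?w $ (i, j) * pf_matrix ?Z $ (k, j)))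
     + (\<Sum>i\<in>UNIV. \<Sum>j\<in>UNIV. \<Sum>k\<in>UNIV. X $ j $ k * (?w $ (j, i) * pf_matrix ?Z $ (k, i)))"
    unfolding x2 pair_def sum_UNIV_pair tensor_action_nth distrib_left sum.distrib sum_distrib_left
    unfolding A B ..
  also have "(\<Sum>i\<in>UNIV. \<Sum>j\<in>UNIV. \<Sum>k\<in>UNIV. X $ j $ k * (?w $ (j, i) * pf_matrix ?Z $ (k, i)))
     = (\<Sum>i\<in>UNIV. \<Sum>j\<in>UNIV. \<Sum>k\<in>UNIV. X $ i $ k * (?w $ (i, j) * pf_matrix ?Z $ (k, j)))"
    by (rule sum.swap)
  also have "(\<Sum>i\<in>UNIV. \<Sum>j\<in>UNIV. \<Sum>k\<in>UNIV. X $ i $ k * (?w $ (i, j) * pf_matrix ?Z $ (k, j)))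
     = (\<Sum>i\<in>UNIV. \<Sum>k\<in>UNIV. X $ i $ k * (\<Sum>j\<in>UNIV. ?w $ (i, j) * pf_matrix ?Z $ (k, j)))"
    unfolding sum_distrib_left by (intro sum.cong refl sum.swap)
  also have "\<dots> = trace X * triples_cubic pf_triples ?Z"
    by (simp add: pf_matrix_adjoint trace_def sum_distrib_right if_distrib[of "\<lambda>t. _ * t"] cong: if_cong)
  also have "\<dots> = 0" using X by (simp add: special_linear_def)
  finally have "pair ?w (tensor_action X X (2 *s x)) = 0" by simp
  moreover have "tensor_action X X (2 *s x) = 2 *s tensor_action X X x"
    by (simp add: vec_eq_iff tensor_action_nth sum_distrib_left algebra_simps)
  ultimately show ?thesis
    by (simp add: pf.form_def w pair_scale)
qed

section \<open>The determinant on symmetric matrices and the classical cases\<close>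

definition symmetric_part :: "complex^('k::finite \<times> 'k) \<Rightarrow> complex^('k \<times> 'k)"
  where "symmetric_part x = (1/2) *s (x + swap_index x)"

lemma symmetric_part_fixed: "symmetric_part x = x \<longleftrightarrow> x \<in> symmetric_square"
proof -
  have eq: "(a + b) / 2 = a \<longleftrightarrow> b = a" for a b :: complex
  proof
    assume "(a + b) / 2 = a"
    then have "a + b = 2 * a" by (simp add: field_simps)
    then show "b = a" by algebra
  qed simp
  have "symmetric_part x = x \<longleftrightarrow> (\<forall>i j. (x $ (i, j) + x $ (j, i)) / 2 = x $ (i, j))"
    by (simp add: symmetric_part_def vec_eq_iff swap_index_nth add_divide_distrib)
  also have "\<dots> \<longleftrightarrow> x \<in> symmetric_square"
    unfolding eq symmetric_square_def by simp
  finally show ?thesis .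
qed

text \<open>The polarised adjugate of two symmetric matrices is symmetric, so the subspace inherits
  the adjoint identity of the full matrix space with the same constant.\<close>

global_interpretation symdet: cubic_norm symmetric_part det.cross 1
proof
  show "symmetric_part (x + y) = symmetric_part x + symmetric_part y" for x y :: "complex^(3 \<times> 3)"
    by (simp add: symmetric_part_def vec_eq_iff swap_index_nth algebra_simps)
  show "symmetric_part (a *s x) = a *s (symmetric_part x)" for a and x :: "complex^(3 \<times> 3)"
    by (simp add: symmetric_part_def vec_eq_iff swap_index_nth algebra_simps)
  show "symmetric_part (symmetric_part x) = symmetric_part x" for x :: "complex^(3 \<times> 3)"
    unfolding symmetric_part_fixed symmetric_square_def by (simp add: symmetric_part_def swap_index_nth add.commute)
  show "pair (symmetric_part x) y = pair x (symmetric_part y)" for x y :: "complex^(3 \<times> 3)"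
    by (simp only: symmetric_part_def pair_scale pair_add pair_swap_index)
  show "det.cross (x + y) z = det.cross x z + det.cross y z" for x y z by (rule det.cross_add)
  show "det.cross (a *s x) y = a *s det.cross x y" for a x y by (rule det.cross_scale)
  show "det.cross x y = det.cross y x" for x y by (rule det.cross_commute)
  show "pair (det.cross x y) z = pair (det.cross x z) y" for x y z by (rule det.cross_pair)
  show "3 *s det.cross (det.cross x x) (det.cross x x) = (4 * 1 * pair (det.cross x x) x) *s x" for x
    using det.adjoint[of x] by simp
  show "symmetric_part (det.cross x y) = det.cross x y"
    if x: "symmetric_part x = x" and y: "symmetric_part y = y" for x y
  proof -
    have sym: "z $ (1, 0) = z $ (0, 1)" "z $ (2, 0) = z $ (0, 2)" "z $ (2, 1) = z $ (1, 2)" if "z \<in> symmetric_square" for z :: "complex^(3 \<times> 3)"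
      using that unfolding symmetric_square_def by blast+
    have "pair (swap_index (det.cross x y)) z = pair (det.cross x y) z" for z
      unfolding pair_swap_index det.pair_cross
      using sym[of x] sym[of y] x y unfolding symmetric_part_fixed
      by (simp add: det_triples_def det_coord det_coord(2)[unfolded One_nat_def] swap_index_nth algebra_simps)
    then have "swap_index (det.cross x y) = det.cross x y" by (rule pair_eqI)
    then show ?thesis by (simp add: symmetric_part_def vec_eq_iff)
  qed
  show "\<exists>x. symmetric_part x = x \<and> pair (det.cross x x) x \<noteq> 0"
    by (rule exI[of _ "vec_lambda (\<lambda>(i, j). if i = j then 1 else 0)"])
      (auto simp: symmetric_part_def vec_eq_iff swap_index_nth det.pair_cross_diag det_cubic det_coord)
qed

lemma swap_index_skew_action:
  "skew_part (tensor_action X X x) = tensor_action X X (skew_part x)"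
  "symmetric_part (tensor_action X X x) = tensor_action X X (symmetric_part x)"
  unfolding skew_part_def symmetric_part_def diff_conv_add_uminus tensor_action_scale tensor_action_add
    tensor_action_minus tensor_action_swap_index
  by (rule refl)+

lemma springer_pair_classical:
  fixes G :: "(complex^'n^'n) set"
  assumes m: "m \<in> {1, 2, 4}" and G: "e6_series m G" and inv: "cubic_invariants G d D"
  shows "springer_tensors d D"
proof -
  from m G consider
      b where "is_basis_of (b :: 'n \<Rightarrow> complex^(3 \<times> 3)) symmetric_square"
        "G = {A. \<exists>X\<in>special_linear. represents_in b (tensor_action X X) A}"
    | b where "is_basis_of (b :: 'n \<Rightarrow> complex^(3 \<times> 3)) UNIV"
        "G = {A. \<exists>X\<in>special_linear. \<exists>Y\<in>special_linear. represents_in b (tensor_action X Y) A}"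
    | b where "is_basis_of (b :: 'n \<Rightarrow> complex^(6 \<times> 6)) exterior_square"
        "G = {A. \<exists>X\<in>special_linear. represents_in b (tensor_action X X) A}"
    unfolding e6_series_def by auto
  then show ?thesis
  proof cases
    case 1
    show ?thesis
    proof (rule symdet.springer_pair_of_derivations[OF _ inv])
      show "is_basis_of b {x. symmetric_part x = x}" using 1 by (simp add: symmetric_part_fixed)
      fix A assume "A \<in> G"
      then obtain X where X: "X \<in> special_linear" "represents_in b (tensor_action X X) A" using 1 by auto
      show "symdet.acts_by_derivation b A"
        unfolding symdet.acts_by_derivation_def
        using X det_form_tensor_action[OF X(1) X(1)]
          det_form_tensor_action[OF transpose_special_linear[OF X(1)] transpose_special_linear[OF X(1)]]
        by (intro exI[of _ "tensor_action X X"] exI[of _ "tensor_action (transpose X) (transpose X)"])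
          (simp add: pair_tensor_action tensor_action_add tensor_action_minus swap_index_skew_action
            symdet.form_def det.form_def)
    qed
  next
    case 2
    show ?thesis
    proof (rule det.springer_pair_of_derivations[OF _ inv])
      show "is_basis_of b {x. x = x}" using 2 by simp
      fix A assume "A \<in> G"
      then obtain X Y where X: "X \<in> special_linear" "Y \<in> special_linear" "represents_in b (tensor_action X Y) A"
        using 2 by auto
      show "det.acts_by_derivation b A"
        unfolding det.acts_by_derivation_def
        using X by (intro exI[of _ "tensor_action X Y"] exI[of _ "tensor_action (transpose X) (transpose Y)"])
          (simp add: pair_tensor_action tensor_action_add tensor_action_minus det_form_tensor_action
            transpose_special_linear)
    qed
  next
    case 3
    show ?thesis
    proof (rule pf.springer_pair_of_derivations[OF _ inv])
      show "is_basis_of b {x. skew_part x = x}" using 3 by (simp add: skew_part_fixed)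
      fix A assume "A \<in> G"
      then obtain X where X: "X \<in> special_linear" "represents_in b (tensor_action X X) A" using 3 by auto
      show "pf.acts_by_derivation b A"
        unfolding pf.acts_by_derivation_def
        using X by (intro exI[of _ "tensor_action X X"] exI[of _ "tensor_action (transpose X) (transpose X)"])
          (simp add: pair_tensor_action tensor_action_add tensor_action_minus swap_index_skew_action
            pf_form_tensor_action transpose_special_linear)
    qed
  qed
qed

section \<open>The exceptional cubic form\<close>

text \<open>The variables correspond to the 27 weights, and the triples are the 45 sets of three
  weights with sum zero (the tritangent planes of a cubic surface). Up to a common factor the signs
  are forced by invariance under the edge operators below.\<close>

definition e6_triples :: "(nat \<times> nat \<times> nat \<times> complex) list"
  where "e6_triples = [(0,12,26,1), (0,15,25,-1), (0,17,24,1), (0,19,23,-1), (0,21,22,1), (1,10,26,-1),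
      (1,13,25,1), (1,16,24,-1), (1,18,23,1), (1,20,22,-1), (2,8,26,1), (2,11,25,-1), (2,14,24,1),
      (2,18,21,-1), (2,19,20,1), (3,6,26,-1), (3,9,25,1), (3,14,23,-1), (3,16,21,1), (3,17,20,-1), (4,5,26,1),
      (4,7,25,-1), (4,14,22,1), (4,16,19,-1), (4,17,18,1), (5,9,24,-1), (5,11,23,1), (5,13,21,-1),
      (5,15,20,1), (6,7,24,1), (6,11,22,-1), (6,13,19,1), (6,15,18,-1), (7,8,23,-1), (7,10,21,1),
      (7,12,20,-1), (8,9,22,1), (8,13,17,-1), (8,15,16,1), (9,10,19,-1), (9,12,18,1), (10,11,17,1),
      (10,14,15,-1), (11,12,16,-1), (12,13,14,1)]"

text \<open>The edges of the crystal of the minuscule representation: \<open>(r, r')\<close> is listed for \<open>i\<close> if \<open>f\<^sub>i\<close> maps the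
  weight vector \<open>r\<close> to the weight vector \<open>r'\<close>. The weights are numbered from the highest one downwards.\<close>

definition e6_edges :: "nat \<Rightarrow> (nat \<times> nat) list"
  where "e6_edges i = [[], [(0,1), (10,12), (13,15), (16,17), (18,19), (20,21)], [(3,4), (5,6), (7,9),
      (18,20), (19,21), (22,23)], [(1,2), (8,10), (11,13), (14,16), (19,22), (21,23)], [(2,3), (6,8), (9,11),
      (16,18), (17,19), (23,24)], [(3,5), (4,6), (11,14), (13,16), (15,17), (24,25)], [(5,7), (6,9), (8,11),
      (10,13), (12,15), (25,26)]] ! i"

lemma e6_gradient:
  "triples_gradient e6_triples X 0 = X 12 * X 26 + X 17 * X 24 + X 21 * X 22 - X 15 * X 25 - X 19 * X 23"
  "triples_gradient e6_triples X 1 = X 13 * X 25 + X 18 * X 23 - X 10 * X 26 - X 16 * X 24 - X 20 * X 22"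
  "triples_gradient e6_triples X 2 = X 8 * X 26 + X 14 * X 24 + X 19 * X 20 - X 11 * X 25 - X 18 * X 21"
  "triples_gradient e6_triples X 3 = X 9 * X 25 + X 16 * X 21 - X 6 * X 26 - X 14 * X 23 - X 17 * X 20"
  "triples_gradient e6_triples X 4 = X 5 * X 26 + X 14 * X 22 + X 17 * X 18 - X 7 * X 25 - X 16 * X 19"
  "triples_gradient e6_triples X 5 = X 4 * X 26 + X 11 * X 23 + X 15 * X 20 - X 9 * X 24 - X 13 * X 21"
  "triples_gradient e6_triples X 6 = X 7 * X 24 + X 13 * X 19 - X 3 * X 26 - X 11 * X 22 - X 15 * X 18"
  "triples_gradient e6_triples X 7 = X 6 * X 24 + X 10 * X 21 - X 4 * X 25 - X 8 * X 23 - X 12 * X 20"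
  "triples_gradient e6_triples X 8 = X 2 * X 26 + X 9 * X 22 + X 15 * X 16 - X 7 * X 23 - X 13 * X 17"
  "triples_gradient e6_triples X 9 = X 3 * X 25 + X 8 * X 22 + X 12 * X 18 - X 5 * X 24 - X 10 * X 19"
  "triples_gradient e6_triples X 10 = X 7 * X 21 + X 11 * X 17 - X 1 * X 26 - X 9 * X 19 - X 14 * X 15"
  "triples_gradient e6_triples X 11 = X 5 * X 23 + X 10 * X 17 - X 2 * X 25 - X 6 * X 22 - X 12 * X 16"
  "triples_gradient e6_triples X 12 = X 0 * X 26 + X 9 * X 18 + X 13 * X 14 - X 7 * X 20 - X 11 * X 16"
  "triples_gradient e6_triples X 13 = X 1 * X 25 + X 6 * X 19 + X 12 * X 14 - X 5 * X 21 - X 8 * X 17"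
  "triples_gradient e6_triples X 14 = X 2 * X 24 + X 4 * X 22 + X 12 * X 13 - X 3 * X 23 - X 10 * X 15"
  "triples_gradient e6_triples X 15 = X 5 * X 20 + X 8 * X 16 - X 0 * X 25 - X 6 * X 18 - X 10 * X 14"
  "triples_gradient e6_triples X 16 = X 3 * X 21 + X 8 * X 15 - X 1 * X 24 - X 4 * X 19 - X 11 * X 12"
  "triples_gradient e6_triples X 17 = X 0 * X 24 + X 4 * X 18 + X 10 * X 11 - X 3 * X 20 - X 8 * X 13"
  "triples_gradient e6_triples X 18 = X 1 * X 23 + X 4 * X 17 + X 9 * X 12 - X 2 * X 21 - X 6 * X 15"
  "triples_gradient e6_triples X 19 = X 2 * X 20 + X 6 * X 13 - X 0 * X 23 - X 4 * X 16 - X 9 * X 10"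
  "triples_gradient e6_triples X 20 = X 2 * X 19 + X 5 * X 15 - X 1 * X 22 - X 3 * X 17 - X 7 * X 12"
  "triples_gradient e6_triples X 21 = X 0 * X 22 + X 3 * X 16 + X 7 * X 10 - X 2 * X 18 - X 5 * X 13"
  "triples_gradient e6_triples X 22 = X 0 * X 21 + X 4 * X 14 + X 8 * X 9 - X 1 * X 20 - X 6 * X 11"
  "triples_gradient e6_triples X 23 = X 1 * X 18 + X 5 * X 11 - X 0 * X 19 - X 3 * X 14 - X 7 * X 8"
  "triples_gradient e6_triples X 24 = X 0 * X 17 + X 2 * X 14 + X 6 * X 7 - X 1 * X 16 - X 5 * X 9"
  "triples_gradient e6_triples X 25 = X 1 * X 13 + X 3 * X 9 - X 0 * X 15 - X 2 * X 11 - X 4 * X 7"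
  "triples_gradient e6_triples X 26 = X 0 * X 12 + X 2 * X 8 + X 4 * X 5 - X 1 * X 10 - X 3 * X 6"
  by (simp_all add: triples_gradient_def e6_triples_def del: One_nat_def)

lemma e6_cubic:
  "triples_cubic e6_triples X = X 0 * X 12 * X 26 + X 1 * X 13 * X 25 + X 0 * X 17 * X 24 + X 1 * X 18 * X 23 + X 0 * X 21 * X 22 + X 2 * X 19 * X 20 + X 3 * X 16 * X 21 + X 4 * X 17 * X 18 + X 5 * X 15 * X 20 + X 7 * X 10 * X 21 + X 9 * X 12 * X 18 + X 10 * X 11 * X 17 + X 12 * X 13 * X 14 + X 8 * X 15 * X 16 + X 6 * X 13 * X 19 + X 4 * X 14 * X 22 + X 2 * X 14 * X 24 + X 5 * X 11 * X 23 + X 8 * X 9 * X 22 + X 6 * X 7 * X 24 + X 3 * X 9 * X 25 + X 4 * X 5 * X 26 + X 2 * X 8 * X 26 - X 1 * X 10 * X 26 - X 0 * X 15 * X 25 - X 1 * X 16 * X 24 - X 0 * X 19 * X 23 - X 1 * X 20 * X 22 - X 2 * X 18 * X 21 - X 3 * X 17 * X 20 - X 5 * X 13 * X 21 - X 6 * X 15 * X 18 - X 7 * X 12 * X 20 - X 9 * X 10 * X 19 - X 11 * X 12 * X 16 - X 8 * X 13 * X 17 - X 10 * X 14 * X 15 - X 6 * X 11 * X 22 - X 4 * X 16 * X 19 - X 3 * X 14 * X 23 - X 5 * X 9 * X 24 - X 7 * X 8 * X 23 - X 4 * X 7 * X 25 - X 3 * X 6 * X 26 - X 2 * X 11 * X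 25"
  by (simp add: triples_cubic_def e6_triples_def del: One_nat_def)

lemma less_27: "(r < (27::nat)) \<longleftrightarrow> r \<in> {0, 1, 2, 3, 4, 5, 6, 7, 8, 9, 10, 11, 12, 13, 14, 15, 16, 17, 18, 19, 20, 21, 22, 23, 24, 25, 26}"
  by (auto simp: less_Suc_eq eval_nat_numeral)

lemma e6_adjoint:
  assumes "r < 27"
  shows "triples_gradient e6_triples (triples_gradient e6_triples X) r = triples_cubic e6_triples X * X r"
proof -
  have "\<forall>r\<in>{0, 1, 2, 3, 4, 5, 6, 7, 8, 9, 10, 11, 12, 13, 14, 15, 16, 17, 18, 19, 20, 21, 22, 23, 24, 25, 26}.
      triples_gradient e6_triples (triples_gradient e6_triples X) r = triples_cubic e6_triples X * X r"
    unfolding ball_simps(5,7) e6_gradient e6_cubic by (intro conjI TrueI; algebra)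
  then show ?thesis using assms unfolding less_27 by blast
qed

text \<open>Up to a factor, the first sum is \<open>form x x (M x)\<close> for the operator M that
  moves basis vectors along the edges of \<open>f i\<close>. The second is the same for the
  transpose of M, which moves them backwards like \<open>e i\<close>.\<close>

lemma e6_edges_invariant:
  assumes "i \<in> {1..6}"
  shows "(\<Sum>(r, r')\<leftarrow>e6_edges i. triples_gradient e6_triples X r' * X r) = 0" (is ?A)
    and "(\<Sum>(r, r')\<leftarrow>e6_edges i. triples_gradient e6_triples X r * X r') = 0" (is ?B)
proof -
  have "i \<in> {1, 2, 3, 4, 5, 6}" using assms by auto
  moreover have "\<forall>i\<in>{1, 2, 3, 4, 5, 6}. (\<Sum>(r, r')\<leftarrow>e6_edges i. triples_gradient e6_triples X r' * X r) = 0
      \<and> (\<Sum>(r, r')\<leftarrow>e6_edges i. triples_gradient e6_triples X r * X r') = 0"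
    unfolding ball_simps(5,7)
    by (simp add: e6_edges_def del: One_nat_def; simp only: e6_gradient; intro conjI; algebra)
  ultimately show ?A ?B by blast+
qed

lemma e6_edges_bound: "i \<in> {1..6} \<Longrightarrow> (r, r') \<in> set (e6_edges i) \<Longrightarrow> r < 27 \<and> r' < 27"
proof -
  assume "i \<in> {1..6}" and r: "(r, r') \<in> set (e6_edges i)"
  then have "i \<in> {1, 2, 3, 4, 5, 6}" by auto
  then show ?thesis using r by (elim insertE emptyE; auto simp: e6_edges_def)
qed

lemma e6_edges_inj:
  "i \<in> {1..6} \<Longrightarrow> distinct (map fst (e6_edges i)) \<and> distinct (map snd (e6_edges i))"
proof -
  assume "i \<in> {1..6}"
  then have "i \<in> {1, 2, 3, 4, 5, 6}" by auto
  then show ?thesis by (elim insertE emptyE; simp add: e6_edges_def)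
qed

lemma triple_system_e6:
  fixes lab :: "nat \<Rightarrow> 'n::finite"
  assumes lab: "bij_betw lab {..<27} UNIV"
  shows "triple_system e6_triples 27 (\<lambda>r. axis (lab r) 1) 1 (\<lambda>x. x)"
proof
  show "\<forall>(p, q, k, s)\<in>set e6_triples. p < 27 \<and> q < 27 \<and> k < 27"
    by (simp add: e6_triples_def)
  show "pair (axis (lab r) 1) (axis (lab r') 1) = (if r = r' then 1 else 0)" if "r < 27" "r' < 27" for r r'
    using that lab unfolding pair_axis by (auto simp: axis_def bij_betw_def inj_on_def)
  show "(\<Sum>r<27. pair x (axis (lab r) 1) *s axis (lab r) 1) = 1 *s x" for x
    using sum.reindex_bij_betw[OF lab, of "\<lambda>p. x $ p *s axis p 1"]
    by (simp add: pair_axis basis_expansion)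
  show "\<exists>X. triples_cubic e6_triples X \<noteq> 0"
    by (rule exI[of _ "\<lambda>r. if r \<in> {0, 12, 26} then 1 else 0"]) (simp add: e6_cubic del: One_nat_def)
qed (simp_all add: e6_adjoint)

section \<open>Transport of the cubic form to a basis of weight vectors\<close>

lemma is_basis_of_dual_system:
  fixes b c :: "'n::finite \<Rightarrow> complex^'n"
  assumes dual: "\<And>i j. pair (b i) (c j) = (if i = j then 1 else 0)"
    and expand: "\<And>x. (\<Sum>i\<in>UNIV. pair x (c i) *s b i) = x"
  shows "is_basis_of b UNIV"
proof -
  have inj: "inj b"
  proof (rule injI)
    fix i j assume "b i = b j"
    then show "i = j" using dual[of i j] dual[of j j] by (auto split: if_splits)
  qed
  have coord: "u (b i) = 0" if "(\<Sum>v\<in>range b. u v *s v) = 0" for u i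
  proof -
    have "pair (\<Sum>j\<in>UNIV. u (b j) *s b j) (c i) = u (b i)"
      by (simp add: pair_sum pair_scale dual if_distrib[of "\<lambda>t. _ * t"] cong: if_cong)
    then show ?thesis using that by (simp add: sum.reindex[OF inj] pair_zero)
  qed
  have "vec.independent (range b)"
    unfolding vec.independent_explicit_finite_subsets
  proof (intro allI impI ballI)
    fix A u v assume A: "A \<subseteq> range b" "finite A" and 0: "(\<Sum>v\<in>A. u v *s v) = 0" and v: "v \<in> A"
    have "(\<Sum>v\<in>range b. (if v \<in> A then u v else 0) *s v) = (\<Sum>v\<in>A. u v *s v)"
      using A by (intro sum.mono_neutral_cong_right) auto
    with 0 have "(\<Sum>v\<in>range b. (if v \<in> A then u v else 0) *s v) = 0" by simp
    moreover obtain i where "v = b i" using A v by auto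
    ultimately show "u v = 0" using coord[of "\<lambda>v. if v \<in> A then u v else 0" i] v by simp
  qed
  moreover have "x \<in> vec.span (range b)" for x
    by (subst expand[of x, symmetric]) (intro vec.span_sum vec.span_scale vec.span_base, auto)
  ultimately show ?thesis using inj by (auto simp: is_basis_of_def)
qed

lemma matrix_vector_scale: "A *v (c *s x) = c *s (A *v x)" for A :: "complex^'n^'m"
  by (simp add: vec_eq_iff matrix_vector_mult_def sum_distrib_left mult_ac)

lemma matrix_vector_sum: "A *v (\<Sum>i\<in>I. f i) = (\<Sum>i\<in>I. A *v f i)" for A :: "complex^'n^'m"
  by (induction I rule: infinite_finite_induct) (simp_all add: matrix_vector_right_distrib)

lemma matrix_vector_mult_minus: "A *v (- x) = - (A *v x)" for A :: "complex^'n^'m"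
  by (simp add: vec_eq_iff matrix_vector_mult_def sum_negf)

lemma pair_matrix_vector: "pair (A *v x) y = pair x (transpose A *v y)"
proof -
  have "pair (A *v x) y = (\<Sum>i\<in>UNIV. \<Sum>j\<in>UNIV. A $ i $ j * x $ j * y $ i)"
    by (simp add: pair_def matrix_vector_mult_def sum_distrib_right)
  also have "\<dots> = (\<Sum>j\<in>UNIV. \<Sum>i\<in>UNIV. A $ i $ j * x $ j * y $ i)" by (rule sum.swap)
  also have "\<dots> = pair x (transpose A *v y)"
    by (simp add: pair_def matrix_vector_mult_def transpose_def sum_distrib_left mult_ac)
  finally show ?thesis .
qed

context triple_system
begin

lemma form_E: "r < n \<Longrightarrow> form x x (E r) = 2 * g * triples_gradient T (coord x) r"
  unfolding form_gradient by (simp add: coord_def ortho if_distrib[of "\<lambda>t. _ * t"] cong: if_cong)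

end

lemma sum_list_edges:
  fixes F :: "nat \<Rightarrow> nat \<Rightarrow> complex"
  assumes "distinct (map fst L)"
  shows "(\<Sum>(r, r')\<leftarrow>L. F r r') = (\<Sum>p\<in>set L. F (fst p) (snd p))"
  using assms by (simp add: distinct_map sum_list_distinct_conv_sum_set case_prod_unfold)

text \<open>\<open>M\<close> permutes the labelled unit vectors partially along \<open>L\<close>,
  and its transpose reverses the edges. The lemma translates both derivation conditions into sums
  over edges.\<close>

lemma form_edge_operator:
  fixes lab :: "nat \<Rightarrow> 'n::finite" and M :: "complex^'n^'n"
  assumes lab: "bij_betw lab {..<27} UNIV"
    and L: "distinct (map fst L)" "\<And>r r'. (r, r') \<in> set L \<Longrightarrow> r < 27 \<and> r' < 27"
    and edge: "\<And>r r'. (r, r') \<in> set L \<Longrightarrow> M *v axis (lab r) 1 = axis (lab r') 1"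
    and no_edge: "\<And>r. r < 27 \<Longrightarrow> r \<notin> fst ` set L \<Longrightarrow> M *v axis (lab r) 1 = 0"
  defines "form \<equiv> cubic_norm.form (triple_system.cross e6_triples (\<lambda>r. axis (lab r) 1))"
  shows "form x x (M *v x) = 2 * (\<Sum>(r, r')\<leftarrow>L. triples_gradient e6_triples (\<lambda>r. x $ lab r) r' * x $ lab r)"
    and "form x x (transpose M *v x) = 2 * (\<Sum>(r, r')\<leftarrow>L. triples_gradient e6_triples (\<lambda>r. x $ lab r) r * x $ lab r')"
proof -
  interpret E6: triple_system e6_triples 27 "\<lambda>r. axis (lab r) 1" 1 "\<lambda>x. x"
    by (rule triple_system_e6[OF lab])
  have form: "form = E6.form" by (simp add: form_def)
  have coord: "E6.coord x = (\<lambda>r. x $ lab r)" for x by (simp add: E6.coord_def pair_axis fun_eq_iff)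
  have edge': "M *v axis (lab (fst p)) 1 = axis (lab (snd p)) 1" if "p \<in> set L" for p
    using edge[of "fst p" "snd p"] that by simp
  have inj: "inj_on fst (set L)" using L(1) by (simp add: distinct_map)
  have sub: "fst ` set L \<subseteq> {..<27}" using L(2) by auto
  have "M *v x = (\<Sum>r<27. x $ lab r *s (M *v axis (lab r) 1))"
  proof -
    have "M *v x = M *v (\<Sum>j\<in>UNIV. x $ j *s axis j 1)" by (simp add: basis_expansion)
    also have "\<dots> = (\<Sum>j\<in>UNIV. x $ j *s (M *v axis j 1))"
      by (simp add: matrix_vector_sum matrix_vector_scale)
    also have "\<dots> = (\<Sum>r<27. x $ lab r *s (M *v axis (lab r) 1))"
      using sum.reindex_bij_betw[OF lab, of "\<lambda>j. x $ j *s (M *v axis j 1)"] by simp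
    finally show ?thesis .
  qed
  also have "\<dots> = (\<Sum>r\<in>fst ` set L. x $ lab r *s (M *v axis (lab r) 1))"
    using sub no_edge by (intro sum.mono_neutral_right) auto
  also have "\<dots> = (\<Sum>p\<in>set L. x $ lab (fst p) *s axis (lab (snd p)) 1)"
    using edge' by (simp add: sum.reindex[OF inj])
  finally have Mx: "M *v x = (\<Sum>p\<in>set L. x $ lab (fst p) *s axis (lab (snd p)) 1)" .
  show "form x x (M *v x) = 2 * (\<Sum>(r, r')\<leftarrow>L. triples_gradient e6_triples (\<lambda>r. x $ lab r) r' * x $ lab r)"
  proof -
    have "form x x (M *v x) = (\<Sum>p\<in>set L. x $ lab (fst p) * E6.form x x (axis (lab (snd p)) 1))"
      unfolding Mx form by (simp add: E6.form_sum E6.form_scale)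
    also have "\<dots> = (\<Sum>p\<in>set L. 2 * (triples_gradient e6_triples (\<lambda>r. x $ lab r) (snd p) * x $ lab (fst p)))"
    proof (rule sum.cong[OF refl])
      fix p assume "p \<in> set L"
      then have "snd p < 27" using L(2)[of "fst p" "snd p"] by simp
      then show "x $ lab (fst p) * E6.form x x (axis (lab (snd p)) 1)
          = 2 * (triples_gradient e6_triples (\<lambda>r. x $ lab r) (snd p) * x $ lab (fst p))"
        using E6.form_E[of "snd p" x] by (simp add: coord)
    qed
    finally show ?thesis by (simp add: sum_list_edges[OF L(1)] sum_distrib_left)
  qed
  have coord_transpose: "E6.coord (transpose M *v x) r = pair x (M *v axis (lab r) 1)" for r
    unfolding E6.coord_def by (metis pair_matrix_vector transpose_transpose)
  show "form x x (transpose M *v x) = 2 * (\<Sum>(r, r')\<leftarrow>L. triples_gradient e6_triples (\<lambda>r. x $ lab r) r * x $ lab r')"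
  proof -
    have "form x x (transpose M *v x)
       = (\<Sum>r<27. 2 * triples_gradient e6_triples (\<lambda>r. x $ lab r) r * pair x (M *v axis (lab r) 1))"
      unfolding form E6.form_gradient coord_transpose by (simp add: coord)
    also have "\<dots> = (\<Sum>r\<in>fst ` set L. 2 * triples_gradient e6_triples (\<lambda>r. x $ lab r) r * pair x (M *v axis (lab r) 1))"
      using sub no_edge by (intro sum.mono_neutral_right) (auto simp: pair_zero)
    also have "\<dots> = (\<Sum>p\<in>set L. 2 * triples_gradient e6_triples (\<lambda>r. x $ lab r) (fst p) * x $ lab (snd p))"
      using edge' by (simp add: sum.reindex[OF inj] pair_axis)
    finally show ?thesis by (simp add: sum_list_edges[OF L(1)] sum_distrib_left mult.assoc)
  qed
qed

lemma invertible_matrix_of_independent: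
  fixes w :: "nat \<Rightarrow> complex^'n::finite"
  assumes lab: "bij_betw lab {..<m} (UNIV :: 'n set)"
    and w: "\<And>u. (\<Sum>r<m. u r *s w r) = 0 \<Longrightarrow> \<forall>r<m. u r = 0"
  obtains S S' :: "complex^'n^'n" where "S ** S' = mat 1" "S' ** S = mat 1"
    "\<And>r. r < m \<Longrightarrow> S *v axis (lab r) 1 = w r"
proof -
  define lab' where "lab' = inv_into {..<m} lab"
  have lab': "lab' (lab r) = r" if "r < m" for r
    using that lab by (simp add: lab'_def bij_betw_def)
  define S :: "complex^'n^'n" where "S = (\<chi> i j. w (lab' j) $ i)"
  have column: "S *v axis (lab r) 1 = w r" if "r < m" for r
    by (simp add: vec_eq_iff matrix_vector_mult_def S_def axis_def lab'[OF that] if_distrib[of "\<lambda>t. _ * t"] cong: if_cong)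
  have "x = 0" if "S *v x = 0" for x
  proof -
    have "S *v x = S *v (\<Sum>j\<in>UNIV. x $ j *s axis j 1)" by (simp add: basis_expansion)
    also have "\<dots> = (\<Sum>j\<in>UNIV. x $ j *s (S *v axis j 1))" by (simp add: matrix_vector_sum matrix_vector_scale)
    also have "\<dots> = (\<Sum>r<m. x $ lab r *s w r)"
      using sum.reindex_bij_betw[OF lab, of "\<lambda>j. x $ j *s (S *v axis j 1)"] column by simp
    finally have "\<forall>r<m. x $ lab r = 0" using w that by simp
    then have "x $ j = 0" for j using lab by (auto simp: bij_betw_def) (metis UNIV_I imageE lessThan_iff)
    then show ?thesis by (simp add: vec_eq_iff)
  qed
  then obtain S' where "S' ** S = mat 1" using matrix_left_invertible_ker[of S] by auto
  then show thesis using that column matrix_left_right_inverse[of S' S] by metis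
qed

definition e6_generated :: "(nat \<Rightarrow> complex^'n^'n) \<Rightarrow> (nat \<Rightarrow> complex^'n^'n) \<Rightarrow> (nat \<Rightarrow> complex^'n^'n) \<Rightarrow> (complex^'n^'n) set"
  where "e6_generated e f h = lie_generated (e ` {1..6} \<union> f ` {1..6} \<union> h ` {1..6})"

text \<open>In the basis \<open>w\<close> all \<open>e i\<close> and \<open>f i\<close> are edge
  operators, so they and their transposes are derivations of the explicit cubic form. Derivations
  form a Lie algebra, which extends this to everything that is generated.\<close>

lemma springer_pair_minuscule:
  fixes e f h :: "nat \<Rightarrow> complex^'n^'n" and w :: "nat \<Rightarrow> complex^'n"
  assumes card: "CARD('n) = 27"
    and h: "\<And>i. i \<in> {1..6} \<Longrightarrow> lie_bracket (e i) (f i) = h i"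
    and w: "\<And>u. (\<Sum>r<27. u r *s w r) = 0 \<Longrightarrow> \<forall>r<27. u r = 0"
    and edge: "\<And>i r r'. i \<in> {1..6} \<Longrightarrow> (r, r') \<in> set (e6_edges i) \<Longrightarrow> f i *v w r = w r' \<and> e i *v w r' = w r"
    and f_zero: "\<And>i r. i \<in> {1..6} \<Longrightarrow> r < 27 \<Longrightarrow> r \<notin> fst ` set (e6_edges i) \<Longrightarrow> f i *v w r = 0"
    and e_zero: "\<And>i r. i \<in> {1..6} \<Longrightarrow> r < 27 \<Longrightarrow> r \<notin> snd ` set (e6_edges i) \<Longrightarrow> e i *v w r = 0"
    and inv: "cubic_invariants (e6_generated e f h) d D"
  shows "springer_tensors d D"
proof -
  obtain lab :: "nat \<Rightarrow> 'n" where lab: "bij_betw lab {..<27} UNIV"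
    using ex_bij_betw_nat_finite[of "UNIV :: 'n set"] card by (auto simp: atLeast0LessThan)
  obtain S S' :: "complex^'n^'n" where S: "S ** S' = mat 1" "S' ** S = mat 1"
    and column: "\<And>r. r < 27 \<Longrightarrow> S *v axis (lab r) 1 = w r"
    using invertible_matrix_of_independent[OF lab, of w] w by blast
  interpret E6: triple_system e6_triples 27 "\<lambda>r. axis (lab r) 1" 1 "\<lambda>x. x"
    by (rule triple_system_e6[OF lab])
  define b where "b j = S' *v axis j 1" for j
  define conj where "conj A = S' ** A ** S" for A
  have conj_apply: "conj A *v x = S' *v (A *v (S *v x))" for A x
    by (simp add: conj_def matrix_vector_mul_assoc matrix_mul_assoc)
  have S_cancel: "S *v (S' *v x) = x" "S' *v (S *v x) = x" for x
    by (simp_all add: matrix_vector_mul_assoc S)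
  have basis: "is_basis_of b UNIV"
  proof (rule is_basis_of_dual_system[where c = "\<lambda>j. transpose S *v axis j 1"])
    show "pair (b i) (transpose S *v axis j 1) = (if i = j then 1 else 0)" for i j
      unfolding pair_matrix_vector[symmetric] b_def S_cancel pair_axis by (simp add: axis_def)
    show "(\<Sum>i\<in>UNIV. pair x (transpose S *v axis i 1) *s b i) = x" for x
    proof -
      have "(\<Sum>i\<in>UNIV. pair x (transpose S *v axis i 1) *s b i) = S' *v (\<Sum>i\<in>UNIV. (S *v x) $ i *s axis i 1)"
        unfolding pair_matrix_vector[symmetric] b_def pair_axis by (simp add: matrix_vector_sum matrix_vector_scale)
      then show ?thesis by (simp add: basis_expansion S_cancel)
    qed
  qed
  define Der where "Der = {M. \<forall>x. E6.form x x (M *v x) = 0}"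
  have polar: "E6.form (M *v x) x y * 2 + E6.form x x (M *v y) = 0" if "M \<in> Der" for M x y
  proof -
    have "E6.form (M *v x) x y + E6.form x (M *v x) y + E6.form x x (M *v y) = 0"
      by (rule E6.derivation_polarized)
        (use that in \<open>auto simp: Der_def matrix_vector_right_distrib matrix_vector_mult_minus\<close>)
    then show ?thesis using E6.form_sym(1)[of x "M *v x" y] by algebra
  qed
  \<comment> \<open>By polarisation \<open>form x x (A (B x))\<close> equals -2 times
    \<open>form (A x) x (B x)\<close>, which is symmetric in A and B and therefore drops out of the
    commutator.\<close>
  have Der_bracket: "lie_bracket A B \<in> Der" if "A \<in> Der" "B \<in> Der" for A B
  proof -
    have "E6.form x x (A *v (B *v x)) = E6.form x x (B *v (A *v x))" for x
    proof -
      have "E6.form x x (A *v (B *v x)) = - (E6.form (A *v x) x (B *v x) * 2)"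
        using polar[OF that(1), of x "B *v x"] by (simp add: eq_neg_iff_add_eq_0 add.commute)
      moreover have "E6.form x x (B *v (A *v x)) = - (E6.form (B *v x) x (A *v x) * 2)"
        using polar[OF that(2), of x "A *v x"] by (simp add: eq_neg_iff_add_eq_0 add.commute)
      moreover have "E6.form (B *v x) x (A *v x) = E6.form (A *v x) x (B *v x)"
        by (metis E6.form_sym)
      ultimately show ?thesis by simp
    qed
    moreover have "lie_bracket A B *v x = A *v (B *v x) + - (B *v (A *v x))" for x
      by (simp add: lie_bracket_def matrix_vector_mult_diff_rdistrib matrix_vector_mul_assoc)
    moreover have "E6.form x y (- z) = - E6.form x y z" for x y z
      by (simp add: E6.form_def pair_minus)
    ultimately show ?thesis by (simp add: Der_def E6.form_add del: add_uminus_conv_diff)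
  qed
  have conj_bracket: "conj (lie_bracket A B) = lie_bracket (conj A) (conj B)" for A B
    unfolding matrix_eq by (simp add: conj_apply lie_bracket_def matrix_vector_mult_diff_rdistrib
        matrix_vector_mul_assoc[symmetric] S_cancel matrix_vector_mult_diff_distrib)
  have transpose_bracket: "transpose (lie_bracket A B) = lie_bracket (transpose B) (transpose A)" for A B :: "complex^'n^'n"
    by (simp add: lie_bracket_def matrix_transpose_mul[symmetric]) (simp add: transpose_def vec_eq_iff)
  have ef: "conj (f i) \<in> Der \<and> transpose (conj (f i)) \<in> Der" "conj (e i) \<in> Der \<and> transpose (conj (e i)) \<in> Der"
    if i: "i \<in> {1..6}" for i
  proof -
    have f_op: "conj (f i) *v axis (lab r) 1 = axis (lab r') 1" if "(r, r') \<in> set (e6_edges i)" for r r'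
      using edge[OF i that] e6_edges_bound[OF i that] by (simp add: conj_apply column) (metis S_cancel(2) column)
    have f_op0: "conj (f i) *v axis (lab r) 1 = 0" if "r < 27" "r \<notin> fst ` set (e6_edges i)" for r
      using f_zero[OF i that] that by (simp add: conj_apply column)
    have fst_distinct: "distinct (map fst (e6_edges i))" using e6_edges_inj[OF i] by simp
    have bound: "r < 27 \<and> r' < 27" if "(r, r') \<in> set (e6_edges i)" for r r' using e6_edges_bound[OF i that] .
    show "conj (f i) \<in> Der \<and> transpose (conj (f i)) \<in> Der"
      using form_edge_operator[where M = "conj (f i)" and L = "e6_edges i", OF lab fst_distinct bound f_op f_op0]
        e6_edges_invariant[OF i] by (simp add: Der_def)
    \<comment> \<open>\<open>e i\<close> follows the same edges in the opposite direction, so the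
      two invariance sums exchange their roles.\<close>
    let ?L = "map prod.swap (e6_edges i)"
    have e_op: "conj (e i) *v axis (lab r) 1 = axis (lab r') 1" if "(r, r') \<in> set ?L" for r r'
    proof -
      have "(r', r) \<in> set (e6_edges i)" using that by auto
      then show ?thesis
        using edge[OF i] e6_edges_bound[OF i] by (simp add: conj_apply column) (metis S_cancel(2) column)
    qed
    have e_op0: "conj (e i) *v axis (lab r) 1 = 0" if "r < 27" "r \<notin> fst ` set ?L" for r
    proof -
      have "r \<notin> snd ` set (e6_edges i)" using that(2) by (auto simp: image_image)
      then show ?thesis using e_zero[OF i that(1)] that by (simp add: conj_apply column)
    qed
    have swap: "(\<Sum>(r, r')\<leftarrow>?L. F r r') = (\<Sum>(r, r')\<leftarrow>e6_edges i. F r' r)" for F :: "nat \<Rightarrow> nat \<Rightarrow> complex"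
      by (simp add: case_prod_unfold o_def)
    have fst_distinct': "distinct (map fst ?L)" using e6_edges_inj[OF i] by (simp add: o_def)
    have bound': "r < 27 \<and> r' < 27" if "(r, r') \<in> set ?L" for r r'
      using that e6_edges_bound[OF i] by auto
    show "conj (e i) \<in> Der \<and> transpose (conj (e i)) \<in> Der"
      using form_edge_operator[where M = "conj (e i)" and L = ?L, OF lab fst_distinct' bound' e_op e_op0]
        e6_edges_invariant[OF i] unfolding swap by (simp add: Der_def)
  qed
  have h_Der: "conj (h i) \<in> Der \<and> transpose (conj (h i)) \<in> Der" if "i \<in> {1..6}" for i
    using ef[OF that] h[OF that, symmetric] by (simp add: conj_bracket transpose_bracket Der_bracket)
  have Der: "conj A \<in> Der \<and> transpose (conj A) \<in> Der" if "A \<in> e6_generated e f h" for A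
    using that unfolding e6_generated_def
  proof (induction rule: lie_generated.induct)
    case (base A)
    then show ?case using ef h_Der by auto
  next
    case zero
    show ?case by (simp add: Der_def conj_def E6.form_zero transpose_def matrix_vector_mult_def matrix_matrix_mult_def
          vec_eq_iff) (simp add: E6.form_def pair_def)
  next
    case (add A B)
    have "conj (A + B) = conj A + conj B"
      unfolding matrix_eq by (simp add: conj_apply matrix_vector_mult_add_rdistrib matrix_vector_right_distrib)
    moreover have "transpose (conj A + conj B) = transpose (conj A) + transpose (conj B)"
      by (simp add: transpose_def vec_eq_iff)
    ultimately show ?case using add.IH by (simp add: Der_def matrix_vector_mult_add_rdistrib E6.form_add)
  next
    case (scale A c)
    have mv: "(c *m M) *v x = c *s (M *v x)" for M :: "complex^'n^'n" and x
      by (simp add: vec_eq_iff scale_matrix_def matrix_vector_mult_def sum_distrib_left mult.assoc)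
    have "conj (c *m A) = c *m conj A"
      unfolding matrix_eq by (simp add: conj_apply mv matrix_vector_scale)
    moreover have "transpose (c *m conj A) = c *m transpose (conj A)"
      by (simp add: transpose_def vec_eq_iff scale_matrix_def)
    ultimately show ?case using scale.IH by (simp add: Der_def mv E6.form_scale)
  next
    case (bracket A B)
    then show ?case by (simp add: conj_bracket transpose_bracket Der_bracket)
  qed
  show ?thesis
  proof (rule E6.springer_pair_of_derivations[OF _ inv])
    show "is_basis_of b {x. x = x}" using basis by simp
    fix A assume A: "A \<in> e6_generated e f h"
    have "represents_in b (\<lambda>x. conj A *v x) A"
    proof -
      have "conj A *v b j = (\<Sum>i\<in>UNIV. A $ i $ j *s b i)" for j
      proof -
        have "A *v axis j 1 = (\<Sum>i\<in>UNIV. (A *v axis j 1) $ i *s axis i 1)" by (simp add: basis_expansion)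
        also have "\<dots> = (\<Sum>i\<in>UNIV. A $ i $ j *s axis i 1)"
          by (simp add: matrix_vector_mult_def axis_def if_distrib[of "\<lambda>t. _ * t"] cong: if_cong)
        finally show ?thesis
          by (simp add: conj_apply b_def S_cancel matrix_vector_sum matrix_vector_scale)
      qed
      then show ?thesis by (simp add: represents_in_def)
    qed
    then show "E6.acts_by_derivation b A"
        unfolding E6.acts_by_derivation_def
      using Der[OF A]
      by (intro exI[of _ "\<lambda>x. conj A *v x"] exI[of _ "\<lambda>x. transpose (conj A) *v x"])
        (simp add: pair_matrix_vector matrix_vector_right_distrib matrix_vector_mult_minus Der_def)
  qed
qed

section \<open>Highest weights of representations of \<open>e\<^sub>6\<close>\<close>

lemma card_le_of_independent:
  fixes w :: "nat \<Rightarrow> complex^'n::finite"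
  assumes w: "\<And>u. (\<Sum>r<m. u r *s w r) = 0 \<Longrightarrow> \<forall>r<m. u r = 0"
  shows "m \<le> CARD('n)"
proof -
  have inj: "inj_on w {..<m}"
  proof (rule inj_onI, rule ccontr)
    fix r s assume rs: "r \<in> {..<m}" "s \<in> {..<m}" "w r = w s" "r \<noteq> s"
    let ?u = "\<lambda>k. (if k = r then 1 else 0) - (if k = s then 1 else (0::complex))"
    have "(\<Sum>k<m. ?u k *s w k) = (\<Sum>k<m. (if k = r then w k else 0)) - (\<Sum>k<m. if k = s then w k else 0)"
      unfolding sum_subtractf[symmetric] by (intro sum.cong refl) (auto simp: vec_eq_iff)
    then have "(\<Sum>k<m. ?u k *s w k) = 0" using rs by simp
    from w[OF this] rs show False by auto
  qed
  have "vec.independent (w ` {..<m})"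
    unfolding vec.independent_explicit_finite_subsets
  proof (intro allI impI ballI)
    fix A u v assume A: "A \<subseteq> w ` {..<m}" "finite A" and 0: "(\<Sum>v\<in>A. u v *s v) = 0" and v: "v \<in> A"
    let ?u = "\<lambda>v. if v \<in> A then u v else 0"
    have "(\<Sum>r<m. ?u (w r) *s w r) = (\<Sum>v\<in>w ` {..<m}. ?u v *s v)"
      by (simp add: sum.reindex[OF inj])
    also have "\<dots> = (\<Sum>v\<in>A. u v *s v)"
      using A by (intro sum.mono_neutral_cong_right) auto
    finally have "\<forall>r<m. ?u (w r) = 0" using 0 w[of "\<lambda>r. ?u (w r)"] by simp
    moreover obtain r where "r < m" "v = w r" using A v by auto
    ultimately show "u v = 0" using v by auto
  qed
  then have "card (w ` {..<m}) \<le> vec.dim (UNIV :: (complex^'n) set)"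
    by (intro vec.independent_card_le_dim) auto
  then show ?thesis by (simp only: card_image[OF inj] vec_dim_card card_lessThan)
qed

lemma eigenvectors_independent:
  fixes M :: "complex^'n^'n" and m :: nat
  assumes "\<And>r. r < m \<Longrightarrow> w r \<noteq> 0 \<and> M *v w r = c r *s w r" and "inj_on c {..<m}"
    and "(\<Sum>r<m. u r *s w r) = 0"
  shows "\<forall>r<m. u r = 0"
  using assms
proof (induction m arbitrary: u)
  case 0
  then show ?case by simp
next
  case (Suc m)
  have "M *v (\<Sum>r<Suc m. u r *s w r) = (\<Sum>r<Suc m. (u r * c r) *s w r)"
    using Suc.prems(1) by (simp add: matrix_vector_sum matrix_vector_scale matrix_vector_right_distrib)
  then have 1: "(\<Sum>r<Suc m. (u r * c r) *s w r) = 0" using Suc.prems(3) by simp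
  have "(\<Sum>r<Suc m. (u r * (c r - c m)) *s w r) = (\<Sum>r<Suc m. (u r * c r) *s w r) - c m *s (\<Sum>r<Suc m. u r *s w r)"
    unfolding vec.scale_sum_right sum_subtractf[symmetric] by (intro sum.cong refl) (simp add: vec_eq_iff algebra_simps)
  then have "(\<Sum>r<Suc m. (u r * (c r - c m)) *s w r) = 0" by (simp only: 1 Suc.prems(3)) simp
  then have "(\<Sum>r<m. (u r * (c r - c m)) *s w r) = 0" by simp
  then have "\<forall>r<m. u r * (c r - c m) = 0"
    using Suc.prems(1,2) by (intro Suc.IH) (auto simp: inj_on_def)
  moreover have "c r \<noteq> c m" if "r < m" for r using Suc.prems(2) that by (auto simp: inj_on_def)
  ultimately have u: "\<forall>r<m. u r = 0" by auto
  then have "u m *s w m = 0" using Suc.prems(3) by simp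
  then have "u m = 0" using Suc.prems(1)[of m] by simp
  then show ?case using u by (simp add: less_Suc_eq)
qed

lemma eigenvalues_bounded:
  fixes M :: "complex^'n^'n"
  assumes "finite C" "\<And>c. c \<in> C \<Longrightarrow> \<exists>x. x \<noteq> 0 \<and> M *v x = c *s x"
  shows "card C \<le> CARD('n)"
proof -
  obtain c where c: "bij_betw c {..<card C} C"
    using ex_bij_betw_nat_finite[OF assms(1)] by (auto simp: atLeast0LessThan)
  define w where "w r = (SOME x. x \<noteq> 0 \<and> M *v x = c r *s x)" for r
  have w: "w r \<noteq> 0 \<and> M *v w r = c r *s w r" if "r < card C" for r
    unfolding w_def by (rule someI_ex) (use assms(2) c that in \<open>auto simp: bij_betw_def\<close>)
  show ?thesis
    by (rule card_le_of_independent[where w = w], rule eigenvectors_independent[where w = w and M = M and c = c])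
      (use w c in \<open>auto simp: bij_betw_def\<close>)
qed

lemma finite_eigenvalues: "finite {c. \<exists>x. x \<noteq> 0 \<and> M *v x = c *s x}" for M :: "complex^'n^'n"
proof (rule ccontr)
  assume "infinite {c. \<exists>x. x \<noteq> 0 \<and> M *v x = c *s x}"
  then obtain C where "finite C" "card C = Suc CARD('n)" "C \<subseteq> {c. \<exists>x. x \<noteq> 0 \<and> M *v x = c *s x}"
    using infinite_arbitrarily_large by blast
  then show False using eigenvalues_bounded[of C M] by auto
qed

text \<open>This is p(M) v, evaluated by Horner's scheme.\<close>

definition poly_apply :: "complex poly \<Rightarrow> complex^'n^'n \<Rightarrow> complex^'n \<Rightarrow> complex^'n"
  where "poly_apply p M v = fold_coeffs (\<lambda>a x. a *s v + M *v x) p 0"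

lemma poly_apply_0: "poly_apply 0 M v = 0"
  by (simp add: poly_apply_def)

lemma poly_apply_pCons: "poly_apply (pCons a p) M v = a *s v + M *v poly_apply p M v"
  by (cases "p = 0 \<and> a = 0") (auto simp: poly_apply_def)

lemma poly_apply_add: "poly_apply (p + q) M v = poly_apply p M v + poly_apply q M v"
  by (induction p q rule: poly_induct2)
    (simp_all add: poly_apply_0 poly_apply_pCons vec.scale_left_distrib matrix_vector_right_distrib)

lemma poly_apply_smult: "poly_apply (smult c p) M v = c *s poly_apply p M v"
  by (induction p) (simp_all add: poly_apply_0 poly_apply_pCons vec.scale_right_distrib matrix_vector_scale)

lemma poly_apply_sum: "poly_apply (\<Sum>i\<in>I. p i) M v = (\<Sum>i\<in>I. poly_apply (p i) M v)"
  by (induction I rule: infinite_finite_induct) (simp_all add: poly_apply_0 poly_apply_add)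

lemma poly_apply_monom: "poly_apply (monom a i) M v = a *s (((*v) M ^^ i) v)"
  by (induction i) (simp_all add: monom_0 monom_Suc poly_apply_0 poly_apply_pCons matrix_vector_scale)

lemma poly_apply_linear_factor:
  "poly_apply ([:- c, 1:] * q) M v = M *v poly_apply q M v - c *s poly_apply q M v"
proof -
  have "[:- c, 1:] * q = pCons 0 q + smult (- c) q" by simp
  then show ?thesis by (simp only: poly_apply_add poly_apply_smult poly_apply_pCons) simp
qed

lemma poly_apply_in_subspace:
  assumes "vec.subspace U" "\<And>x. x \<in> U \<Longrightarrow> M *v x \<in> U" "v \<in> U"
  shows "poly_apply p M v \<in> U"
  by (induction p)
    (use assms in \<open>auto simp: poly_apply_0 poly_apply_pCons intro!: vec.subspace_0 vec.subspace_add vec.subspace_scale\<close>)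

text \<open>The n + 1 vectors v, M v, ..., M^n v cannot be independent in dimension n.\<close>

lemma annihilating_poly_exists: "\<exists>p. p \<noteq> 0 \<and> poly_apply p M v = 0" for M :: "complex^'n^'n"
proof (rule ccontr)
  assume *: "\<not> ?thesis"
  have "Suc CARD('n) \<le> CARD('n)"
  proof (rule card_le_of_independent[where w = "\<lambda>i. ((*v) M ^^ i) v"])
    fix u assume u: "(\<Sum>r<Suc CARD('n). u r *s ((*v) M ^^ r) v) = 0"
    define p where "p = (\<Sum>r<Suc CARD('n). monom (u r) r)"
    have "poly_apply p M v = 0" using u unfolding p_def poly_apply_sum poly_apply_monom .
    with * have "p = 0" by auto
    moreover have "coeff p r = u r" if "r < Suc CARD('n)" for r
      using that by (simp add: p_def coeff_sum if_distrib del: sum.lessThan_Suc cong: if_cong)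
    ultimately show "\<forall>r<Suc CARD('n). u r = 0" by auto
  qed
  then show False by simp
qed

text \<open>Split a linear factor X - c off an annihilating polynomial of least degree. The cofactor
  applied to v is nonzero by minimality, is killed by M - c, and stays in the invariant
  subspace.\<close>

lemma eigenvector_in_subspace:
  fixes M :: "complex^'n^'n"
  assumes U: "vec.subspace U" "\<And>x. x \<in> U \<Longrightarrow> M *v x \<in> U" and v: "v \<in> U" "v \<noteq> 0"
  shows "\<exists>c x. x \<in> U \<and> x \<noteq> 0 \<and> M *v x = c *s x"
proof -
  obtain p where p: "p \<noteq> 0" "poly_apply p M v = 0"
    and least: "\<And>q. q \<noteq> 0 \<Longrightarrow> poly_apply q M v = 0 \<Longrightarrow> degree p \<le> degree q"
    using exists_least_lemma[of "\<lambda>n. \<exists>p. degree p = n \<and> p \<noteq> 0 \<and> poly_apply p M v = 0"]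
      annihilating_poly_exists[of M v] ex_has_least_nat[of "\<lambda>p. p \<noteq> 0 \<and> poly_apply p M v = 0" _ degree] by metis
  have "degree p \<noteq> 0"
  proof
    assume "degree p = 0"
    then obtain a where a: "p = [:a:]" by (metis degree_eq_zeroE)
    then have "a *s v = 0" using p(2) by (simp add: poly_apply_pCons poly_apply_0)
    then show False using p(1) v a by simp
  qed
  then obtain c where "poly p c = 0"
    using fundamental_theorem_of_algebra[of p] by (auto simp: constant_degree)
  then obtain q where q: "p = [:- c, 1:] * q" by (metis poly_eq_0_iff_dvd dvdE)
  have "q \<noteq> 0" using q p(1) by auto
  then have "degree p = Suc (degree q)" unfolding q by (subst degree_mult_eq) auto
  then have "poly_apply q M v \<noteq> 0" using least[of q] \<open>q \<noteq> 0\<close> by auto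
  moreover have "M *v poly_apply q M v = c *s poly_apply q M v"
    using p(2) unfolding q poly_apply_linear_factor by simp
  ultimately show ?thesis using poly_apply_in_subspace[OF U v(1)] by blast
qed

text \<open>An eigenspace of one operator is invariant under the operators that commute with it, so
  the induction continues inside it.\<close>

lemma common_eigenvector:
  fixes h :: "'i \<Rightarrow> complex^'n^'n"
  assumes comm: "\<And>i j x. i \<in> set L \<Longrightarrow> j \<in> set L \<Longrightarrow> h i *v (h j *v x) = h j *v (h i *v x)"
    and U: "vec.subspace U" "\<And>i x. i \<in> set L \<Longrightarrow> x \<in> U \<Longrightarrow> h i *v x \<in> U" "v \<in> U" "v \<noteq> 0"
  shows "\<exists>c x. x \<in> U \<and> x \<noteq> 0 \<and> (\<forall>i\<in>set L. h i *v x = c i *s x)"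
  using assms
proof (induction L arbitrary: U v)
  case Nil
  then show ?case by auto
next
  case (Cons i L)
  obtain a x where x: "x \<in> U" "x \<noteq> 0" "h i *v x = a *s x"
    using eigenvector_in_subspace[of U "h i" v] Cons.prems by auto
  define U' where "U' = {x \<in> U. h i *v x = a *s x}"
  have "\<exists>c x. x \<in> U' \<and> x \<noteq> 0 \<and> (\<forall>i\<in>set L. h i *v x = c i *s x)"
  proof (rule Cons.IH)
    show "vec.subspace U'"
      unfolding U'_def vec.subspace_def
      using vec.subspace_0 vec.subspace_add vec.subspace_scale Cons.prems(2)
      by (auto simp: matrix_vector_right_distrib matrix_vector_scale vec.scale_right_distrib mult.commute)
    show "h j *v y \<in> U'" if "j \<in> set L" "y \<in> U'" for j y
    proof -
      have "h i *v (h j *v y) = h j *v (h i *v y)" using Cons.prems(1) that by simp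
      then show ?thesis using that Cons.prems(3) by (simp add: U'_def matrix_vector_scale)
    qed
    show "x \<in> U'" using x by (simp add: U'_def)
  qed (use Cons.prems x in auto)
  then obtain c y where y: "y \<in> U'" "y \<noteq> 0" "\<forall>j\<in>set L. h j *v y = c j *s y" by blast
  show ?case
  proof (intro exI conjI)
    show "y \<in> U" "y \<noteq> 0" using y by (auto simp: U'_def)
    show "\<forall>j\<in>set (i # L). h j *v y = (if j = i then a else c j) *s y" using y by (auto simp: U'_def)
  qed
qed

text \<open>With y_k = F^k v one has H y_k = (c - 2 k) y_k and E y_(k+1) = (k + 1) (c - k) y_k. The
  eigenvalues c - 2 k are different, so some y_k vanishes, and at the first vanishing y_(j+1) the
  second formula forces c = j.\<close>

lemma sl2_highest_weight:
  fixes E F H :: "complex^'n^'n"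
  assumes EF: "\<And>x. E *v (F *v x) = F *v (E *v x) + H *v x"
    and HF: "\<And>x. H *v (F *v x) = F *v (H *v x) - 2 *s (F *v x)"
    and v: "v \<noteq> 0" "H *v v = c *s v" "E *v v = 0"
  shows "\<exists>k. c = of_nat k \<and> ((*v) F ^^ Suc k) v = 0"
proof -
  define y where "y k = ((*v) F ^^ k) v" for k
  have y_Suc: "y (Suc k) = F *v y k" for k by (simp add: y_def)
  have H: "H *v y k = (c - 2 * of_nat k) *s y k" for k
  proof (induction k)
    case 0
    then show ?case using v by (simp add: y_def)
  next
    case (Suc k)
    have "H *v y (Suc k) = (c - 2 * of_nat k) *s y (Suc k) - 2 *s y (Suc k)"
      by (simp only: y_Suc HF Suc matrix_vector_scale)
    then show ?case by (simp add: vec_eq_iff algebra_simps)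
  qed
  have E: "E *v y (Suc k) = (of_nat (Suc k) * (c - of_nat k)) *s y k" for k
  proof (induction k)
    case 0
    have "E *v y (Suc 0) = F *v (E *v v) + H *v v" by (simp add: y_def EF)
    then show ?case using v by (simp add: y_def)
  next
    case (Suc k)
    have "E *v y (Suc (Suc k)) = F *v (E *v y (Suc k)) + H *v y (Suc k)" by (simp add: y_Suc EF)
    also have "\<dots> = (of_nat (Suc k) * (c - of_nat k) + (c - 2 * of_nat (Suc k))) *s y (Suc k)"
      by (simp only: Suc H matrix_vector_scale y_Suc[symmetric] vec.scale_left_distrib)
    also have "of_nat (Suc k) * (c - of_nat k) + (c - 2 * of_nat (Suc k)) = of_nat (Suc (Suc k)) * (c - of_nat (Suc k))"
      by (simp add: algebra_simps)
    finally show ?case .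
  qed
  have "\<exists>k. y k = 0"
  proof (rule ccontr)
    assume "\<nexists>k. y k = 0"
    then have "(\<lambda>k. c - 2 * of_nat k) ` (UNIV :: nat set) \<subseteq> {c. \<exists>x. x \<noteq> 0 \<and> H *v x = c *s x}"
      using H by blast
    then have "finite ((\<lambda>k. c - 2 * of_nat k) ` (UNIV :: nat set))"
      using finite_eigenvalues finite_subset by blast
    moreover have "inj (\<lambda>k::nat. c - 2 * of_nat k)" by (auto simp: inj_on_def)
    ultimately show False by (simp add: finite_image_iff)
  qed
  then obtain k where k: "y k = 0" "\<And>j. j < k \<Longrightarrow> y j \<noteq> 0"
    using exists_least_iff[of "\<lambda>k. y k = 0"] by auto
  have "k \<noteq> 0"
  proof
    assume "k = 0"
    then show False using k(1) v(1) by (simp add: y_def)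
  qed
  then obtain j where j: "k = Suc j" by (cases k) auto
  have "(of_nat (Suc j) * (c - of_nat j)) *s y j = 0" using E[of j] k(1) j by simp
  moreover have "y j \<noteq> 0" using k(2)[of j] j by simp
  moreover have "of_nat (Suc j) \<noteq> (0 :: complex)" by (rule of_nat_neq_0)
  ultimately have "c = of_nat j" by (simp del: of_nat_Suc)
  then show ?thesis using k(1) j by (auto simp: y_def)
qed

text \<open>Lists indexed by the nodes 1 to 6 of the diagram carry a dummy entry at position 0.\<close>

definition e6_cartan_rows :: "int list list"
  where "e6_cartan_rows = [[], [0,2,0,-1,0,0,0], [0,0,2,0,-1,0,0], [0,-1,0,2,-1,0,0], [0,0,-1,-1,2,-1,0], [0,0,0,0,-1,2,-1], [0,0,0,0,0,-1,2]]"

definition cartan :: "nat \<Rightarrow> nat \<Rightarrow> int"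
  where "cartan i j = e6_cartan_rows ! i ! j"

lemma e6_cartan_eq: "i \<in> {1..6} \<Longrightarrow> j \<in> {1..6} \<Longrightarrow> e6_cartan i j = cartan i j"
proof -
  assume "i \<in> {1..6}" "j \<in> {1..6}"
  moreover have "{1..6} = {1, 2, 3, 4, 5, 6 :: nat}" by auto
  moreover have "\<forall>i\<in>{1, 2, 3, 4, 5, 6}. \<forall>j\<in>{1, 2, 3, 4, 5, 6}. e6_cartan i j = cartan i j"
    by (simp add: e6_cartan_def e6_adjacent_def cartan_def e6_cartan_rows_def doubleton_eq_iff)
  ultimately show ?thesis by blast
qed

lemma cartan_diag: "i \<in> {1..6} \<Longrightarrow> cartan i i = 2"
  using e6_cartan_eq[of i i] by (simp add: e6_cartan_def)

text \<open>Every \<open>e\<^sub>i\<close> and \<open>f\<^sub>i\<close> shifts the eigenvalue of \<open>\<Sum> t\<^sub>j h\<^sub>j\<close> by three times \<open>s\<^sub>i\<close>. The numbers are so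
  chosen that this one eigenvalue separates all weights that have to be told apart below.\<close>

definition height_coeff :: "nat \<Rightarrow> int" where "height_coeff j = [0, 264, 375, 504, 714, 516, 279] ! j"
definition root_height :: "nat \<Rightarrow> int" where "root_height i = [0, 8, 12, 10, 11, 13, 14] ! i"

definition height :: "(nat \<Rightarrow> int) \<Rightarrow> int"
  where "height \<mu> = (\<Sum>j\<in>{1..6}. height_coeff j * \<mu> j)"

text \<open>The coefficients t_j arise as three times the inverse Cartan matrix applied to the
  numbers \<open>root_height i\<close>; the 3 clears the denominators of that inverse.\<close>

lemma root_height: "i \<in> {1..6} \<Longrightarrow> height (\<lambda>j. e6_cartan j i) = 3 * root_height i"
proof -
  assume i: "i \<in> {1..6}"
  have *: "{1..6} = {1, 2, 3, 4, 5, 6 :: nat}" by auto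
  have "\<forall>i\<in>{1, 2, 3, 4, 5, 6}. height (\<lambda>j. cartan j i) = 3 * root_height i"
    unfolding height_def * by (simp add: height_coeff_def root_height_def cartan_def e6_cartan_rows_def)
  moreover have "height (\<lambda>j. e6_cartan j i) = height (\<lambda>j. cartan j i)"
    unfolding height_def using i by (intro sum.cong refl) (simp add: e6_cartan_eq)
  moreover have "i \<in> {1, 2, 3, 4, 5, 6}" using i unfolding * .
  ultimately show ?thesis by metis
qed

lemma root_height_pos: "i \<in> {1..6} \<Longrightarrow> root_height i > 0"
proof -
  assume "i \<in> {1..6}"
  then have "i \<in> {1, 2, 3, 4, 5, 6}" by auto
  then show ?thesis by (elim insertE emptyE) (simp_all add: root_height_def)
qed

section \<open>Weights in an arbitrary representation\<close>

locale e6_rep =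
  fixes e f h :: "nat \<Rightarrow> complex^'n^'n"
  assumes rep: "e6_representation e f h"
begin

lemma bracket_apply: "lie_bracket A B *v x = A *v (B *v x) - B *v (A *v x)" for A B :: "complex^'n^'n"
  by (simp add: lie_bracket_def matrix_vector_mult_diff_rdistrib matrix_vector_mul_assoc)

lemma scale_apply: "(c *m M) *v x = c *s (M *v x)" for M :: "complex^'n^'n"
  by (simp add: vec_eq_iff scale_matrix_def matrix_vector_mult_def sum_distrib_left mult.assoc)

lemma relations:
  assumes i: "i \<in> {1..6}" and j: "j \<in> {1..6}"
  shows "h i *v (h j *v x) = h j *v (h i *v x)"
    and "e i *v (f j *v x) = f j *v (e i *v x) + (if i = j then h i *v x else 0)"
    and "h i *v (e j *v x) = e j *v (h i *v x) + of_int (e6_cartan i j) *s (e j *v x)"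
    and "h i *v (f j *v x) = f j *v (h i *v x) - of_int (e6_cartan i j) *s (f j *v x)"
    and "i \<noteq> j \<Longrightarrow> e6_cartan i j = 0 \<Longrightarrow> f i *v (f j *v x) = f j *v (f i *v x)"
proof -
  have r: "lie_bracket (h i) (h j) = 0" "lie_bracket (e i) (f j) = (if i = j then h i else 0)"
    "lie_bracket (h i) (e j) = of_int (e6_cartan i j) *m e j"
    "lie_bracket (h i) (f j) = - of_int (e6_cartan i j) *m f j"
    "i \<noteq> j \<Longrightarrow> (lie_bracket (f i) ^^ nat (1 - e6_cartan i j)) (f j) = 0"
    using rep i j unfolding e6_representation_def by blast+
  show "h i *v (h j *v x) = h j *v (h i *v x)"
    using arg_cong[OF r(1), of "\<lambda>M. M *v x"] by (simp add: bracket_apply)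
  show "e i *v (f j *v x) = f j *v (e i *v x) + (if i = j then h i *v x else 0)"
    using arg_cong[OF r(2), of "\<lambda>M. M *v x"] by (auto simp: bracket_apply algebra_simps)
  show "h i *v (e j *v x) = e j *v (h i *v x) + of_int (e6_cartan i j) *s (e j *v x)"
    using arg_cong[OF r(3), of "\<lambda>M. M *v x"] by (simp add: bracket_apply scale_apply algebra_simps)
  show "h i *v (f j *v x) = f j *v (h i *v x) - of_int (e6_cartan i j) *s (f j *v x)"
    using arg_cong[OF r(4), of "\<lambda>M. M *v x"] by (simp add: bracket_apply scale_apply algebra_simps)
  show "f i *v (f j *v x) = f j *v (f i *v x)" if "i \<noteq> j" "e6_cartan i j = 0"
    using arg_cong[OF r(5)[OF that(1)], of "\<lambda>M. M *v x"] that(2) by (simp add: bracket_apply)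
qed

definition weight :: "(nat \<Rightarrow> int) \<Rightarrow> complex^'n \<Rightarrow> bool"
  where "weight \<mu> x \<longleftrightarrow> (\<forall>i\<in>{1..6}. h i *v x = of_int (\<mu> i) *s x)"

lemma weight_f: "weight \<mu> x \<Longrightarrow> i \<in> {1..6} \<Longrightarrow> weight (\<lambda>j. \<mu> j - e6_cartan j i) (f i *v x)"
  by (simp add: weight_def relations matrix_vector_scale vec.scale_left_diff_distrib)

lemma weight_e: "weight \<mu> x \<Longrightarrow> i \<in> {1..6} \<Longrightarrow> weight (\<lambda>j. \<mu> j + e6_cartan j i) (e i *v x)"
  by (simp add: weight_def relations matrix_vector_scale vec.scale_left_distrib)

lemma e6_cartan_diag: "e6_cartan i i = 2"
  by (simp add: e6_cartan_def)

lemma highest_weight_natural: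
  assumes "i \<in> {1..6}" "v \<noteq> 0" "h i *v v = c *s v" "e i *v v = 0"
  shows "\<exists>k. c = of_nat k \<and> ((*v) (f i) ^^ Suc k) v = 0"
proof (rule sl2_highest_weight[OF _ _ assms(2-4)])
  show "e i *v (f i *v x) = f i *v (e i *v x) + h i *v x" for x
    using assms(1) by (simp add: relations(2))
  show "h i *v (f i *v x) = f i *v (h i *v x) - 2 *s (f i *v x)" for x
    using assms(1) by (simp add: relations(4) e6_cartan_diag)
qed

text \<open>With \<open>e i\<close> and \<open>f i\<close> exchanged and \<open>h i\<close> negated,
  a vector killed by \<open>f i\<close> becomes a highest weight vector, so its weight at i would be
  at most zero.\<close>

lemma f_nonzero:
  assumes i: "i \<in> {1..6}" and x: "x \<noteq> 0" "weight \<mu> x" and pos: "\<mu> i > 0"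
  shows "f i *v x \<noteq> 0"
proof
  assume 0: "f i *v x = 0"
  have minus: "(- A) *v y = - (A *v y)" for A :: "complex^'n^'n" and y
    by (simp add: vec_eq_iff matrix_vector_mult_def sum_negf)
  have "\<exists>k. - complex_of_int (\<mu> i) = of_nat k \<and> ((*v) (e i) ^^ Suc k) x = 0"
  proof (rule sl2_highest_weight[where E = "f i" and F = "e i" and H = "- h i"])
    show "f i *v (e i *v y) = e i *v (f i *v y) + (- h i) *v y" for y
      using relations(2)[OF i i, of y] by (simp add: minus)
    show "(- h i) *v (e i *v y) = e i *v ((- h i) *v y) - 2 *s (e i *v y)" for y
      using relations(3)[OF i i, of y] by (simp add: minus e6_cartan_diag matrix_vector_mult_minus)
    show "(- h i) *v x = - of_int (\<mu> i) *s x"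
      using x(2) i by (simp add: minus weight_def)
  qed (use x 0 in auto)
  then obtain k where "- complex_of_int (\<mu> i) = of_nat k" by blast
  then have "complex_of_int (- \<mu> i) = of_int (int k)" by simp
  then have "- \<mu> i = int k" by (simp only: of_int_eq_iff)
  then show False using pos by simp
qed

definition height_op :: "complex^'n^'n"
  where "height_op = (\<Sum>j\<in>{1..6}. of_int (height_coeff j) *m h j)"

lemma height_op_apply: "height_op *v x = (\<Sum>j\<in>{1..6}. of_int (height_coeff j) *s (h j *v x))"
proof -
  have "(\<Sum>j\<in>I. M j) *v x = (\<Sum>j\<in>I. M j *v x)" for I and M :: "nat \<Rightarrow> complex^'n^'n"
    by (induction I rule: infinite_finite_induct) (simp_all add: matrix_vector_mult_add_rdistrib)
  then show ?thesis by (simp add: height_op_def scale_apply)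
qed

lemma height_op_weight: "weight \<mu> x \<Longrightarrow> height_op *v x = of_int (height \<mu>) *s x"
  by (simp add: height_op_apply weight_def height_def vec.scale_sum_left)

text \<open>Among the common eigenvectors of the \<open>h i\<close> take one whose height eigenvalue
  has maximal real part: every \<open>e i\<close> would raise the height by a positive integer.
  Integrality of the weight is not known beforehand; it follows from the sl2 argument, which also
  gives the vanishing under \<open>f i\<close>.\<close>

lemma highest_weight_vector:
  obtains v \<nu> where "v \<noteq> 0" "weight \<nu> v" "\<And>i. i \<in> {1..6} \<Longrightarrow> e i *v v = 0"
    "\<And>i. i \<in> {1..6} \<Longrightarrow> 0 \<le> \<nu> i" "\<And>i. i \<in> {1..6} \<Longrightarrow> \<nu> i = 0 \<Longrightarrow> f i *v v = 0"
proof -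
  define joint where "joint c x \<longleftrightarrow> x \<noteq> 0 \<and> (\<forall>i\<in>{1..6}. h i *v x = c i *s x)" for c x
  define ht where "ht c = (\<Sum>j\<in>{1..6}. of_int (height_coeff j) * c j)" for c :: "nat \<Rightarrow> complex"
  have ht: "height_op *v x = ht c *s x" if "joint c x" for c x
    using that by (simp add: joint_def ht_def height_op_apply vec.scale_sum_left)
  have "(1 :: complex^'n) \<noteq> 0" by (simp add: vec_eq_iff)
  then have "\<exists>c x. x \<in> UNIV \<and> x \<noteq> 0 \<and> (\<forall>i\<in>set [1..<7]. h i *v x = c i *s x)"
    by (intro common_eigenvector[of "[1..<7]" h UNIV 1]) (auto intro!: relations(1))
  moreover have "set [1..<7] = {1..6}" by auto
  ultimately have ex: "\<exists>c x. joint c x" by (auto simp: joint_def)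
  \<comment> \<open>The heights of joint eigenvectors are eigenvalues of one matrix, hence finite in
    number, and a maximum exists.\<close>
  define Z where "Z = {ht c | c x. joint c x}"
  have "finite Z"
    by (rule finite_subset[OF _ finite_eigenvalues[of height_op]]) (use ht in \<open>auto simp: Z_def joint_def\<close>)
  moreover have "Z \<noteq> {}" using ex by (auto simp: Z_def)
  ultimately have "Max (Re ` Z) \<in> Re ` Z" "\<forall>z'\<in>Z. Re z' \<le> Max (Re ` Z)" by simp_all
  then obtain z where z: "z \<in> Z" "\<And>z'. z' \<in> Z \<Longrightarrow> Re z' \<le> Re z" by force
  then obtain c v where v: "joint c v" "z = ht c" by (auto simp: Z_def)
  have e0: "e i *v v = 0" if i: "i \<in> {1..6}" for i
  proof (rule ccontr)
    assume "e i *v v \<noteq> 0"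
    then have "joint (\<lambda>j. c j + of_int (e6_cartan j i)) (e i *v v)"
      using v(1) i by (simp add: joint_def relations(3) matrix_vector_scale vec.scale_left_distrib)
    then have "ht (\<lambda>j. c j + of_int (e6_cartan j i)) \<in> Z" by (auto simp: Z_def)
    moreover have "ht (\<lambda>j. c j + of_int (e6_cartan j i)) = z + of_int (height (\<lambda>j. e6_cartan j i))"
      by (simp add: ht_def v(2) height_def distrib_left sum.distrib)
    ultimately have "of_int (height (\<lambda>j. e6_cartan j i)) \<le> (0::real)" using z(2) by fastforce
    then show False using root_height[OF i] root_height_pos[OF i] by simp
  qed
  have "\<forall>i\<in>{1..6}. \<exists>k. c i = of_nat k \<and> ((*v) (f i) ^^ Suc k) v = 0"
    using highest_weight_natural v(1) e0 by (auto simp: joint_def)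
  then obtain k where k: "\<And>i. i \<in> {1..6} \<Longrightarrow> c i = of_nat (k i) \<and> ((*v) (f i) ^^ Suc (k i)) v = 0"
    by metis
  show thesis
  proof (rule that[of v "\<lambda>i. int (k i)"])
    show "weight (\<lambda>i. int (k i)) v" using v(1) k by (simp add: weight_def joint_def)
    show "f i *v v = 0" if "i \<in> {1..6}" "int (k i) = 0" for i using k[OF that(1)] that(2) by simp
  qed (use v(1) e0 in \<open>auto simp: joint_def\<close>)
qed

definition word_apply :: "nat list \<Rightarrow> complex^'n \<Rightarrow> complex^'n"
  where "word_apply w x = foldr (\<lambda>i. (*v) (f i)) w x"

lemma word_apply_simps: "word_apply [] x = x" "word_apply (i # w) x = f i *v word_apply w x"
  by (simp_all add: word_apply_def)

end

definition word_height :: "nat list \<Rightarrow> int"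
  where "word_height w = (\<Sum>i\<leftarrow>w. root_height i)"

text \<open>The rightmost letter acts first. Each letter i must meet a weight that is still positive
  at i when the start is \<open>l\<close>; for a larger start this holds all the more, so
  \<open>f_nonzero\<close> applies at every letter.\<close>

fun valid_word :: "int list \<Rightarrow> nat list \<Rightarrow> bool" where
  "valid_word l [] = True"
| "valid_word l (i # w) = (1 \<le> i \<and> i \<le> 6 \<and> valid_word l w \<and> l ! i > (\<Sum>j\<leftarrow>w. cartan i j))"

text \<open>Each pair \<open>(l, words)\<close> lists 28 words leading from a highest weight above \<open>l\<close> to different weights.
  The dominant weights that lie above none of these \<open>l\<close> are zero and the two minuscule ones.\<close>

definition excluding_words :: "(int list \<times> nat list list) list"
  where "excluding_words =
    [([0,0,1,0,0,0,0],
      [[],[2],[4,2],[3,4,2],[5,4,2],[1,3,4,2],[5,3,4,2],[6,5,4,2],[5,1,3,4,2],[4,5,3,4,2],[6,5,3,4,2],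
      [4,5,1,3,4,2],[6,5,1,3,4,2],[2,4,5,3,4,2],[6,4,5,3,4,2],[2,4,5,1,3,4,2],[3,4,5,1,3,4,2],[6,4,5,1,3,4,2],
      [6,2,4,5,3,4,2],[5,6,4,5,3,4,2],[3,2,4,5,1,3,4,2],[6,2,4,5,1,3,4,2],[6,3,4,5,1,3,4,2],[5,6,4,5,1,3,4,2],
      [5,6,2,4,5,3,4,2],[4,3,2,4,5,1,3,4,2],[6,3,2,4,5,1,3,4,2],[5,6,2,4,5,1,3,4,2]]),
    ([0,0,0,1,0,0,0],
      [[],[3],[1,3],[4,3],[4,1,3],[2,4,3],[5,4,3],[2,4,1,3],[3,4,1,3],[5,4,1,3],[5,2,4,3],[6,5,4,3],
      [3,2,4,1,3],[5,2,4,1,3],[5,3,4,1,3],[6,5,4,1,3],[4,5,2,4,3],[6,5,2,4,3],[4,3,2,4,1,3],[5,3,2,4,1,3],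
      [4,5,2,4,1,3],[6,5,2,4,1,3],[4,5,3,4,1,3],[6,5,3,4,1,3],[3,4,5,2,4,3],[6,4,5,2,4,3],[5,4,3,2,4,1,3],
      [6,5,3,2,4,1,3]]),
    ([0,0,0,0,1,0,0],
      [[],[4],[2,4],[3,4],[5,4],[3,2,4],[5,2,4],[1,3,4],[5,3,4],[6,5,4],[1,3,2,4],[4,3,2,4],[5,3,2,4],
      [4,5,2,4],[6,5,2,4],[5,1,3,4],[4,5,3,4],[6,5,3,4],[4,1,3,2,4],[5,1,3,2,4],[5,4,3,2,4],[6,5,3,2,4],
      [6,4,5,2,4],[4,5,1,3,4],[6,5,1,3,4],[6,4,5,3,4],[3,4,1,3,2,4],[5,4,1,3,2,4]]),
    ([0,0,0,0,0,1,0],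
      [[],[5],[4,5],[6,5],[2,4,5],[3,4,5],[6,4,5],[3,2,4,5],[6,2,4,5],[1,3,4,5],[6,3,4,5],[5,6,4,5],
      [1,3,2,4,5],[4,3,2,4,5],[6,3,2,4,5],[5,6,2,4,5],[6,1,3,4,5],[5,6,3,4,5],[4,1,3,2,4,5],[6,1,3,2,4,5],
      [5,4,3,2,4,5],[6,4,3,2,4,5],[5,6,3,2,4,5],[4,5,6,2,4,5],[5,6,1,3,4,5],[4,5,6,3,4,5],[3,4,1,3,2,4,5],
      [5,4,1,3,2,4,5]]),
    ([0,2,0,0,0,0,0],
      [[],[1],[3,1],[1,3,1],[4,3,1],[4,1,3,1],[2,4,3,1],[5,4,3,1],[2,4,1,3,1],[3,4,1,3,1],[5,4,1,3,1],
      [5,2,4,3,1],[6,5,4,3,1],[3,2,4,1,3,1],[5,2,4,1,3,1],[5,3,4,1,3,1],[6,5,4,1,3,1],[4,5,2,4,3,1],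
      [6,5,2,4,3,1],[4,3,2,4,1,3,1],[5,3,2,4,1,3,1],[4,5,2,4,1,3,1],[6,5,2,4,1,3,1],[4,5,3,4,1,3,1],
      [6,5,3,4,1,3,1],[3,4,5,2,4,3,1],[6,4,5,2,4,3,1],[5,4,3,2,4,1,3,1]]),
    ([0,1,0,0,0,0,1],
      [[],[1],[6],[3,1],[6,1],[5,6],[4,3,1],[6,3,1],[5,6,1],[4,5,6],[2,4,3,1],[5,4,3,1],[6,4,3,1],[5,6,3,1],
      [4,5,6,1],[2,4,5,6],[3,4,5,6],[5,2,4,3,1],[6,2,4,3,1],[6,5,4,3,1],[2,4,5,6,1],[3,2,4,5,6],[4,5,2,4,3,1],
      [6,5,2,4,3,1],[4,3,2,4,5,6],[3,4,5,2,4,3,1],[6,4,5,2,4,3,1],[5,4,3,2,4,5,6]]),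
    ([0,0,0,0,0,0,2],
      [[],[6],[5,6],[4,5,6],[6,5,6],[2,4,5,6],[3,4,5,6],[6,4,5,6],[3,2,4,5,6],[6,2,4,5,6],[1,3,4,5,6],
      [6,3,4,5,6],[5,6,4,5,6],[1,3,2,4,5,6],[4,3,2,4,5,6],[6,3,2,4,5,6],[5,6,2,4,5,6],[6,1,3,4,5,6],
      [5,6,3,4,5,6],[4,1,3,2,4,5,6],[6,1,3,2,4,5,6],[5,4,3,2,4,5,6],[6,4,3,2,4,5,6],[5,6,3,2,4,5,6],
      [4,5,6,2,4,5,6],[5,6,1,3,4,5,6],[4,5,6,3,4,5,6],[3,4,1,3,2,4,5,6]])]"

lemma excluding_words:
  "list_all (\<lambda>(l, words). length words = 28 \<and> list_all (valid_word l) words \<and> distinct (map word_height words))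
    excluding_words"
  by code_simp

lemma valid_word_letters: "valid_word l w \<Longrightarrow> set w \<subseteq> {1..6}"
  by (induction w) auto

context e6_rep
begin

lemma weight_word:
  assumes "weight \<nu> v" "set w \<subseteq> {1..6}"
  shows "weight (\<lambda>j. \<nu> j - (\<Sum>i\<leftarrow>w. e6_cartan j i)) (word_apply w v)"
  using assms(2)
proof (induction w)
  case Nil
  then show ?case using assms(1) by (simp add: word_apply_simps)
next
  case (Cons i w)
  then have "weight (\<lambda>j. (\<nu> j - (\<Sum>i\<leftarrow>w. e6_cartan j i)) - e6_cartan j i) (f i *v word_apply w v)"
    by (intro weight_f) auto
  then show ?case by (simp add: word_apply_simps algebra_simps)
qed

lemma height_word:
  assumes "set w \<subseteq> {1..6}"
  shows "height (\<lambda>j. \<nu> j - (\<Sum>i\<leftarrow>w. e6_cartan j i)) = height \<nu> - 3 * word_height w"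
  using assms
proof (induction w)
  case Nil
  then show ?case by (simp add: word_height_def)
next
  case (Cons i w)
  have "height (\<lambda>j. \<nu> j - (\<Sum>i\<leftarrow>i # w. e6_cartan j i))
      = height (\<lambda>j. \<nu> j - (\<Sum>i\<leftarrow>w. e6_cartan j i)) - height (\<lambda>j. e6_cartan j i)"
    by (simp add: height_def algebra_simps sum_subtractf sum.distrib)
  then show ?case using Cons root_height[of i] by (simp add: word_height_def)
qed

lemma word_nonzero:
  assumes v: "weight \<nu> v" "v \<noteq> 0" and l: "\<And>i. i \<in> {1..6} \<Longrightarrow> l ! i \<le> \<nu> i" and w: "valid_word l w"
  shows "word_apply w v \<noteq> 0"
  using w
proof (induction w)
  case Nil
  then show ?case using v by (simp add: word_apply_simps)
next
  case (Cons i w)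
  have i: "i \<in> {1..6}" and w: "set w \<subseteq> {1..6}" using valid_word_letters[OF Cons.prems] by auto
  have "(\<Sum>j\<leftarrow>w. e6_cartan i j) = (\<Sum>j\<leftarrow>w. cartan i j)"
    using w i by (intro arg_cong[where f = sum_list] map_cong) (auto simp: e6_cartan_eq)
  then have "\<nu> i - (\<Sum>j\<leftarrow>w. e6_cartan i j) > 0"
    using l[OF i] Cons.prems by simp
  then show ?case
    using f_nonzero[OF i _ weight_word[OF v(1) w]] Cons by (simp add: word_apply_simps)
qed

text \<open>Different word heights give different eigenvalues of \<open>height_op\<close>, each
  attained by a nonzero vector, and there cannot be more of them than the dimension.\<close>

lemma too_many_weights:
  assumes v: "weight \<nu> v" "v \<noteq> 0" and l: "\<And>i. i \<in> {1..6} \<Longrightarrow> l ! i \<le> \<nu> i"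
    and card: "CARD('n) < length words" and valid: "list_all (valid_word l) words"
    and distinct: "distinct (map word_height words)"
  shows False
proof -
  let ?C = "(\<lambda>w. of_int (height \<nu> - 3 * word_height w) :: complex) ` set words"
  have "inj_on word_height (set words)" "distinct words" using distinct by (simp_all add: distinct_map)
  then have "inj_on (\<lambda>w. of_int (height \<nu> - 3 * word_height w) :: complex) (set words)"
    by (simp only: inj_on_def of_int_eq_iff) simp
  then have "card ?C = length words"
    using \<open>distinct words\<close> by (simp add: card_image distinct_card)
  moreover have "card ?C \<le> CARD('n)"
  proof (rule eigenvalues_bounded[of _ height_op])
    fix c assume "c \<in> ?C"
    then obtain w where w: "w \<in> set words" "c = of_int (height \<nu> - 3 * word_height w)" by auto
    then have "valid_word l w" using valid by (simp add: list_all_iff)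
    then show "\<exists>x. x \<noteq> 0 \<and> height_op *v x = c *s x"
      using word_nonzero[OF v l] height_op_weight[OF weight_word[OF v(1)]] height_word valid_word_letters w(2) by metis
  qed simp
  ultimately show False using card by simp
qed

lemma excluded_weight:
  assumes "(l, words) \<in> set excluding_words"
    and "weight \<nu> v" "v \<noteq> 0" "\<And>i. i \<in> {1..6} \<Longrightarrow> l ! i \<le> \<nu> i" "CARD('n) = 27"
  shows False
  using too_many_weights[OF assms(2-4), of words] excluding_words assms(1,5) by (auto simp: list_all_iff)

end

section \<open>The minuscule representations\<close>

text \<open>One word for each weight; the tail of every nonempty word is again in the list, so the
  words form a spanning tree of the crystal.\<close>

definition minuscule_words :: "nat list list"
  where "minuscule_words =
    [[],[1],[3,1],[4,3,1],[2,4,3,1],[5,4,3,1],[5,2,4,3,1],[6,5,4,3,1],[4,5,2,4,3,1],[6,5,2,4,3,1],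
      [3,4,5,2,4,3,1],[6,4,5,2,4,3,1],[1,3,4,5,2,4,3,1],[6,3,4,5,2,4,3,1],[5,6,4,5,2,4,3,1],
      [6,1,3,4,5,2,4,3,1],[5,6,3,4,5,2,4,3,1],[5,6,1,3,4,5,2,4,3,1],[4,5,6,3,4,5,2,4,3,1],
      [4,5,6,1,3,4,5,2,4,3,1],[2,4,5,6,3,4,5,2,4,3,1],[2,4,5,6,1,3,4,5,2,4,3,1],[3,4,5,6,1,3,4,5,2,4,3,1],
      [3,2,4,5,6,1,3,4,5,2,4,3,1],[4,3,2,4,5,6,1,3,4,5,2,4,3,1],[5,4,3,2,4,5,6,1,3,4,5,2,4,3,1],
      [6,5,4,3,2,4,5,6,1,3,4,5,2,4,3,1]]"

abbreviation omega1 :: "int list" where "omega1 \<equiv> [0, 1, 0, 0, 0, 0, 0]"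

lemma set_1_6: "set [1..<7] = {1..6 :: nat}"
  by auto

lemma minuscule_words:
  "length minuscule_words = 27" "list_all (valid_word omega1) minuscule_words" "distinct (map word_height minuscule_words)"
  by code_simp+

text \<open>Where the crystal has no edge, the height that the image would have is not one of the 27
  heights. By \<open>height_in_minuscule\<close> the image must then be zero.\<close>

lemma minuscule_no_edge:
  "list_all (\<lambda>i. list_all (\<lambda>r.
      (r \<in> set (map fst (e6_edges i)) \<or> root_height i + word_height (minuscule_words ! r) \<notin> set (map word_height minuscule_words))
    \<and> (r \<in> set (map snd (e6_edges i)) \<or> word_height (minuscule_words ! r) - root_height i \<notin> set (map word_height minuscule_words)))
    [0..<27]) [1..<7]"
  by code_simp

lemma minuscule_heights:
  assumes "i \<in> {1..6}" "r < 27"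
  shows "r \<in> fst ` set (e6_edges i) \<or> root_height i + word_height (minuscule_words ! r) \<notin> set (map word_height minuscule_words)" (is ?A)
    and "r \<in> snd ` set (e6_edges i) \<or> word_height (minuscule_words ! r) - root_height i \<notin> set (map word_height minuscule_words)" (is ?B)
proof -
  have "r \<in> set [0..<27]" using assms(2) by simp
  then show ?A ?B
    using minuscule_no_edge assms(1) unfolding list_all_iff set_1_6 set_map[of fst] set_map[of snd] by blast+
qed

text \<open>An edge that does not belong to the tree of words is one side of a square whose other sides come earlier.\<close>

lemma minuscule_edge:
  "list_all (\<lambda>i. list_all (\<lambda>(r, r'). minuscule_words ! r' = i # minuscule_words ! r
      \<or> list_ex (\<lambda>j. cartan i j = 0 \<and> list_ex (\<lambda>(q, p). q < r \<and> (q, r) \<in> set (e6_edges j)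
          \<and> minuscule_words ! r' = j # minuscule_words ! p) (e6_edges i)) [1..<7]) (e6_edges i)) [1..<7]"
  by code_simp

text \<open>At the source of an edge \<open>h i\<close> acts as 1 and \<open>e i\<close> as 0, which
  determines \<open>e i\<close> on the target; see \<open>basis_e_edge\<close>.\<close>

lemma minuscule_edge_weight:
  "list_all (\<lambda>i. list_all (\<lambda>(r, r'). omega1 ! i - (\<Sum>j\<leftarrow>minuscule_words ! r. cartan i j) = 1
      \<and> r \<notin> set (map snd (e6_edges i))) (e6_edges i)) [1..<7]"
  by code_simp

context e6_rep
begin

context
  fixes v \<nu>
  assumes card: "CARD('n) = 27" and v: "v \<noteq> 0" "weight \<nu> v" and ev: "\<And>i. i \<in> {1..6} \<Longrightarrow> e i *v v = 0"
    and omega1: "\<And>i. i \<in> {1..6} \<Longrightarrow> \<nu> i = omega1 ! i"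
begin

definition basis_vector :: "nat \<Rightarrow> complex^'n"
  where "basis_vector r = word_apply (minuscule_words ! r) v"

lemma basis_word: "r < 27 \<Longrightarrow> valid_word omega1 (minuscule_words ! r)"
  using minuscule_words by (simp add: list_all_length)

lemma basis_letters: "r < 27 \<Longrightarrow> set (minuscule_words ! r) \<subseteq> {1..6}"
  using basis_word valid_word_letters by blast

lemma basis_nonzero: "r < 27 \<Longrightarrow> basis_vector r \<noteq> 0"
  unfolding basis_vector_def by (rule word_nonzero[OF v(2,1), of omega1]) (use basis_word omega1 in auto)

lemma basis_weight: "r < 27 \<Longrightarrow> weight (\<lambda>j. \<nu> j - (\<Sum>i\<leftarrow>minuscule_words ! r. e6_cartan j i)) (basis_vector r)"
  unfolding basis_vector_def by (rule weight_word[OF v(2) basis_letters])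

lemma basis_height_op:
  "r < 27 \<Longrightarrow> height_op *v basis_vector r = of_int (height \<nu> - 3 * word_height (minuscule_words ! r)) *s basis_vector r"
  using height_op_weight[OF basis_weight] height_word[OF basis_letters] by simp

lemma basis_independent: "(\<Sum>r<27. u r *s basis_vector r) = 0 \<Longrightarrow> \<forall>r<27. u r = 0"
proof (rule eigenvectors_independent[where w = basis_vector and M = height_op
      and c = "\<lambda>r. of_int (height \<nu> - 3 * word_height (minuscule_words ! r))"])
  have "inj_on (\<lambda>r. word_height (minuscule_words ! r)) {..<27}"
    using minuscule_words(1,3) nth_eq_iff_index_eq[OF minuscule_words(3)] by (auto simp: inj_on_def)
  then show "inj_on (\<lambda>r. complex_of_int (height \<nu> - 3 * word_height (minuscule_words ! r))) {..<27}"
    unfolding inj_on_def of_int_eq_iff by simp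
qed (use basis_nonzero basis_height_op in auto)

text \<open>The 27 words already provide 27 different eigenvalues of \<open>height_op\<close> in
  dimension 27; any further height of a weight vector would be the 28th.\<close>

lemma height_in_minuscule:
  assumes x: "x \<noteq> 0" "weight \<mu> x" "height \<mu> = height \<nu> - 3 * z"
  shows "z \<in> set (map word_height minuscule_words)"
proof (rule ccontr)
  assume z: "z \<notin> set (map word_height minuscule_words)"
  let ?Z = "insert z (set (map word_height minuscule_words))"
  let ?C = "(\<lambda>z. complex_of_int (height \<nu> - 3 * z)) ` ?Z"
  have "card (set (map word_height minuscule_words)) = 27"
    using minuscule_words distinct_card[OF minuscule_words(3)] by simp
  then have "card ?Z = 28" using z by simp
  moreover have "inj_on (\<lambda>z. complex_of_int (height \<nu> - 3 * z)) ?Z"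
    unfolding inj_on_def of_int_eq_iff by simp
  ultimately have "card ?C = 28" by (simp only: card_image)
  moreover have "card ?C \<le> CARD('n)"
  proof (rule eigenvalues_bounded[of _ height_op])
    fix c assume "c \<in> ?C"
    then consider "c = of_int (height \<nu> - 3 * z)"
      | w where "w \<in> set minuscule_words" "c = of_int (height \<nu> - 3 * word_height w)" by auto
    then show "\<exists>x. x \<noteq> 0 \<and> height_op *v x = c *s x"
    proof cases
      case 1
      then show ?thesis using x height_op_weight[OF x(2)] by auto
    next
      case 2
      then obtain r where "r < 27" "w = minuscule_words ! r" using minuscule_words(1) by (metis in_set_conv_nth)
      then show ?thesis using 2 basis_nonzero basis_height_op by blast
    qed
  qed simp
  ultimately show False using card by simp
qed

lemma basis_f_zero:
  assumes i: "i \<in> {1..6}" and r: "r < 27" "r \<notin> fst ` set (e6_edges i)"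
  shows "f i *v basis_vector r = 0"
proof (rule ccontr)
  assume "f i *v basis_vector r \<noteq> 0"
  moreover have "f i *v basis_vector r = word_apply (i # minuscule_words ! r) v"
    by (simp add: basis_vector_def word_apply_simps)
  ultimately have "word_height (i # minuscule_words ! r) \<in> set (map word_height minuscule_words)"
    using height_in_minuscule[OF _ weight_word[OF v(2)] height_word] basis_letters[OF r(1)] i by simp
  then show False
    using minuscule_heights(1)[OF i r(1)] r(2) by (simp add: word_height_def)
qed

lemma basis_e_zero:
  assumes i: "i \<in> {1..6}" and r: "r < 27" "r \<notin> snd ` set (e6_edges i)"
  shows "e i *v basis_vector r = 0"
proof (rule ccontr)
  assume *: "e i *v basis_vector r \<noteq> 0"
  let ?\<mu> = "\<lambda>j. \<nu> j - (\<Sum>i\<leftarrow>minuscule_words ! r. e6_cartan j i)"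
  have "height (\<lambda>j. ?\<mu> j + e6_cartan j i) = height ?\<mu> + height (\<lambda>j. e6_cartan j i)"
    by (simp add: height_def distrib_left sum.distrib)
  then have "height (\<lambda>j. ?\<mu> j + e6_cartan j i) = height \<nu> - 3 * (word_height (minuscule_words ! r) - root_height i)"
    using height_word[OF basis_letters[OF r(1)]] root_height[OF i] by simp
  then have "word_height (minuscule_words ! r) - root_height i \<in> set (map word_height minuscule_words)"
    by (rule height_in_minuscule[OF * weight_e[OF basis_weight[OF r(1)] i]])
  then show False
    using minuscule_heights(2)[OF i r(1)] r(2) by blast
qed

text \<open>Induction on the number of the source. Tree edges hold by definition. On a square,
  \<open>f i\<close> and \<open>f j\<close> commute because the nodes are not joined, and the two
  edges to which the induction hypothesis applies both start at the smaller number
  \<open>q\<close>.\<close>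

lemma basis_f_edge:
  "i \<in> {1..6} \<Longrightarrow> (r, r') \<in> set (e6_edges i) \<Longrightarrow> f i *v basis_vector r = basis_vector r'"
proof (induction r arbitrary: i r' rule: less_induct)
  case (less r)
  have "minuscule_words ! r' = i # minuscule_words ! r
      \<or> (\<exists>j\<in>{1..6}. cartan i j = 0 \<and> (\<exists>(q, p)\<in>set (e6_edges i). q < r \<and> (q, r) \<in> set (e6_edges j)
          \<and> minuscule_words ! r' = j # minuscule_words ! p))"
    using minuscule_edge less.prems unfolding list_all_iff list_ex_iff set_1_6 by blast
  then show ?case
  proof (elim disjE bexE conjE)
    assume "minuscule_words ! r' = i # minuscule_words ! r"
    then show ?thesis by (simp add: basis_vector_def word_apply_simps)
  next
    fix j qp
    assume j: "j \<in> {1..6}" "cartan i j = 0" and qp: "qp \<in> set (e6_edges i)"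
      and "case qp of (q, p) \<Rightarrow> q < r \<and> (q, r) \<in> set (e6_edges j) \<and> minuscule_words ! r' = j # minuscule_words ! p"
    then obtain q p where q: "(q, p) \<in> set (e6_edges i)" "q < r" "(q, r) \<in> set (e6_edges j)"
      "minuscule_words ! r' = j # minuscule_words ! p" by (cases qp) auto
    have "i \<noteq> j" using j cartan_diag[OF less.prems(1)] by auto
    have "f i *v basis_vector r = f i *v (f j *v basis_vector q)"
      using less.IH[OF q(2) j(1) q(3)] by simp
    also have "\<dots> = f j *v (f i *v basis_vector q)"
      using relations(5)[OF less.prems(1) j(1) \<open>i \<noteq> j\<close>] e6_cartan_eq[OF less.prems(1) j(1)] j(2) by simp
    also have "\<dots> = f j *v basis_vector p"
      using less.IH[OF q(2) less.prems(1) q(1)] by simp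
    also have "\<dots> = basis_vector r'" by (simp add: basis_vector_def q(4) word_apply_simps)
    finally show ?thesis .
  qed
qed

text \<open>The target is \<open>f i\<close> applied to the source w, and e_i f_i w = f_i e_i w +
  h_i w = w.\<close>

lemma basis_e_edge:
  assumes i: "i \<in> {1..6}" and edge: "(r, r') \<in> set (e6_edges i)"
  shows "e i *v basis_vector r' = basis_vector r"
proof -
  have r: "r < 27" using e6_edges_bound[OF i edge] by simp
  have weight1: "omega1 ! i - (\<Sum>j\<leftarrow>minuscule_words ! r. cartan i j) = 1" "r \<notin> set (map snd (e6_edges i))"
    using minuscule_edge_weight edge i unfolding list_all_iff set_1_6 by blast+
  have "(\<Sum>j\<leftarrow>minuscule_words ! r. e6_cartan i j) = (\<Sum>j\<leftarrow>minuscule_words ! r. cartan i j)"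
    using basis_letters[OF r] i by (intro arg_cong[where f = sum_list] map_cong) (auto simp: e6_cartan_eq)
  then have "\<nu> i - (\<Sum>j\<leftarrow>minuscule_words ! r. e6_cartan i j) = 1"
    using weight1(1) omega1[OF i] by (simp only:)
  moreover have "h i *v basis_vector r = of_int (\<nu> i - (\<Sum>j\<leftarrow>minuscule_words ! r. e6_cartan i j)) *s basis_vector r"
    using basis_weight[OF r] i unfolding weight_def by blast
  ultimately have "h i *v basis_vector r = basis_vector r" by simp
  moreover have "r \<notin> snd ` set (e6_edges i)"
    using weight1(2) by simp
  ultimately show ?thesis
    using relations(2)[OF i i, of "basis_vector r"] basis_e_zero[OF i r] basis_f_edge[OF i edge] by simp
qed

lemma springer_pair_omega1:
  assumes "cubic_invariants (e6_generated e f h) d D"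
  shows "springer_tensors d D"
proof (rule springer_pair_minuscule[OF card, where w = basis_vector])
  show "lie_bracket (e i) (f i) = h i" if "i \<in> {1..6}" for i
    using rep that by (simp add: e6_representation_def)
qed (use assms basis_independent basis_f_edge basis_e_edge basis_f_zero basis_e_zero in auto)

end

end

text \<open>The diagram automorphism, exchanging 1 with 6 and 3 with 5. Renumbering the generators
  by it keeps the generated Lie algebra and turns the second minuscule highest weight into the
  first.\<close>

definition e6_flip :: "nat \<Rightarrow> nat"
  where "e6_flip i = [0, 6, 2, 5, 4, 3, 1] ! i"

lemma e6_flip_image: "e6_flip ` {1..6} = {1..6}"
proof -
  have "{1..6} = {1, 2, 3, 4, 5, 6 :: nat}" by auto
  then show ?thesis by (auto simp: e6_flip_def)
qed

lemma e6_flip_in: "i \<in> {1..6} \<Longrightarrow> e6_flip i \<in> {1..6}"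
  using e6_flip_image by blast

lemma e6_flip_cartan: "i \<in> {1..6} \<Longrightarrow> j \<in> {1..6} \<Longrightarrow> e6_cartan (e6_flip i) (e6_flip j) = e6_cartan i j"
proof -
  assume ij: "i \<in> {1..6}" "j \<in> {1..6}"
  have "\<forall>i\<in>{1, 2, 3, 4, 5, 6}. \<forall>j\<in>{1, 2, 3, 4, 5, 6}. cartan (e6_flip i) (e6_flip j) = cartan i j"
    by (simp add: e6_flip_def cartan_def e6_cartan_rows_def)
  moreover have "i \<in> {1, 2, 3, 4, 5, 6}" "j \<in> {1, 2, 3, 4, 5, 6}" using ij by auto
  ultimately have "cartan (e6_flip i) (e6_flip j) = cartan i j" by blast
  then show ?thesis using ij e6_flip_in by (simp only: e6_cartan_eq)
qed

lemma e6_representation_flip: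
  assumes "e6_representation e f h"
  shows "e6_representation (e \<circ> e6_flip) (f \<circ> e6_flip) (h \<circ> e6_flip)"
proof -
  have "inj_on e6_flip {1..6}"
    by (rule eq_card_imp_inj_on[OF finite_atLeastAtMost]) (simp only: e6_flip_image)
  then have inj: "e6_flip i = e6_flip j \<longleftrightarrow> i = j" if "i \<in> {1..6}" "j \<in> {1..6}" for i j
    using that by (simp add: inj_on_eq_iff)
  show ?thesis
    unfolding e6_representation_def
  proof (intro ballI)
    fix i j :: nat assume ij: "i \<in> {1..6}" "j \<in> {1..6}"
    show "lie_bracket ((h \<circ> e6_flip) i) ((h \<circ> e6_flip) j) = 0 \<and>
      lie_bracket ((e \<circ> e6_flip) i) ((f \<circ> e6_flip) j) = (if i = j then (h \<circ> e6_flip) i else 0) \<and>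
      lie_bracket ((h \<circ> e6_flip) i) ((e \<circ> e6_flip) j) = of_int (e6_cartan i j) *m (e \<circ> e6_flip) j \<and>
      lie_bracket ((h \<circ> e6_flip) i) ((f \<circ> e6_flip) j) = - of_int (e6_cartan i j) *m (f \<circ> e6_flip) j \<and>
      (i \<noteq> j \<longrightarrow>
        (lie_bracket ((e \<circ> e6_flip) i) ^^ nat (1 - e6_cartan i j)) ((e \<circ> e6_flip) j) = 0 \<and>
        (lie_bracket ((f \<circ> e6_flip) i) ^^ nat (1 - e6_cartan i j)) ((f \<circ> e6_flip) j) = 0)"
      using assms[unfolded e6_representation_def, rule_format, OF e6_flip_in[OF ij(1)] e6_flip_in[OF ij(2)]]
      unfolding e6_flip_cartan[OF ij] inj[OF ij] o_apply .
  qed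
qed

lemma springer_pair_e6:
  fixes e f h :: "nat \<Rightarrow> complex^'n^'n"
  assumes rep: "e6_representation e f h" and card: "CARD('n) = 27"
    and irreducible: "acts_irreducibly (e6_generated e f h)"
    and inv: "cubic_invariants (e6_generated e f h) d D"
  shows "springer_tensors d D"
proof -
  interpret e6_rep e f h by standard (rule rep)
  obtain v \<nu> where v: "v \<noteq> 0" "weight \<nu> v" and ev: "\<And>i. i \<in> {1..6} \<Longrightarrow> e i *v v = 0"
    and nonneg: "\<And>i. i \<in> {1..6} \<Longrightarrow> 0 \<le> \<nu> i" and zero: "\<And>i. i \<in> {1..6} \<Longrightarrow> \<nu> i = 0 \<Longrightarrow> f i *v v = 0"
    using highest_weight_vector by blast
  have six: "(\<forall>i\<in>{1..6}. P i) \<longleftrightarrow> P 1 \<and> P 2 \<and> P 3 \<and> P 4 \<and> P 5 \<and> P 6" for P :: "nat \<Rightarrow> bool"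
  proof -
    have "{1..6} = {1, 2, 3, 4, 5, 6 :: nat}" by auto
    then show ?thesis by simp
  qed
  have not_above: "\<not> (\<forall>i\<in>{1..6}. l ! i \<le> \<nu> i)" if l: "l \<in> set (map fst excluding_words)" for l
  proof -
    obtain words where "(l, words) \<in> set excluding_words" using l by auto
    from excluded_weight[OF this v(2,1) _ card] show ?thesis by blast
  qed
  have "set (map fst excluding_words) = {[0, 0, 1, 0, 0, 0, 0], [0, 0, 0, 1, 0, 0, 0], [0, 0, 0, 0, 1, 0, 0],
      [0, 0, 0, 0, 0, 1, 0], [0, 2, 0, 0, 0, 0, 0], [0, 1, 0, 0, 0, 0, 1], [0, 0, 0, 0, 0, 0, 2]}"
    by (simp add: excluding_words_def)
  \<comment> \<open>The exclusions force the weight to vanish at the nodes 2, 3, 4, 5, to be at most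
    1 at nodes 1 and 6, and not to be 1 at both.\<close>
  then have "(\<forall>i\<in>{1..6}. \<nu> i = 0) \<or> (\<forall>i\<in>{1..6}. \<nu> i = omega1 ! i) \<or> (\<forall>i\<in>{1..6}. \<nu> (e6_flip i) = omega1 ! i)"
    using not_above[of "[0, 0, 1, 0, 0, 0, 0]"] not_above[of "[0, 0, 0, 1, 0, 0, 0]"]
      not_above[of "[0, 0, 0, 0, 1, 0, 0]"] not_above[of "[0, 0, 0, 0, 0, 1, 0]"]
      not_above[of "[0, 2, 0, 0, 0, 0, 0]"] not_above[of "[0, 1, 0, 0, 0, 0, 1]"]
      not_above[of "[0, 0, 0, 0, 0, 0, 2]"] nonneg[of 1] nonneg[of 2] nonneg[of 3] nonneg[of 4] nonneg[of 5] nonneg[of 6]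
    unfolding six by (simp add: e6_flip_def) presburger
  then show ?thesis
  proof (elim disjE)
    assume "\<forall>i\<in>{1..6}. \<nu> i = omega1 ! i"
    then show ?thesis using springer_pair_omega1[OF card v ev _ inv] by blast
  next
    assume *: "\<forall>i\<in>{1..6}. \<nu> (e6_flip i) = omega1 ! i"
    interpret flip: e6_rep "e \<circ> e6_flip" "f \<circ> e6_flip" "h \<circ> e6_flip"
      by standard (rule e6_representation_flip[OF rep])
    have image: "(g \<circ> e6_flip) ` {1..6} = g ` {1..6}" for g :: "nat \<Rightarrow> complex^'n^'n"
      by (simp only: image_comp[symmetric] e6_flip_image)
    have "e6_generated (e \<circ> e6_flip) (f \<circ> e6_flip) (h \<circ> e6_flip) = e6_generated e f h"
      unfolding e6_generated_def image ..
    moreover have "flip.weight (\<nu> \<circ> e6_flip) v"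
      using v(2) e6_flip_in by (simp add: weight_def flip.weight_def)
    moreover have "(e \<circ> e6_flip) i *v v = 0" if "i \<in> {1..6}" for i
      using ev[OF e6_flip_in[OF that]] by simp
    ultimately show ?thesis
      using flip.springer_pair_omega1[OF card v(1), of "\<nu> \<circ> e6_flip"] * inv by auto
  next
    assume 0: "\<forall>i\<in>{1..6}. \<nu> i = 0"
    \<comment> \<open>At highest weight zero all generators kill v. Its line is then an invariant
      subspace, and irreducibility would make the whole space one-dimensional.\<close>
    have line: "A *v v \<in> vec.span {v}" if "A \<in> e6_generated e f h" for A
    proof -
      have "A *v v = 0"
        using that unfolding e6_generated_def
      proof (induction rule: lie_generated.induct)
        case (base A)
        then show ?case using ev zero 0 v(2) by (auto simp: weight_def)
      next
        case (add A B)
        then show ?case by (simp add: matrix_vector_mult_add_rdistrib)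
      next
        case (scale A c)
        then show ?case by (simp add: scale_apply)
      next
        case (bracket A B)
        then show ?case by (simp add: bracket_apply)
      qed simp
      then show ?thesis by (simp add: vec.span_zero)
    qed
    have "A *v x \<in> vec.span {v}" if "A \<in> e6_generated e f h" "x \<in> vec.span {v}" for A x
      using that line[OF that(1)] by (auto simp: vec.span_singleton matrix_vector_scale)
    then have "vec.span {v} = {0} \<or> vec.span {v} = UNIV"
      using irreducible unfolding acts_irreducibly_def by (simp add: vec.subspace_span)
    moreover have "v \<in> vec.span {v}" by (simp add: vec.span_base)
    ultimately have "vec.span {v} = UNIV" using v(1) by auto
    then have "vec.dim (UNIV :: (complex^'n) set) \<le> card {v}"
      by (intro vec.dim_le_card) auto
    then show ?thesis using card by (simp only: vec_dim_card) simp
  qed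
qed

theorem theorem4p11:
  fixes m :: nat
    and G :: "(complex^'n^'n) set"
    and d D :: "complex^('n \<times> 'n \<times> 'n)"
    and u v :: complex
  assumes "m \<in> {1, 2, 4, 8}"
    and "CARD('n) = 3 * m + 3"
    and "e6_series m G"
    and "cubic_invariants G d D"
    and "u \<noteq> 2 * of_nat m" and "v \<noteq> 2 * of_nat m" and "u + v \<noteq> 2 * of_nat m"
  shows "tensor_id (R_check m d D u) ** id_tensor (R_check m d D (u + v)) ** tensor_id (R_check m d D v)
       = id_tensor (R_check m d D v) ** tensor_id (R_check m d D (u + v)) ** id_tensor (R_check m d D u)"
proof -
  have "springer_tensors d D"
  proof (cases "m = 8")
    case True
    then obtain e f h where rep: "e6_representation e f h"
      and G: "G = lie_generated (e ` {1..6} \<union> f ` {1..6} \<union> h ` {1..6})" and irreducible: "acts_irreducibly G"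
      using assms(3) by (auto simp: e6_series_def)
    have "G = e6_generated e f h" by (simp only: G e6_generated_def)
    then show ?thesis
      using springer_pair_e6[OF rep, of d D] assms(2,4) irreducible True by simp
  next
    case False
    then show ?thesis using springer_pair_classical[of m G d D] assms(1,3,4) by simp
  qed
  then show ?thesis using R_check_yang_baxter[OF _ assms(2,5,6,7)] by blast
qed

end
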